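(* Let $\mu>1$. (a) If $\frac{1-\lfloor\mu\rfloor}{\mu}+1\le s<\frac12$, then there exists $f\in C^\infty(\overline{\Omega_\mu})$ such that $P^0_{\Omega_\mu}f\notin W^s(\Omega_\mu)$. (b) If $\frac1\mu\le s<\frac12$ and $p\in\{1,2\}$, then there exists $f\in C^\infty_{p,0}(\overline{\Omega_\mu})$ such that $P^p_{\Omega_\mu}f\notin W^s_{p,0}(\Omega_\mu)$.
   Context: Let $\tilde M=\mathbb{C}\times(\mathbb{C}\setminus\{0\})$ with Kähler form $\omega_{\tilde M}=\frac i2 dz_1\wedge d\bar z_1+\frac{i}{2|z_2|^2}dz_2\wedge d\bar z_2$. For $\mu>0$, $M_\mu$ is the quotient of $\tilde M$ by the equivalence relation generated by $(z_1,z_2)\sim(e^{2\pi\mu i}z_1,e^{\pi\mu}z_2)$, with the induced Kähler form. Let $\tilde\Omega=\{z\in\tilde M:|z_1+e^{i\log|z_2|^2}|^2<1\}$ and, for $\mu>1$, $\Omega_\mu=\{[z]\in M_\mu:z\in\tilde\Omega\}$; this is a relatively compact domain with smooth boundary in $M_\mu$. For $p\in\{0,1,2\}$, $P^p_{\Omega_\mu}:L^2_{p,0}(\Omega_\mu)\to A^2_{p,0}(\Omega_\mu)$ is the Bergman projection, i.e. the orthogonal projection (with respect to the metric of $M_\mu$) from the square-integrable $(p,0)$-forms on $\Omega_\mu$ onto the square-integrable holomorphic $(p,0)$-forms. $W^s(\Omega_\mu)$ is the usual $L^2$ Sobolev space of (possibly fractional) order $s$, defined by a finite cover of $\overline{\Omega_\mu}$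 by coordinate charts of $M_\mu$ and a partition of unity, elements being locally restrictions of elements of $W^s(\mathbb{C}^2)$. With the frame $\theta^1_z=e^{-i\log|z_2|^2}dz_1$, $\theta^2_z=z_2^{-1}dz_2$ (which descends to a smooth frame on $M_\mu$), $W^s_{1,0}(\Omega_\mu)$ is the space of forms $f_1\theta^1_z+f_2\theta^2_z$ with $f_1,f_2\in W^s(\Omega_\mu)$ and $W^s_{2,0}(\Omega_\mu)$ the space of forms $f\,\theta^1_z\wedge\theta^2_z$ with $f\in W^s(\Omega_\mu)$. $C^\infty_{p,0}(\overline{\Omega_\mu})$ denotes $(p,0)$-forms smooth up to the boundary. *)

theory Defs
  imports "HOL-Analysis.Analysis"
begin

section \<open>Smooth and holomorphic functions on open subsets of the covering space\<close>

primrec Ck_on :: "nat \<Rightarrow> 'a::euclidean_space set \<Rightarrow> ('a \<Rightarrow> 'b::real_normed_vector) \<Rightarrow> bool" where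
  "Ck_on 0 S f \<longleftrightarrow> continuous_on S f"
| "Ck_on (Suc k) S f \<longleftrightarrow> (\<forall>x\<in>S. f differentiable (at x)) \<and>
     (\<forall>b\<in>Basis. Ck_on k S (\<lambda>x. frechet_derivative f (at x) b))"

definition smooth_on :: "'a::euclidean_space set \<Rightarrow> ('a \<Rightarrow> 'b::real_normed_vector) \<Rightarrow> bool" where
  "smooth_on S f \<longleftrightarrow> (\<forall>k. Ck_on k S f)"

text \<open>Holomorphy in two variables: the real derivative at each point is complex linear.\<close>

definition holomorphic2_on :: "(complex \<times> complex) set \<Rightarrow> (complex \<times> complex \<Rightarrow> complex) \<Rightarrow> bool" where
  "holomorphic2_on S f \<longleftrightarrow>
     (\<forall>z\<in>S. \<exists>a b. (f has_derivative (\<lambda>w. a * fst w + b * snd w)) (at z))"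


section \<open>The Sobolev spaces \<open>W\<^sup>s\<close> of a Euclidean space\<close>

definition square_integrable :: "('a::euclidean_space \<Rightarrow> complex) \<Rightarrow> bool" where
  "square_integrable F \<longleftrightarrow>
     F \<in> borel_measurable lborel \<and> integrable lborel (\<lambda>x. (norm (F x))\<^sup>2)"

definition test_function :: "('a::euclidean_space \<Rightarrow> real) \<Rightarrow> bool" where
  "test_function \<phi> \<longleftrightarrow> smooth_on UNIV \<phi> \<and> (\<exists>K. compact K \<and> (\<forall>x. x \<notin> K \<longrightarrow> \<phi> x = 0))"

definition weak_derivative ::
  "'a::euclidean_space \<Rightarrow> ('a \<Rightarrow> complex) \<Rightarrow> ('a \<Rightarrow> complex) \<Rightarrow> bool" where
  "weak_derivative b F G \<longleftrightarrow>
     (\<forall>\<phi>. test_function \<phi> \<longrightarrow>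
        (LINT x|lborel. frechet_derivative \<phi> (at x) b *\<^sub>R F x) = - (LINT x|lborel. \<phi> x *\<^sub>R G x))"

text \<open>Finiteness of the Gagliardo (Slobodeckij) seminorm of order \<open>0 < \<sigma> < 1\<close>. The value of the
  integrand on the diagonal, a null set, is \<open>0\<close> by the convention \<open>x / 0 = 0\<close>.\<close>

definition finite_gagliardo :: "real \<Rightarrow> ('a::euclidean_space \<Rightarrow> complex) \<Rightarrow> bool" where
  "finite_gagliardo \<sigma> F \<longleftrightarrow>
     integrable (lborel \<Otimes>\<^sub>M lborel)
       (\<lambda>(x, y). (norm (F x - F y))\<^sup>2 / norm (x - y) powr (real DIM('a) + 2 * \<sigma>))"

primrec sobolev_aux :: "nat \<Rightarrow> real \<Rightarrow> ('a::euclidean_space \<Rightarrow> complex) \<Rightarrow> bool" where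
  "sobolev_aux 0 \<sigma> F \<longleftrightarrow> square_integrable F \<and> (\<sigma> > 0 \<longrightarrow> finite_gagliardo \<sigma> F)"
| "sobolev_aux (Suc k) \<sigma> F \<longleftrightarrow> square_integrable F \<and>
     (\<forall>b\<in>Basis. \<exists>G. weak_derivative b F G \<and> sobolev_aux k \<sigma> G)"

text \<open>Meaningful for orders \<open>s \<ge> 0\<close> only; functions are genuine (Borel) representatives of
  \<open>L\<^sup>2\<close>-classes.\<close>

definition sobolev_space :: "real \<Rightarrow> ('a::euclidean_space \<Rightarrow> complex) set" where
  "sobolev_space s = {F. sobolev_aux (nat \<lfloor>s\<rfloor>) (frac s) F}"


section \<open>The manifold \<open>M\<^sub>\<mu>\<close>\<close>

type_synonym pt = "(complex \<times> complex) set"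

definition Mtilde :: "(complex \<times> complex) set" where
  "Mtilde = {z. snd z \<noteq> 0}"

definition deck :: "real \<Rightarrow> complex \<times> complex \<Rightarrow> complex \<times> complex" where
  "deck \<mu> z = (exp (2 * pi * \<mu> * \<i>) * fst z, exp (of_real (pi * \<mu>)) * snd z)"

definition deck_rel :: "real \<Rightarrow> ((complex \<times> complex) \<times> (complex \<times> complex)) set" where
  "deck_rel \<mu> = {(z, w). z \<in> Mtilde \<and> w \<in> Mtilde \<and> equivclp (\<lambda>a b. b = deck \<mu> a) z w}"

definition M_mu :: "real \<Rightarrow> pt set" where
  "M_mu \<mu> = Mtilde // deck_rel \<mu>"

definition proj_mu :: "real \<Rightarrow> complex \<times> complex \<Rightarrow> pt" where
  "proj_mu \<mu> z = deck_rel \<mu> `` {z}"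

definition M_top :: "real \<Rightarrow> pt topology" where
  "M_top \<mu> = topology (\<lambda>U. U \<subseteq> M_mu \<mu> \<and> open {z \<in> Mtilde. proj_mu \<mu> z \<in> U})"

text \<open>The Kaehler form is \<open>(i/2) \<Sum>\<^sub>j h\<^sub>j dz\<^sub>j \<and> d\<bar>z\<^sub>j\<close> with the following coefficients \<open>h\<^sub>j\<close>;
  the volume form \<open>\<omega>\<^sup>2 / 2\<close> then has density \<open>h\<^sub>1 h\<^sub>2\<close> with respect to Lebesgue measure.\<close>

definition kahler_coeff :: "nat \<Rightarrow> complex \<times> complex \<Rightarrow> real" where
  "kahler_coeff j z = (if j = 1 then 1 else 1 / (norm (snd z))\<^sup>2)"

definition Mtilde_volume :: "(complex \<times> complex) measure" where
  "Mtilde_volume = density lborel (\<lambda>z. ennreal (kahler_coeff 1 z * kahler_coeff 2 z))"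

text \<open>For \<open>\<mu> > 0\<close> every class has exactly one representative in the following set. Since the
  deck transformations are isometries, the Riemannian volume of \<open>M\<^sub>\<mu>\<close> is the image of the volume
  of this set.\<close>

definition fundamental_domain :: "real \<Rightarrow> (complex \<times> complex) set" where
  "fundamental_domain \<mu> = {z. 1 \<le> norm (snd z) \<and> norm (snd z) < exp (pi * \<mu>)}"

definition M_volume :: "real \<Rightarrow> pt measure" where
  "M_volume \<mu> = distr (restrict_space Mtilde_volume (fundamental_domain \<mu>))
     (sigma (M_mu \<mu>) {U. openin (M_top \<mu>) U}) (proj_mu \<mu>)"


section \<open>The domain \<open>\<Omega>\<^sub>\<mu>\<close>\<close>

definition Omega_tilde :: "(complex \<times> complex) set" where
  "Omega_tilde = {z \<in> Mtilde. (norm (fst z + exp (\<i> * ln ((norm (snd z))\<^sup>2))))\<^sup>2 < 1}"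

definition Omega :: "real \<Rightarrow> pt set" where
  "Omega \<mu> = proj_mu \<mu> ` Omega_tilde"

definition Omega_closure :: "real \<Rightarrow> pt set" where
  "Omega_closure \<mu> = (M_top \<mu>) closure_of (Omega \<mu>)"

definition Omega_volume :: "real \<Rightarrow> pt measure" where
  "Omega_volume \<mu> = restrict_space (M_volume \<mu>) (Omega \<mu>)"

text \<open>Functions smooth up to the boundary: those extending to smooth functions on \<open>M\<^sub>\<mu>\<close>.\<close>

definition smooth_closure :: "real \<Rightarrow> (pt \<Rightarrow> complex) set" where
  "smooth_closure \<mu> = {f. \<exists>F. smooth_on Mtilde (F \<circ> proj_mu \<mu>) \<and> (\<forall>x\<in>Omega_closure \<mu>. f x = F x)}"

text \<open>The charts of \<open>M\<^sub>\<mu>\<close> are the inverses of the covering projection on open sets \<open>V\<close> on which it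
  is injective. The functions \<open>\<eta> j\<close> form a partition of unity over the closure of the domain, with
  the (closed) support of \<open>\<eta> j\<close> contained in the domain \<open>proj_mu \<mu> ` V j\<close> of the \<open>j\<close>-th chart.
  Membership in \<open>W\<^sup>s\<close> does not depend on the choice of \<open>V\<close> and \<open>\<eta>\<close>.\<close>

definition sobolev_Omega :: "real \<Rightarrow> real \<Rightarrow> (pt \<Rightarrow> complex) set" where
  "sobolev_Omega \<mu> s = {f. \<exists>(n::nat) V (\<eta> :: nat \<Rightarrow> pt \<Rightarrow> real).
     (\<forall>j<n. open (V j) \<and> V j \<subseteq> Mtilde \<and> inj_on (proj_mu \<mu>) (V j)) \<and>
     (\<forall>j<n. smooth_on Mtilde (\<eta> j \<circ> proj_mu \<mu>) \<and> (\<forall>x\<in>M_mu \<mu>. 0 \<le> \<eta> j x) \<and>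
        (M_top \<mu>) closure_of {x \<in> M_mu \<mu>. \<eta> j x \<noteq> 0} \<subseteq> proj_mu \<mu> ` V j) \<and>
     (\<forall>x\<in>Omega_closure \<mu>. (\<Sum>j<n. \<eta> j x) = 1) \<and>
     (\<forall>j<n. \<exists>F\<in>sobolev_space s. AE z in lborel. z \<in> V j \<inter> Omega_tilde \<longrightarrow>
        F z = of_real (\<eta> j (proj_mu \<mu> z)) * f (proj_mu \<mu> z))}"


section \<open>Forms of type \<open>(p,0)\<close>\<close>

text \<open>A \<open>(p,0)\<close>-form is given by its coefficients \<open>u I\<close>, where \<open>I\<close> ranges over the \<open>p\<close>-element
  subsets of \<open>{1,2}\<close>, in the global smooth frame of exterior products \<open>\<theta>\<^sup>I\<close> of
  \<open>\<theta>\<^sup>1 = e\<^bsup>-i log |z\<^sub>2|\<^sup>2\<^esup> dz\<^sub>1\<close> and \<open>\<theta>\<^sup>2 = z\<^sub>2\<^bsup>-1\<^esup> dz\<^sub>2\<close>. For \<open>p = 0\<close> the only index is the empty set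
  and forms are functions. Values \<open>u I\<close> at other \<open>I\<close> are irrelevant.\<close>

type_synonym form = "nat set \<Rightarrow> pt \<Rightarrow> complex"

definition form_index :: "nat \<Rightarrow> nat set set" where
  "form_index p = {I. I \<subseteq> {1, 2} \<and> card I = p}"

text \<open>\<open>\<theta>\<^sup>j = frame_coeff j z dz\<^sub>j\<close>\<close>

definition frame_coeff :: "nat \<Rightarrow> complex \<times> complex \<Rightarrow> complex" where
  "frame_coeff j z = (if j = 1 then exp (- (\<i> * ln ((norm (snd z))\<^sup>2))) else inverse (snd z))"

definition smooth_forms_closure :: "real \<Rightarrow> nat \<Rightarrow> form set" where
  "smooth_forms_closure \<mu> p = {u. \<forall>I\<in>form_index p. u I \<in> smooth_closure \<mu>}"

definition sobolev_forms :: "real \<Rightarrow> real \<Rightarrow> nat \<Rightarrow> form set" where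
  "sobolev_forms \<mu> s p = {u. \<forall>I\<in>form_index p. u I \<in> sobolev_Omega \<mu> s}"

definition L2_forms :: "real \<Rightarrow> nat \<Rightarrow> form set" where
  "L2_forms \<mu> p = {u. \<forall>I\<in>form_index p. u I \<in> borel_measurable (Omega_volume \<mu>) \<and>
     integrable (Omega_volume \<mu>) (\<lambda>x. (norm (u I x))\<^sup>2)}"

text \<open>The frame is orthonormal: \<open>\<omega> = (i/2) \<Sum>\<^sub>j \<theta>\<^sup>j \<and> \<bar>\<theta>\<^sup>j\<close>, see \<open>kahler_coeff_frame\<close> below. Hence so
  is the frame \<open>\<theta>\<^sup>I\<close> of the \<open>(p,0)\<close>-forms, and the \<open>L\<^sup>2\<close> inner product takes this form.\<close>

definition L2_inner :: "real \<Rightarrow> nat \<Rightarrow> form \<Rightarrow> form \<Rightarrow> complex" where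
  "L2_inner \<mu> p u v = (LINT x|Omega_volume \<mu>. (\<Sum>I\<in>form_index p. u I x * cnj (v I x)))"

text \<open>A form is holomorphic iff the coefficients of its pullback to the covering space, with respect
  to \<open>dz\<^sub>1\<close>, \<open>dz\<^sub>2\<close> (not the frame), are holomorphic.\<close>

definition holomorphic_form :: "real \<Rightarrow> nat \<Rightarrow> form \<Rightarrow> bool" where
  "holomorphic_form \<mu> p u \<longleftrightarrow>
     (\<forall>I\<in>form_index p.
        holomorphic2_on Omega_tilde (\<lambda>z. u I (proj_mu \<mu> z) * (\<Prod>j\<in>I. frame_coeff j z)))"

text \<open>Elements of the Bergman space are required to vanish at arguments without meaning (indices
  outside \<open>form_index p\<close>, points outside the domain), so that the projection is unique.\<close>

definition bergman_space :: "real \<Rightarrow> nat \<Rightarrow> form set" where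
  "bergman_space \<mu> p = {u \<in> L2_forms \<mu> p. holomorphic_form \<mu> p u \<and>
     (\<forall>I x. I \<notin> form_index p \<or> x \<notin> Omega \<mu> \<longrightarrow> u I x = 0)}"

definition bergman_proj :: "real \<Rightarrow> nat \<Rightarrow> form \<Rightarrow> form" where
  "bergman_proj \<mu> p f = (THE g. g \<in> bergman_space \<mu> p \<and>
     (\<forall>h\<in>bergman_space \<mu> p. L2_inner \<mu> p (\<lambda>I x. f I x - g I x) h = 0))"


section \<open>Consistency of the conventions\<close>

lemma open_Mtilde: "open Mtilde"
proof -
  have "Mtilde = snd -` (- {0::complex})" by (auto simp: Mtilde_def)
  then show ?thesis by (metis open_vimage_snd open_Compl closed_singleton)
qed

lemma istopology_M: "istopology (\<lambda>U. U \<subseteq> M_mu \<mu> \<and> open {z \<in> Mtilde. proj_mu \<mu> z \<in> U})"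
  unfolding istopology_def
proof (intro conjI allI impI)
  fix S T
  assume S: "S \<subseteq> M_mu \<mu> \<and> open {z \<in> Mtilde. proj_mu \<mu> z \<in> S}"
    and T: "T \<subseteq> M_mu \<mu> \<and> open {z \<in> Mtilde. proj_mu \<mu> z \<in> T}"
  show "S \<inter> T \<subseteq> M_mu \<mu>" using S by auto
  have "{z \<in> Mtilde. proj_mu \<mu> z \<in> S \<inter> T} =
      {z \<in> Mtilde. proj_mu \<mu> z \<in> S} \<inter> {z \<in> Mtilde. proj_mu \<mu> z \<in> T}" by auto
  then show "open {z \<in> Mtilde. proj_mu \<mu> z \<in> S \<inter> T}" using S T by (simp add: open_Int)
next
  fix K
  assume K: "\<forall>S\<in>K. S \<subseteq> M_mu \<mu> \<and> open {z \<in> Mtilde. proj_mu \<mu> z \<in> S}"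
  show "\<Union> K \<subseteq> M_mu \<mu>" using K by auto
  have "{z \<in> Mtilde. proj_mu \<mu> z \<in> \<Union> K} = (\<Union>S\<in>K. {z \<in> Mtilde. proj_mu \<mu> z \<in> S})" by auto
  then show "open {z \<in> Mtilde. proj_mu \<mu> z \<in> \<Union> K}" using K by (simp add: open_UN)
qed

lemma openin_M_top:
  "openin (M_top \<mu>) U \<longleftrightarrow> U \<subseteq> M_mu \<mu> \<and> open {z \<in> Mtilde. proj_mu \<mu> z \<in> U}"
  unfolding M_top_def using topology_inverse'[OF istopology_M] by simp

lemma equiv_deck_rel: "equiv Mtilde (deck_rel \<mu>)"
proof (rule equivI)
  show "deck_rel \<mu> \<subseteq> Mtilde \<times> Mtilde" by (auto simp: deck_rel_def)
  show "refl_on Mtilde (deck_rel \<mu>)" by (auto simp: refl_on_def deck_rel_def)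
  show "sym (deck_rel \<mu>)" by (auto simp: sym_def deck_rel_def intro: equivclp_sym)
  show "trans (deck_rel \<mu>)" by (auto simp: trans_def deck_rel_def intro: equivclp_trans)
qed

lemma kahler_coeff_frame:
  "kahler_coeff j z = (norm (frame_coeff j z))\<^sup>2"
  by (simp add: kahler_coeff_def frame_coeff_def norm_inverse power_inverse inverse_eq_divide
      norm_divide power_divide)

lemma Omega_tilde_deck:
  assumes "z \<in> Mtilde"
  shows "deck \<mu> z \<in> Omega_tilde \<longleftrightarrow> z \<in> Omega_tilde"
    and "deck \<mu> z \<in> Mtilde"
    and "frame_coeff 1 (deck \<mu> z) * exp (2 * pi * \<mu> * \<i>) = frame_coeff 1 z"
    and "frame_coeff 2 (deck \<mu> z) * exp (of_real (pi * \<mu>)) = frame_coeff 2 z"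
proof -
  have nz: "norm (snd z) > 0" using assms by (simp add: Mtilde_def)
  have l: "ln ((norm (snd (deck \<mu> z)))\<^sup>2) = 2 * pi * \<mu> + ln ((norm (snd z))\<^sup>2)"
    using nz by (simp add: deck_def norm_mult power_mult_distrib ln_mult ln_realpow)
  have e: "exp (\<i> * ln ((norm (snd (deck \<mu> z)))\<^sup>2)) =
      exp (2 * pi * \<mu> * \<i>) * exp (\<i> * ln ((norm (snd z))\<^sup>2))"
    unfolding l by (simp add: exp_add[symmetric] algebra_simps)
  show M: "deck \<mu> z \<in> Mtilde" using nz by (simp add: Mtilde_def deck_def)
  have "norm (fst (deck \<mu> z) + exp (\<i> * ln ((norm (snd (deck \<mu> z)))\<^sup>2))) =
      norm (exp (2 * pi * \<mu> * \<i>) * (fst z + exp (\<i> * ln ((norm (snd z))\<^sup>2))))"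
    unfolding e by (simp add: deck_def algebra_simps)
  also have "\<dots> = norm (fst z + exp (\<i> * ln ((norm (snd z))\<^sup>2)))" by (simp add: norm_mult)
  finally show "deck \<mu> z \<in> Omega_tilde \<longleftrightarrow> z \<in> Omega_tilde"
    using M assms by (simp add: Omega_tilde_def)
  show "frame_coeff 1 (deck \<mu> z) * exp (2 * pi * \<mu> * \<i>) = frame_coeff 1 z"
    using e by (simp add: frame_coeff_def exp_minus field_simps)
  show "frame_coeff 2 (deck \<mu> z) * exp (of_real (pi * \<mu>)) = frame_coeff 2 z"
    using nz by (simp add: frame_coeff_def deck_def field_simps)
qed

end

theory Submission
  imports Defs "HOL-Complex_Analysis.Cauchy_Integral_Formula"
begin

text \<open>Write \<open>\<theta> = log |z\<^sub>2|\<^sup>2\<close> and \<open>v = - z\<^sub>1 e\<^bsup>-i\<theta>\<^esup>\<close>. The domain is \<open>|v - 1| < 1\<close>, and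
\<open>(v, t, \<phi>) \<mapsto> (- e\<^bsup>it\<^esup> v, e\<^bsup>t/2 + i\<phi>\<^esup>)\<close> identifies its quotient with the product of a disc and a torus on which
\<open>t\<close> has period \<open>2\<pi>\<mu>\<close>. In these coordinates the volume is half of Lebesgue measure (lemma
\<open>Omega_volume_eq_distr\<close>). The translations of the torus are holomorphic isometries, so the
Bergman spaces split into their weight spaces. The weights of interest are \<open>k / \<mu>\<close> in \<open>t\<close> and \<open>0\<close> in \<open>\<phi>\<close>.

Each of these weight spaces is at most one-dimensional in every frame component. Averaging a holomorphic
coefficient against \<open>e\<^bsup>-ikt/\<mu>\<^esup>\<close> over the torus gives a function \<open>J\<close> of \<open>v\<close> alone; the Cauchy-Riemann
equations express \<open>v J'\<close> by derivatives along the torus, and integration by parts turns them into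
\<open>v J' = b J\<close> with \<open>b = k / \<mu> - 1\<close> if \<open>\<theta>\<^sup>1\<close> occurs in the component and \<open>b = k / \<mu>\<close> otherwise (lemma
\<open>torus_integral_eq_powr\<close>). Hence \<open>J\<close> is a multiple of \<open>v\<^sup>b\<close>. Conversely \<open>v\<^sup>b e\<^bsup>ik\<theta>/\<mu>\<^esup>\<close> is the coefficient of
a holomorphic form, and it is square integrable for \<open>b > -1\<close>.

The form with the single coefficient \<open>e\<^bsup>ik\<theta>/\<mu>\<^esup>\<close> is smooth on the whole manifold. Its Bergman projection has
the coefficient \<open>c v\<^sup>b e\<^bsup>ik\<theta>/\<mu>\<^esup>\<close>, where \<open>c\<close> is the conjugate of the integral of \<open>v\<^sup>b\<close> over the disc up to
a positive factor; it does not vanish because \<open>v\<^sup>b\<close> has positive real part there (lemma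
\<open>bergman_proj_phase\<close>).

For \<open>-1 < b < 0\<close> this coefficient blows up like \<open>|z\<^sub>1|\<^sup>b\<close> at the boundary points with \<open>z\<^sub>1 = 0\<close>, a set of real
codimension two. Every dyadic scale \<open>|z\<^sub>1| \<approx> \<rho>\<close> contributes about \<open>\<rho>\<^bsup>2b + 2 - 2s\<^esup>\<close> to the Gagliardo
seminorm of order \<open>s\<close>, so the seminorm is infinite as soon as \<open>s \<ge> 1 + b\<close> (lemma
\<open>gagliardo_edge_power_infinite\<close>). The weight \<open>k = 1 - \<lfloor>\<mu>\<rfloor>\<close> for functions gives
\<open>1 + b = (1 - \<lfloor>\<mu>\<rfloor>) / \<mu> + 1\<close>, and \<open>k = 1\<close> for forms of positive degree gives \<open>1 + b = 1 / \<mu>\<close>.\<close>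

section \<open>Rotations and logarithmic polar coordinates in the plane\<close>

text \<open>The change of variables theorem and the invariance of Lebesgue measure under orthogonal maps concern
\<open>real^2\<close>; this isometry carries them over to the complex plane.\<close>

definition complex_of_vec :: "real^2 \<Rightarrow> complex" where
  "complex_of_vec x = Complex (x $ 1) (x $ 2)"

definition vec_of_complex :: "complex \<Rightarrow> real^2" where
  "vec_of_complex z = vector [Re z, Im z]"

lemma vec_of_complex_inverse [simp]: "complex_of_vec (vec_of_complex z) = z"
  by (simp add: complex_of_vec_def vec_of_complex_def)

lemma complex_of_vec_inverse [simp]: "vec_of_complex (complex_of_vec x) = x"
  by (simp add: complex_of_vec_def vec_of_complex_def vec_eq_iff forall_2)

lemma continuous_complex_of_vec: "continuous_on UNIV complex_of_vec"
  unfolding complex_of_vec_def Complex_eq by (intro continuous_intros)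

lemma measurable_complex_of_vec [measurable]: "complex_of_vec \<in> borel_measurable borel"
  by (rule borel_measurable_continuous_onI[OF continuous_complex_of_vec])

lemma Basis_vec2: "(Basis :: (real^2) set) = {axis 1 1, axis 2 1}"
  by (auto simp: Basis_vec_def UNIV_2)

lemma vimage_box_complex_of_vec:
  "complex_of_vec -` box l u = box (vec_of_complex l) (vec_of_complex u)"
  by (auto simp: box_def Basis_complex_def Basis_vec2 complex_of_vec_def vec_of_complex_def
      inner_axis)

lemma lborel_complex_of_vec: "distr lborel borel complex_of_vec = lborel"
proof (rule lborel_eqI[symmetric])
  fix l u :: complex
  assume le': "\<And>b. b \<in> Basis \<Longrightarrow> l \<bullet> b \<le> u \<bullet> b"
  have le: "Re l \<le> Re u" "Im l \<le> Im u"
    using le'[of 1] le'[of \<i>] by (simp_all add: Basis_complex_def)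
  have ne: "axis 1 1 \<noteq> (axis 2 1 :: real^2)" by (simp add: axis_eq_axis)
  show "emeasure (distr lborel borel complex_of_vec) (box l u) = (\<Prod>b\<in>Basis. (u - l) \<bullet> b)"
    using le ne
    by (simp add: emeasure_distr vimage_box_complex_of_vec emeasure_lborel_box_eq Basis_vec2
        Basis_complex_def vec_of_complex_def inner_axis)
qed simp

lemma emeasure_complex_of_vec:
  assumes "A \<in> sets borel"
  shows "emeasure lborel A = emeasure lborel (complex_of_vec -` A)"
proof -
  have "emeasure lborel A = emeasure (distr lborel borel complex_of_vec) A"
    by (simp add: lborel_complex_of_vec)
  then show ?thesis using assms by (simp add: emeasure_distr)
qed

lemma linear_vec_of_complex: "linear vec_of_complex"
  by (rule linearI) (auto simp: vec_of_complex_def vec_eq_iff forall_2)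

lemma linear_complex_of_vec: "linear complex_of_vec"
  by (rule linearI) (auto simp: complex_of_vec_def complex_eq_iff)

lemma inner_vec_of_complex: "vec_of_complex z \<bullet> vec_of_complex w = z \<bullet> w"
  by (simp add: vec_of_complex_def inner_vec_def UNIV_2 inner_complex_def)

lemma inner_complex_of_vec: "complex_of_vec x \<bullet> complex_of_vec y = x \<bullet> y"
  by (simp add: complex_of_vec_def inner_vec_def UNIV_2 inner_complex_def)

lemma norm_complex_of_vec: "norm (complex_of_vec x) = norm x"
  by (simp add: norm_eq_sqrt_inner inner_complex_of_vec)

text \<open>A rotation of the plane is an orthogonal map of \<open>real^2\<close> and therefore preserves the measure of boxes,
which determine Lebesgue measure.\<close>

lemma lborel_rotation:
  fixes c :: complex
  assumes "norm c = 1"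
  shows "distr lborel borel (\<lambda>z. c * z) = lborel"
proof (rule lborel_eqI[symmetric])
  fix l u :: complex
  assume le: "\<And>b. b \<in> Basis \<Longrightarrow> l \<bullet> b \<le> u \<bullet> b"
  define T where "T x = vec_of_complex (cnj c * complex_of_vec x)" for x
  have unit: "c * cnj c = 1" using assms by (simp add: complex_mult_cnj complex_norm cmod_def power2_eq_square)
  have cancel: "c * (cnj c * z) = z" "cnj c * (c * z) = z" for z
    using unit by (simp_all add: mult.assoc[symmetric] mult.commute)
  have inner: "(cnj c * z) \<bullet> (cnj c * w) = z \<bullet> w" for z w
  proof -
    have "(cnj c * z) \<bullet> (cnj c * w) = Re ((c * cnj c) * (z * cnj w))"
      by (simp add: inner_complex_def algebra_simps)
    also have "\<dots> = z \<bullet> w" unfolding unit by (simp add: inner_complex_def)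
    finally show ?thesis .
  qed
  have lin: "linear T"
    unfolding T_def
    by (rule linearI) (auto simp: linear_add[OF linear_complex_of_vec] linear_cmul[OF linear_complex_of_vec]
       linear_add[OF linear_vec_of_complex] linear_cmul[OF linear_vec_of_complex] ring_distribs)
  have T: "orthogonal_transformation T"
    unfolding orthogonal_transformation_def using lin
    by (simp add: T_def inner_vec_of_complex inner inner_complex_of_vec)
  let ?B = "box (vec_of_complex l) (vec_of_complex u)"
  have pre: "complex_of_vec -` ((\<lambda>z. c * z) -` box l u) = T ` ?B"
  proof -
    have "x \<in> T ` ?B" if "c * complex_of_vec x \<in> box l u" for x
    proof (rule image_eqI)
      show "vec_of_complex (c * complex_of_vec x) \<in> ?B"
        using that by (simp flip: vimage_box_complex_of_vec)
      show "x = T (vec_of_complex (c * complex_of_vec x))"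
        by (simp add: T_def cancel)
    qed
    moreover have "c * complex_of_vec (T x) \<in> box l u" if "x \<in> ?B" for x
      using that by (simp add: T_def cancel flip: vimage_box_complex_of_vec)
    ultimately show ?thesis by auto
  qed
  have m: "(\<lambda>z. c * z) -` box l u \<in> sets borel"
    using measurable_sets[of "\<lambda>z. c * z" borel borel "box l u"] by simp
  have "emeasure (distr lborel borel (\<lambda>z. c * z)) (box l u) = emeasure lborel ((\<lambda>z. c * z) -` box l u)"
    by (simp add: emeasure_distr)
  also have "\<dots> = emeasure lborel (T ` ?B)"
    using emeasure_complex_of_vec[OF m] pre by simp
  also have "\<dots> = emeasure lebesgue (T ` ?B)"
    using measurable_sets_borel[OF measurable_complex_of_vec m] by (simp add: pre)
  also have "\<dots> = measure lebesgue (T ` ?B)"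
    by (intro emeasure_eq_measure2 measurable_orthogonal_image[OF T]) simp
  also have "\<dots> = measure lebesgue ?B"
    by (simp add: measure_orthogonal_image[OF T])
  also have "\<dots> = emeasure lborel ?B"
    by (subst emeasure_eq_measure2[symmetric]) simp_all
  also have "\<dots> = emeasure lborel (box l u)"
    by (simp add: emeasure_complex_of_vec vimage_box_complex_of_vec)
  finally show "emeasure (distr lborel borel (\<lambda>z. c * z)) (box l u) = (\<Prod>b\<in>Basis. (u - l) \<bullet> b)"
    using le by (simp add: emeasure_lborel_box_eq)
qed simp

text \<open>The exponential map with the real part halved, so that the first coordinate is \<open>log |z|\<^sup>2\<close>.\<close>

definition log_polar :: "real \<times> real \<Rightarrow> complex" where
  "log_polar p = exp (of_real (fst p / 2) + \<i> * of_real (snd p))"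

lemma log_polar_nonzero [simp]: "log_polar p \<noteq> 0" by (simp add: log_polar_def)

lemma norm_log_polar: "norm (log_polar p) = exp (fst p / 2)"
  by (simp add: log_polar_def norm_exp_eq_Re)

lemma continuous_log_polar: "continuous_on UNIV log_polar"
  unfolding log_polar_def by (intro continuous_intros) auto

lemma continuous_on_log_polar [continuous_intros]:
  "continuous_on S f \<Longrightarrow> continuous_on S (\<lambda>x. log_polar (f x))"
  by (rule continuous_on_compose2[OF continuous_log_polar]) auto

lemma measurable_log_polar [measurable]: "log_polar \<in> borel_measurable borel"
  by (rule borel_measurable_continuous_onI[OF continuous_log_polar])

lemma log_polar_eq_iff_strip:
  assumes "0 < snd p" "snd p < 2 * pi" "0 < snd q" "snd q < 2 * pi" "log_polar p = log_polar q"
  shows "p = q"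
proof -
  have "exp (fst p / 2) = exp (fst q / 2)"
    using norm_log_polar[of p] norm_log_polar[of q] assms(5) by simp
  then have f: "fst p = fst q" by simp
  then have "exp (\<i> * of_real (snd p)) = exp (\<i> * of_real (snd q))"
    using assms(5) by (simp add: log_polar_def exp_add)
  then obtain n :: int where "\<i> * of_real (snd p) = \<i> * of_real (snd q) + of_int (2 * n) * (of_real pi * \<i>)"
    by (auto simp: exp_eq)
  then have "snd p = snd q + 2 * n * pi" by (simp add: complex_eq_iff)
  moreover from this have "real_of_int n * (2 * pi) < 1 * (2 * pi)" "(- 1) * (2 * pi) < real_of_int n * (2 * pi)"
    using assms(1-4) by linarith+
  then have "real_of_int n < 1" "- 1 < real_of_int n"
    by (simp_all only: mult_less_cancel_right_pos pi_gt_zero zero_less_mult_iff zero_less_numeral simp_thms)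
  then have "n = 0" by linarith
  ultimately have "snd p = snd q" by simp
  with f show ?thesis by (simp add: prod_eq_iff)
qed

lemma log_polar_surj_strip:
  assumes "z \<noteq> 0"
  obtains p where "z = log_polar p" "fst p = 2 * ln (norm z)" "0 \<le> snd p" "snd p < 2 * pi"
proof
  show "z = log_polar (2 * ln (norm z), Arg2pi z)"
    using Arg2pi_eq[of z] assms by (simp add: log_polar_def exp_add exp_of_real)
qed (use Arg2pi[of z] in auto)

text \<open>Parameters are kept as pairs, for which iterated integrals are convenient; the change of variables
needs them as vectors.\<close>

definition plane_of_vec :: "real^2 \<Rightarrow> real \<times> real" where
  "plane_of_vec x = (x $ 1, x $ 2)"

lemma measurable_plane_of_vec [measurable]: "plane_of_vec \<in> borel_measurable borel"
  unfolding plane_of_vec_def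
  by (intro borel_measurable_continuous_onI continuous_intros)

lemma vimage_box_plane_of_vec:
  "plane_of_vec -` box l u = box (vector [fst l, snd l]) (vector [fst u, snd u])"
  by (auto simp: box_def Basis_prod_def Basis_vec2 plane_of_vec_def inner_axis inner_prod_def)

lemma lborel_plane_of_vec: "distr lborel borel plane_of_vec = lborel"
proof (rule lborel_eqI[symmetric])
  fix l u :: "real \<times> real"
  assume le': "\<And>b. b \<in> Basis \<Longrightarrow> l \<bullet> b \<le> u \<bullet> b"
  have le: "fst l \<le> fst u" "snd l \<le> snd u"
    using le'[of "(1, 0)"] le'[of "(0, 1)"] by (simp_all add: Basis_prod_def inner_prod_def)
  have ne: "axis 1 1 \<noteq> (axis 2 1 :: real^2)" by (simp add: axis_eq_axis)
  show "emeasure (distr lborel borel plane_of_vec) (box l u) = (\<Prod>b\<in>Basis. (u - l) \<bullet> b)"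
    using le ne
    by (simp add: emeasure_distr vimage_box_plane_of_vec emeasure_lborel_box_eq Basis_vec2
        Basis_prod_def inner_axis inner_prod_def mult.commute)
qed simp

definition log_polar_vec :: "real^2 \<Rightarrow> real^2" where
  "log_polar_vec x = vec_of_complex (log_polar (plane_of_vec x))"

definition log_polar_vec' :: "real^2 \<Rightarrow> real^2 \<Rightarrow> real^2" where
  "log_polar_vec' x h =
     vec_of_complex (log_polar (plane_of_vec x) * Complex (h $ 1 / 2) (h $ 2))"

lemma bounded_linear_vec_of_complex: "bounded_linear vec_of_complex"
  using linear_vec_of_complex by (simp add: linear_conv_bounded_linear)

lemma has_derivative_log_polar:
  "(log_polar has_derivative (\<lambda>h. log_polar p * (of_real (fst h / 2) + \<i> * of_real (snd h)))) (at p within S)"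
proof -
  have "((\<lambda>p. complex_of_real (fst p / 2) + \<i> * of_real (snd p)) has_derivative
      (\<lambda>h. of_real (fst h / 2) + \<i> * of_real (snd h))) (at p within S)"
    by (auto intro!: derivative_eq_intros)
  from has_derivative_compose[OF this DERIV_exp[THEN has_field_derivative_imp_has_derivative]] show ?thesis
    unfolding log_polar_def by (simp add: mult.commute)
qed

lemma log_polar_vec_has_derivative:
  "(log_polar_vec has_derivative log_polar_vec' x) (at x within S)"
proof -
  have "bounded_linear plane_of_vec"
    unfolding plane_of_vec_def
    by (intro bounded_linear_Pair bounded_linear_vec_nth)
  then have 1: "(plane_of_vec has_derivative plane_of_vec) (at x within S)"
    by (rule bounded_linear_imp_has_derivative)
  have 2: "((\<lambda>x. log_polar (plane_of_vec x)) has_derivative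
     (\<lambda>h. log_polar (plane_of_vec x) * (of_real (fst (plane_of_vec h) / 2) + \<i> * of_real (snd (plane_of_vec h))))) (at x within S)"
    by (rule has_derivative_compose[OF 1 has_derivative_log_polar])
  have "(log_polar_vec has_derivative (\<lambda>h. vec_of_complex (log_polar (plane_of_vec x) * (of_real (fst (plane_of_vec h) / 2) + \<i> * of_real (snd (plane_of_vec h)))))) (at x within S)"
    unfolding log_polar_vec_def
    by (rule bounded_linear.has_derivative[OF bounded_linear_vec_of_complex 2])
  then show ?thesis
    by (simp add: log_polar_vec'_def[abs_def] plane_of_vec_def Complex_eq)
qed

text \<open>The Jacobian of a holomorphic map is the squared norm of its derivative; the factor \<open>1/2\<close> comes from
the halved real part.\<close>

lemma det_log_polar_vec: "det (matrix (log_polar_vec' x)) = exp (x $ 1) / 2"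
proof -
  define w where "w = log_polar (plane_of_vec x)"
  have "det (matrix (log_polar_vec' x)) = ((Re w)\<^sup>2 + (Im w)\<^sup>2) / 2"
    by (simp add: det_2 matrix_def log_polar_vec'_def vec_of_complex_def axis_def
        power2_eq_square field_simps flip: w_def)
  also have "(Re w)\<^sup>2 + (Im w)\<^sup>2 = (norm w)\<^sup>2" by (simp add: cmod_power2)
  also have "\<dots> = exp (x $ 1)"
    by (simp add: w_def norm_log_polar plane_of_vec_def power2_eq_square flip: exp_add)
  finally show ?thesis .
qed

definition annulus :: "real \<Rightarrow> complex set" where
  "annulus T = {z. 1 \<le> norm z \<and> norm z < exp (T / 2)}"

text \<open>The density \<open>1 / |z|\<^sup>2\<close> cancels the exponential in the Jacobian, so logarithmic polar coordinates turn
it into a constant. The change of variables is applied to the open strip, which parametrises the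
annulus without the positive real axis and its boundary circles; what is missing on either side is a
null set.\<close>

lemma emeasure_annulus_log_polar:
  assumes T: "T > 0" and A [measurable]: "A \<in> sets borel"
  shows "(\<integral>\<^sup>+z. ennreal (1 / (norm z)\<^sup>2) * indicator (A \<inter> annulus T) z \<partial>lborel) =
    ennreal (1 / 2) * emeasure lborel (cbox (0, 0) (T, 2 * pi) \<inter> log_polar -` A)"
proof -
  define slit where "slit = {z :: complex. 1 < norm z \<and> norm z < exp (T / 2) \<and> z \<notin> \<real>\<^sub>\<ge>\<^sub>0}"
  define Q where "Q = box (vector [0, 0]) (vector [T, 2 * pi] :: real^2)"
  define S where "S = Q \<inter> (\<lambda>x. log_polar (plane_of_vec x)) -` A"
  have Q_iff: "x \<in> Q \<longleftrightarrow> 0 < x $ 1 \<and> x $ 1 < T \<and> 0 < x $ 2 \<and> x $ 2 < 2 * pi" for x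
    by (auto simp: Q_def box_def Basis_vec2 inner_axis)
  have "open slit"
  proof -
    have "slit = {z. 1 < norm z} \<inter> {z. norm z < exp (T / 2)} \<inter> - \<real>\<^sub>\<ge>\<^sub>0"
      by (auto simp: slit_def)
    then show ?thesis
      by (auto intro!: open_Int open_Collect_less continuous_intros closed_nonneg_Reals_complex simp: open_Compl)
  qed
  then have [measurable]: "slit \<in> sets borel" by simp
  have [measurable]: "annulus T \<in> sets borel" unfolding annulus_def by measurable
  have [measurable]: "Q \<in> sets borel" by (simp add: Q_def)
  have S [measurable]: "S \<in> sets borel"
    unfolding S_def using measurable_sets_borel[OF _ A, where f = "\<lambda>x. log_polar (plane_of_vec x)"] by simp
  have S_fin: "emeasure lborel S < \<infinity>"
    by (rule le_less_trans[OF emeasure_mono[of _ Q]]) (auto simp: S_def, auto simp: Q_def emeasure_lborel_box_eq)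
  have S_leb: "S \<in> lmeasurable"
    using S_fin by (intro fmeasurableI) (auto simp: sets_completionI_sets)
  have im: "log_polar_vec ` S = complex_of_vec -` (A \<inter> slit)"
  proof (intro subset_antisym subsetI)
    fix y assume "y \<in> log_polar_vec ` S"
    then obtain x where x: "x \<in> S" "y = log_polar_vec x" by auto
    let ?w = "log_polar (plane_of_vec x)"
    have 1: "1 < norm ?w" "norm ?w < exp (T / 2)"
      using x(1) by (simp_all add: S_def Q_iff norm_log_polar plane_of_vec_def)
    have "?w \<notin> \<real>\<^sub>\<ge>\<^sub>0"
    proof
      assume "?w \<in> \<real>\<^sub>\<ge>\<^sub>0"
      then have "Arg2pi ?w = 0" by (simp add: Arg2pi_eq_0 complex_nonneg_Reals_iff complex_is_Real_iff)
      moreover have "Arg2pi ?w = x $ 2"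
        by (rule Arg2pi_unique[of "exp (x $ 1 / 2)"])
          (use x(1) in \<open>simp_all add: S_def Q_iff log_polar_def plane_of_vec_def exp_add flip: exp_of_real\<close>)
      ultimately show False using x(1) by (simp add: S_def Q_iff)
    qed
    with 1 x show "y \<in> complex_of_vec -` (A \<inter> slit)"
      by (simp add: log_polar_vec_def slit_def S_def)
  next
    fix y assume y: "y \<in> complex_of_vec -` (A \<inter> slit)"
    let ?z = "complex_of_vec y"
    have "?z \<noteq> 0" using y by (auto simp: slit_def)
    then obtain p where p: "?z = log_polar p" "fst p = 2 * ln (norm ?z)" "0 \<le> snd p" "snd p < 2 * pi"
      by (rule log_polar_surj_strip)
    have "snd p \<noteq> 0"
    proof
      assume "snd p = 0"
      then have "?z = of_real (exp (fst p / 2))" using p(1) by (simp add: log_polar_def flip: exp_of_real)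
      then have "?z \<in> \<real>\<^sub>\<ge>\<^sub>0" by (simp only: nonneg_Reals_of_real_iff) simp
      with y show False by (simp add: slit_def)
    qed
    moreover have "0 < fst p" "fst p < T"
    proof -
      have "exp 0 < exp (fst p / 2)" "exp (fst p / 2) < exp (T / 2)"
        using y norm_log_polar[of p] by (auto simp: slit_def p(1))
      then show "0 < fst p" "fst p < T" by simp_all
    qed
    moreover have v: "plane_of_vec (vector [fst p, snd p]) = p" by (simp add: plane_of_vec_def)
    ultimately have "vector [fst p, snd p] \<in> S"
      using p(1,3,4) y unfolding S_def by (simp add: Q_iff)
    moreover have "y = log_polar_vec (vector [fst p, snd p])"
      by (simp add: log_polar_vec_def v flip: p(1))
    ultimately show "y \<in> log_polar_vec ` S" by blast
  qed
  have inj: "inj_on log_polar_vec S"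
  proof (rule inj_onI)
    fix x y assume xy: "x \<in> S" "y \<in> S" "log_polar_vec x = log_polar_vec y"
    then have "log_polar (plane_of_vec x) = log_polar (plane_of_vec y)"
      by (metis log_polar_vec_def vec_of_complex_inverse)
    then have "plane_of_vec x = plane_of_vec y"
      using xy by (intro log_polar_eq_iff_strip) (auto simp: S_def Q_iff plane_of_vec_def)
    then show "x = y" by (simp add: plane_of_vec_def vec_eq_iff forall_2)
  qed
  have jac: "\<bar>det (matrix (log_polar_vec' x))\<bar> *\<^sub>R (vec (1 / (norm (log_polar_vec x))\<^sup>2) :: real^1) = vec (1 / 2)" for x
  proof -
    have "norm (log_polar_vec x) = exp (x $ 1 / 2)"
      by (simp add: log_polar_vec_def norm_log_polar plane_of_vec_def flip: norm_complex_of_vec)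
    then have "(norm (log_polar_vec x))\<^sup>2 = exp (x $ 1)"
      by (simp add: power2_eq_square flip: exp_add)
    then show ?thesis by (simp add: det_log_polar_vec vec_eq_iff)
  qed
  have const: "(\<lambda>x. vec (1 / 2) :: real^1) absolutely_integrable_on S \<and>
      integral S (\<lambda>x. vec (1 / 2) :: real^1) = vec (measure lebesgue S / 2)"
  proof
    show "(\<lambda>x. vec (1 / 2) :: real^1) absolutely_integrable_on S"
      using S_leb absolutely_integrable_on_const by blast
    show "integral S (\<lambda>x. vec (1 / 2) :: real^1) = vec (measure lebesgue S / 2)"
      using lmeasure_integral[OF S_leb] by (simp add: integral_on_1_eq)
  qed
  have cov: "(\<lambda>y. vec (1 / (norm y)\<^sup>2) :: real^1) absolutely_integrable_on (log_polar_vec ` S) \<and>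
      integral (log_polar_vec ` S) (\<lambda>y. vec (1 / (norm y)\<^sup>2) :: real^1) = vec (measure lebesgue S / 2)"
    using has_absolute_integral_change_of_variables[OF _ log_polar_vec_has_derivative inj,
        where f = "\<lambda>y. vec (1 / (norm y)\<^sup>2) :: real^1" and b = "vec (measure lebesgue S / 2)"]
      const S_leb unfolding jac by (simp add: fmeasurableD)
  then have "((\<lambda>y. 1 / (norm y)\<^sup>2) has_integral (measure lebesgue S / 2)) (log_polar_vec ` S)"
    unfolding absolutely_integrable_on_1_iff integral_on_1_eq has_integral_iff
    by (auto simp: absolutely_integrable_on_def vec_eq_iff)
  then have "(\<integral>\<^sup>+y. ennreal (1 / (norm y)\<^sup>2) * indicator (log_polar_vec ` S) y \<partial>lborel) =
      ennreal (measure lebesgue S / 2)"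
    by (intro nn_integral_has_integral_lebesgue') auto
  moreover have "(\<integral>\<^sup>+y. ennreal (1 / (norm y)\<^sup>2) * indicator (log_polar_vec ` S) y \<partial>lborel) =
      (\<integral>\<^sup>+y. ennreal (1 / (norm (complex_of_vec y))\<^sup>2) * indicator (A \<inter> slit) (complex_of_vec y) \<partial>lborel)"
    unfolding im norm_complex_of_vec by (intro nn_integral_cong) (simp add: indicator_def)
  moreover have "\<dots> = (\<integral>\<^sup>+z. ennreal (1 / (norm z)\<^sup>2) * indicator (A \<inter> slit) z \<partial>lborel)"
    using nn_integral_distr[of complex_of_vec lborel borel
        "\<lambda>z. ennreal (1 / (norm z)\<^sup>2) * indicator (A \<inter> slit) z"]
    by (simp add: lborel_complex_of_vec)
  moreover have "\<dots> = (\<integral>\<^sup>+z. ennreal (1 / (norm z)\<^sup>2) * indicator (A \<inter> annulus T) z \<partial>lborel)"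
  proof (intro nn_integral_cong_AE)
    have "sphere 0 1 \<in> null_sets (lborel :: complex measure)"
      using negligible_sphere[of "0::complex" 1] by (simp add: negligible_iff_null_sets null_sets_completion_iff)
    then have "AE z in lborel. z \<notin> sphere (0::complex) 1" by (rule AE_not_in)
    moreover have "AE z in lborel. z \<bullet> \<i> \<noteq> 0" by (rule AE_lborel_inner_neq) (simp add: Basis_complex_def)
    ultimately show "AE z in lborel. ennreal (1 / (norm z)\<^sup>2) * indicator (A \<inter> slit) z =
        ennreal (1 / (norm z)\<^sup>2) * indicator (A \<inter> annulus T) z"
      by eventually_elim (auto simp: indicator_def slit_def annulus_def complex_nonneg_Reals_iff)
  qed
  moreover have "ennreal (measure lebesgue S / 2) = ennreal (1 / 2) * emeasure lborel S"
  proof -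
    have "ennreal (measure lebesgue S / 2) = ennreal (1 / 2 * measure lborel S)" by simp
    also have "\<dots> = ennreal (1 / 2) * ennreal (measure lborel S)" by (rule ennreal_mult') simp
    also have "ennreal (measure lborel S) = emeasure lborel S"
      using S_fin by (intro emeasure_eq_ennreal_measure[symmetric]) auto
    finally show ?thesis .
  qed
  moreover have "emeasure lborel S = emeasure lborel (box (0, 0) (T, 2 * pi) \<inter> log_polar -` A)"
  proof -
    have m: "box (0, 0) (T, 2 * pi) \<inter> log_polar -` A \<in> sets borel"
      using measurable_sets_borel[OF measurable_log_polar A] by simp
    have eq: "S = plane_of_vec -` (box (0, 0) (T, 2 * pi) \<inter> log_polar -` A)"
      by (auto simp: S_def Q_def vimage_box_plane_of_vec[of "(0,0)" "(T, 2 * pi)", simplified])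
    have "emeasure lborel (box (0, 0) (T, 2 * pi) \<inter> log_polar -` A) =
        emeasure (distr lborel borel plane_of_vec) (box (0, 0) (T, 2 * pi) \<inter> log_polar -` A)"
      by (simp add: lborel_plane_of_vec)
    also have "\<dots> = emeasure lborel S" using m by (simp add: emeasure_distr eq)
    finally show ?thesis by simp
  qed
  moreover have "\<dots> = emeasure lborel (cbox (0, 0) (T, 2 * pi) \<inter> log_polar -` A)"
  proof (rule emeasure_eq_AE)
    have "AE p in lborel. p \<bullet> (1::real, 0::real) \<noteq> 0" "AE p in lborel. p \<bullet> (1::real, 0::real) \<noteq> T"
      "AE p in lborel. p \<bullet> (0::real, 1::real) \<noteq> (0::real)" "AE p in lborel. p \<bullet> (0::real, 1::real) \<noteq> 2 * pi"
      by (rule AE_lborel_inner_neq, auto simp: Basis_prod_def)+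
    then show "AE p in lborel. p \<in> box (0, 0) (T, 2 * pi) \<inter> log_polar -` A \<longleftrightarrow>
        p \<in> cbox (0, 0) (T, 2 * pi) \<inter> log_polar -` A"
      by eventually_elim (auto simp: box_def Basis_prod_def inner_prod_def)
  qed (use measurable_sets_borel[OF measurable_log_polar A] in auto)
  ultimately show ?thesis by simp
qed

lemma nn_integral_annulus_log_polar:
  assumes T: "T > 0" and K [measurable]: "K \<in> borel_measurable borel"
  shows "(\<integral>\<^sup>+z. ennreal (1 / (norm z)\<^sup>2) * indicator (annulus T) z * K z \<partial>lborel) =
    (\<integral>\<^sup>+p. ennreal (1 / 2) * indicator (cbox (0, 0) (T, 2 * pi)) p * K (log_polar p) \<partial>lborel)"
proof -
  have [measurable]: "annulus T \<in> sets borel" unfolding annulus_def by measurable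
  let ?M = "density lborel (\<lambda>z. ennreal (1 / (norm z)\<^sup>2) * indicator (annulus T) z)"
  let ?N = "density lborel (\<lambda>p. ennreal (1 / 2) * indicator (cbox (0, 0) (T, 2 * pi)) p)"
  have "?M = distr ?N borel log_polar"
  proof (rule measure_eqI)
    fix A assume "A \<in> sets ?M"
    then have A [measurable]: "A \<in> sets borel" by simp
    have "emeasure ?M A = (\<integral>\<^sup>+z. ennreal (1 / (norm z)\<^sup>2) * indicator (A \<inter> annulus T) z \<partial>lborel)"
      by (subst emeasure_density) (auto intro!: nn_integral_cong simp: indicator_def)
    also have "\<dots> = ennreal (1 / 2) * emeasure lborel (cbox (0, 0) (T, 2 * pi) \<inter> log_polar -` A)"
      by (rule emeasure_annulus_log_polar[OF T A])
    also have "\<dots> = (\<integral>\<^sup>+p. ennreal (1 / 2) * indicator (cbox (0, 0) (T, 2 * pi) \<inter> log_polar -` A) p \<partial>lborel)"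
      using measurable_sets_borel[OF measurable_log_polar A] by (subst nn_integral_cmult_indicator) auto
    also have "\<dots> = emeasure (distr ?N borel log_polar) A"
      using measurable_sets_borel[OF measurable_log_polar A]
      by (subst emeasure_distr, simp, simp, subst emeasure_density)
        (auto intro!: nn_integral_cong simp: indicator_def)
    finally show "emeasure ?M A = emeasure (distr ?N borel log_polar) A" .
  qed simp
  then have "(\<integral>\<^sup>+z. K z \<partial>?M) = (\<integral>\<^sup>+z. K z \<partial>(distr ?N borel log_polar))" by simp
  then show ?thesis
    by (simp add: nn_integral_density nn_integral_distr)
qed

section \<open>Torus coordinates on the covering space\<close>

definition level :: "complex \<times> complex \<Rightarrow> real" where
  "level z = ln ((norm (snd z))\<^sup>2)"

text \<open>On every fibre over \<open>z\<^sub>2\<close> the domain is a disc touching \<open>z\<^sub>1 = 0\<close>; this coordinate rotates all these discs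
to the disc of centre and radius one, and is invariant under the deck transformations.\<close>

definition disc_coord :: "complex \<times> complex \<Rightarrow> complex" where
  "disc_coord z = - (fst z * exp (- (\<i> * level z)))"

definition torus_point :: "complex \<times> (real \<times> real) \<Rightarrow> complex \<times> complex" where
  "torus_point x = (- (exp (\<i> * fst (snd x)) * fst x), log_polar (snd x))"

lemma torus_point_in_Mtilde [simp]: "torus_point x \<in> Mtilde"
  by (simp add: torus_point_def Mtilde_def)

lemma level_torus_point [simp]: "level (torus_point x) = fst (snd x)"
  by (simp add: level_def torus_point_def norm_log_polar ln_realpow)

lemma disc_coord_torus_point [simp]: "disc_coord (torus_point x) = fst x"
  unfolding disc_coord_def level_torus_point by (simp add: torus_point_def exp_minus field_simps)

lemma Omega_tilde_iff: "z \<in> Omega_tilde \<longleftrightarrow> z \<in> Mtilde \<and> disc_coord z \<in> ball 1 1"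
proof -
  let ?e = "exp (\<i> * of_real (level z))"
  have "fst z + ?e = ?e * (1 - disc_coord z)"
    by (simp add: disc_coord_def exp_minus field_simps)
  then have "norm (fst z + ?e) = dist 1 (disc_coord z)"
    by (simp add: norm_mult dist_norm)
  moreover have "dist 1 (disc_coord z) ^ 2 < 1 \<longleftrightarrow> dist 1 (disc_coord z) < 1"
    by (simp add: power2_eq_square abs_square_less_1[unfolded power2_eq_square])
  ultimately show ?thesis
    by (simp add: Omega_tilde_def level_def)
qed

lemma torus_point_in_Omega_tilde_iff: "torus_point x \<in> Omega_tilde \<longleftrightarrow> fst x \<in> ball 1 1"
  by (simp add: Omega_tilde_iff)

lemma torus_point_surj:
  assumes "z \<in> Mtilde"
  obtains p where "z = torus_point (disc_coord z, p)" "fst p = level z" "0 \<le> snd p" "snd p < 2 * pi"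
proof -
  have "snd z \<noteq> 0" using assms by (simp add: Mtilde_def)
  then obtain p where p: "snd z = log_polar p" "fst p = 2 * ln (norm (snd z))" "0 \<le> snd p" "snd p < 2 * pi"
    by (rule log_polar_surj_strip)
  have l: "fst p = level z" using p(2) \<open>snd z \<noteq> 0\<close> by (simp add: level_def ln_realpow)
  have "z = torus_point (disc_coord z, p)"
    by (simp add: torus_point_def prod_eq_iff p(1)[symmetric] l disc_coord_def exp_minus field_simps)
  with l p that show ?thesis by blast
qed

text \<open>Hence functions on the quotient have period \<open>2\<pi>\<mu>\<close> in the first angle.\<close>

lemma deck_torus_point:
  "deck \<mu> (torus_point (v, p)) = torus_point (v, (fst p + 2 * pi * \<mu>, snd p))"
  by (simp add: deck_def torus_point_def log_polar_def exp_add[symmetric] algebra_simps add_divide_distrib)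

lemma continuous_torus_point: "continuous_on UNIV torus_point"
  unfolding torus_point_def by (intro continuous_intros)

lemma continuous_on_level: "continuous_on Mtilde level"
  unfolding level_def Mtilde_def by (intro continuous_intros) auto

lemma continuous_on_disc_coord: "continuous_on Mtilde disc_coord"
  unfolding disc_coord_def by (intro continuous_intros continuous_on_level)

lemma open_Omega_tilde: "open Omega_tilde"
proof -
  have "Omega_tilde = Mtilde \<inter> disc_coord -` ball 1 1" by (auto simp: Omega_tilde_iff)
  then show ?thesis
    using continuous_open_preimage[OF continuous_on_disc_coord open_Mtilde open_ball[of 1 1]] by (simp only:)
qed

section \<open>The quotient by the deck group\<close>

lemma deck_Mtilde_iff: "deck \<mu> z \<in> Mtilde \<longleftrightarrow> z \<in> Mtilde"
  by (simp add: deck_def Mtilde_def)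

text \<open>The relation of the quotient is generated by the deck transformation, so invariance under the generator
suffices.\<close>

lemma deck_rel_invariant:
  assumes "(z, w) \<in> deck_rel \<mu>" and inv: "\<And>z. z \<in> Mtilde \<Longrightarrow> U (deck \<mu> z) = U z"
  shows "U z = U w"
proof -
  have "z \<in> Mtilde" and eq: "equivclp (\<lambda>a b. b = deck \<mu> a) z w"
    using assms(1) by (auto simp: deck_rel_def)
  from eq have "w \<in> Mtilde \<and> U z = U w"
  proof (induction rule: equivclp_induct)
    case base
    show ?case using \<open>z \<in> Mtilde\<close> by simp
  next
    case (step y w)
    then show ?case using inv[of y] inv[of w] deck_Mtilde_iff[of \<mu>] by metis
  qed
  then show ?thesis ..
qed

lemma proj_mu_eq_iff:
  "z \<in> Mtilde \<Longrightarrow> w \<in> Mtilde \<Longrightarrow> proj_mu \<mu> z = proj_mu \<mu> w \<longleftrightarrow> (z, w) \<in> deck_rel \<mu>"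
  unfolding proj_mu_def by (rule eq_equiv_class_iff[OF equiv_deck_rel])

lemma proj_mu_in_M_mu: "z \<in> Mtilde \<Longrightarrow> proj_mu \<mu> z \<in> M_mu \<mu>"
  by (simp add: proj_mu_def M_mu_def quotientI)

lemma proj_mu_deck: "z \<in> Mtilde \<Longrightarrow> proj_mu \<mu> (deck \<mu> z) = proj_mu \<mu> z"
  by (subst proj_mu_eq_iff) (auto simp: deck_Mtilde_iff deck_rel_def equivclp_sym intro: r_into_equivclp)

lemma proj_mu_in_Omega_iff:
  assumes "z \<in> Mtilde"
  shows "proj_mu \<mu> z \<in> Omega \<mu> \<longleftrightarrow> z \<in> Omega_tilde"
proof
  assume "proj_mu \<mu> z \<in> Omega \<mu>"
  then obtain w where w: "w \<in> Omega_tilde" "proj_mu \<mu> z = proj_mu \<mu> w" by (auto simp: Omega_def)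
  then have "(z, w) \<in> deck_rel \<mu>" using assms by (simp add: proj_mu_eq_iff Omega_tilde_def)
  then have "(z \<in> Omega_tilde) = (w \<in> Omega_tilde)"
    by (rule deck_rel_invariant) (simp add: Omega_tilde_deck)
  with w show "z \<in> Omega_tilde" by simp
qed (simp add: Omega_def)

lemma Omega_subset_M_mu: "Omega \<mu> \<subseteq> M_mu \<mu>"
  by (auto simp: Omega_def Omega_tilde_def intro: proj_mu_in_M_mu)

lemma openin_Omega: "openin (M_top \<mu>) (Omega \<mu>)"
proof -
  have "{z \<in> Mtilde. proj_mu \<mu> z \<in> Omega \<mu>} = Omega_tilde"
    using proj_mu_in_Omega_iff by (auto simp: Omega_tilde_def)
  then show ?thesis
    by (simp add: openin_M_top Omega_subset_M_mu open_Omega_tilde)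
qed

lemma topspace_M_top: "topspace (M_top \<mu>) = M_mu \<mu>"
proof
  have "openin (M_top \<mu>) (M_mu \<mu>)"
    using open_Mtilde by (auto simp: openin_M_top proj_mu_in_M_mu cong: conj_cong)
  then show "M_mu \<mu> \<subseteq> topspace (M_top \<mu>)" by (rule openin_subset)
  show "topspace (M_top \<mu>) \<subseteq> M_mu \<mu>"
    using openin_topspace[of "M_top \<mu>"] unfolding openin_M_top by blast
qed

section \<open>The volume in torus coordinates\<close>

definition M_borel :: "real \<Rightarrow> pt measure" where
  "M_borel \<mu> = sigma (M_mu \<mu>) {U. openin (M_top \<mu>) U}"

lemma open_sets_Pow: "{U. openin (M_top \<mu>) U} \<subseteq> Pow (M_mu \<mu>)"
  by (auto simp: openin_M_top)

lemma space_M_borel: "space (M_borel \<mu>) = M_mu \<mu>"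
  unfolding M_borel_def by (rule space_measure_of[OF open_sets_Pow])

lemma sets_M_borel_open: "openin (M_top \<mu>) U \<Longrightarrow> U \<in> sets (M_borel \<mu>)"
  unfolding M_borel_def by (simp add: sets_measure_of[OF open_sets_Pow])

lemma measurable_proj_mu: "proj_mu \<mu> \<in> measurable (restrict_space borel Mtilde) (M_borel \<mu>)"
  unfolding M_borel_def
proof (rule measurable_measure_of[OF open_sets_Pow])
  show "proj_mu \<mu> \<in> space (restrict_space borel Mtilde) \<rightarrow> M_mu \<mu>"
    by (auto simp: space_restrict_space proj_mu_in_M_mu)
  fix U assume "U \<in> {U. openin (M_top \<mu>) U}"
  then have U: "open {z \<in> Mtilde. proj_mu \<mu> z \<in> U}" by (simp add: openin_M_top)
  show "proj_mu \<mu> -` U \<inter> space (restrict_space borel Mtilde) \<in> sets (restrict_space borel Mtilde)"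
    unfolding sets_restrict_space
  proof (rule image_eqI)
    show "proj_mu \<mu> -` U \<inter> space (restrict_space borel Mtilde) = Mtilde \<inter> {z \<in> Mtilde. proj_mu \<mu> z \<in> U}"
      by (auto simp: space_restrict_space)
    show "{z \<in> Mtilde. proj_mu \<mu> z \<in> U} \<in> sets borel" using U by (rule borel_open)
  qed
qed

lemma sets_Omega_volume: "sets (Omega_volume \<mu>) = sets (restrict_space (M_borel \<mu>) (Omega \<mu>))"
  unfolding Omega_volume_def M_volume_def M_borel_def by (rule sets_restrict_space_cong) (rule sets_distr)

lemma Omega_in_M_borel: "Omega \<mu> \<in> sets (M_borel \<mu>)"
  by (rule sets_M_borel_open[OF openin_Omega])

lemma space_Omega_volume: "space (Omega_volume \<mu>) = Omega \<mu>"
  using sets_eq_imp_space_eq[OF sets_Omega_volume, of \<mu>] Omega_subset_M_mu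
  by (auto simp: space_restrict_space space_M_borel)

lemma sets_Omega_volume_iff: "A \<in> sets (Omega_volume \<mu>) \<longleftrightarrow> A \<subseteq> Omega \<mu> \<and> A \<in> sets (M_borel \<mu>)"
  unfolding sets_Omega_volume using Omega_in_M_borel[of \<mu>] Omega_subset_M_mu[of \<mu>]
  by (subst sets_restrict_space_iff) (auto simp: space_M_borel Int_absorb2)

text \<open>The rectangle of torus angles is closed although opposite edges have the same image: the edges form a
null set, and continuous functions are integrable over a closed rectangle.\<close>

definition model_domain :: "real \<Rightarrow> (complex \<times> (real \<times> real)) set" where
  "model_domain \<mu> = ball 1 1 \<times> cbox (0, 0) (2 * pi * \<mu>, 2 * pi)"

definition model_measure :: "real \<Rightarrow> (complex \<times> (real \<times> real)) measure" where
  "model_measure \<mu> = restrict_space (density lborel (\<lambda>_. ennreal (1 / 2))) (model_domain \<mu>)"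

lemma model_domain_borel [measurable]: "model_domain \<mu> \<in> sets borel"
  unfolding model_domain_def by (intro borel_Times) auto

lemma fundamental_domain_borel: "fundamental_domain \<mu> \<in> sets borel"
proof -
  have "fundamental_domain \<mu> = {z. 1 \<le> norm (snd z)} \<inter> {z. norm (snd z) < exp (pi * \<mu>)}"
    by (auto simp: fundamental_domain_def)
  moreover have "closed {z :: complex \<times> complex. 1 \<le> norm (snd z)}"
    by (intro closed_Collect_le continuous_intros)
  moreover have "open {z :: complex \<times> complex. norm (snd z) < exp (pi * \<mu>)}"
    by (intro open_Collect_less continuous_intros)
  ultimately show ?thesis by (simp only: sets.Int borel_closed borel_open)
qed

lemma volume_density_borel:
  "(\<lambda>z :: complex \<times> complex. ennreal (1 / (norm (snd z))\<^sup>2)) \<in> borel_measurable borel"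
proof -
  have "(\<lambda>z :: complex \<times> complex. norm (snd z)) \<in> borel_measurable borel"
    by (intro borel_measurable_continuous_onI continuous_intros)
  then have "(\<lambda>z :: complex \<times> complex. 1 / (norm (snd z))\<^sup>2) \<in> borel_measurable borel"
    by (intro borel_measurable_divide borel_measurable_power) auto
  then show ?thesis by (rule measurable_compose) simp
qed

lemma space_model_measure: "space (model_measure \<mu>) = model_domain \<mu>"
  by (simp add: model_measure_def space_restrict_space)

lemma sets_model_measure: "sets (model_measure \<mu>) = sets (restrict_space borel (model_domain \<mu>))"
  unfolding model_measure_def by (intro sets_restrict_space_cong) simp

lemma measurable_torus_point [measurable]: "torus_point \<in> measurable borel borel"
  by (rule borel_measurable_continuous_onI[OF continuous_torus_point])

lemma measurable_proj_torus_point: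
  "(\<lambda>x. proj_mu \<mu> (torus_point x)) \<in> measurable (model_measure \<mu>) (Omega_volume \<mu>)"
proof -
  have "(\<lambda>x. proj_mu \<mu> (torus_point x)) \<in> measurable borel (M_borel \<mu>)"
    by (rule measurable_compose[OF _ measurable_proj_mu]) (auto intro: measurable_restrict_space2)
  then have "(\<lambda>x. proj_mu \<mu> (torus_point x)) \<in> measurable (restrict_space borel (model_domain \<mu>)) (M_borel \<mu>)"
    by (rule measurable_restrict_space1)
  then have "(\<lambda>x. proj_mu \<mu> (torus_point x)) \<in> measurable (restrict_space borel (model_domain \<mu>)) (restrict_space (M_borel \<mu>) (Omega \<mu>))"
    by (intro measurable_restrict_space2)
      (auto simp: space_restrict_space model_domain_def proj_mu_in_Omega_iff torus_point_in_Omega_tilde_iff)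
  then show ?thesis
    by (simp cong: measurable_cong_sets add: sets_Omega_volume sets_model_measure)
qed

text \<open>Integrate over \<open>z\<^sub>1\<close> first and rotate the disc over each fixed \<open>z\<^sub>2\<close> to the standard one; then introduce
logarithmic polar coordinates in \<open>z\<^sub>2\<close>, which absorb the density of the volume.\<close>

lemma nn_integral_fundamental_torus:
  assumes \<mu>: "\<mu> > 0" and G [measurable]: "G \<in> borel_measurable borel"
  shows "(\<integral>\<^sup>+z. ennreal (1 / (norm (snd z))\<^sup>2) * indicator (fundamental_domain \<mu> \<inter> Omega_tilde) z * G z \<partial>lborel) =
    (\<integral>\<^sup>+x. ennreal (1 / 2) * indicator (model_domain \<mu>) x * G (torus_point x) \<partial>lborel)"
proof -
  have [measurable]: "annulus (2 * pi * \<mu>) \<in> sets borel" unfolding annulus_def by measurable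
  have [measurable]: "Omega_tilde \<in> sets borel" using open_Omega_tilde by simp
  have fd: "z \<in> fundamental_domain \<mu> \<longleftrightarrow> snd z \<in> annulus (2 * pi * \<mu>)" for z
    by (simp add: fundamental_domain_def annulus_def)
  note fundamental_domain_borel [measurable] volume_density_borel [measurable]
  let ?F = "\<lambda>z. ennreal (1 / (norm (snd z))\<^sup>2) * indicator (fundamental_domain \<mu> \<inter> Omega_tilde) z * G z"
  define K where "K w = (\<integral>\<^sup>+v. indicator (ball 1 1) v * G (- (exp (\<i> * ln ((norm w)\<^sup>2)) * v), w) \<partial>lborel)" for w
  have [measurable]: "ball (1 :: complex) 1 \<in> sets borel" by simp
  have pair [measurable]: "(\<lambda>x :: complex \<times> complex. (- (exp (\<i> * ln ((norm (fst x))\<^sup>2)) * snd x), fst x))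
      \<in> measurable (borel \<Otimes>\<^sub>M lborel) borel"
    unfolding borel_prod[symmetric] by measurable
  have K [measurable]: "K \<in> borel_measurable borel"
    unfolding K_def
  proof (rule lborel.borel_measurable_nn_integral)
    have "(\<lambda>x. indicator (ball 1 1) (snd x) * G (- (exp (\<i> * ln ((norm (fst x))\<^sup>2)) * snd x), fst x))
        \<in> borel_measurable (borel \<Otimes>\<^sub>M lborel)"
      by (intro borel_measurable_times_ennreal measurable_compose[OF pair G]
          measurable_compose[OF measurable_snd borel_measurable_indicator]) simp
    then show "(\<lambda>(w, v). indicator (ball 1 1) v * G (- (exp (\<i> * ln ((norm w)\<^sup>2)) * v), w))
        \<in> borel_measurable (borel \<Otimes>\<^sub>M lborel)"
      by (simp add: case_prod_beta')
  qed
  have F: "?F \<in> borel_measurable borel"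
    by (intro borel_measurable_times_ennreal volume_density_borel borel_measurable_indicator G) simp
  have "(\<integral>\<^sup>+z. ?F z \<partial>lborel) = (\<integral>\<^sup>+z. ?F z \<partial>(lborel \<Otimes>\<^sub>M lborel))"
    by (simp add: lborel_prod)
  also have "\<dots> = (\<integral>\<^sup>+w. (\<integral>\<^sup>+u. ?F (u, w) \<partial>lborel) \<partial>lborel)"
    by (rule lborel_pair.nn_integral_snd[symmetric]) (use F in \<open>simp add: lborel_prod\<close>)
  also have "\<dots> = (\<integral>\<^sup>+w. ennreal (1 / (norm w)\<^sup>2) * indicator (annulus (2 * pi * \<mu>)) w * K w \<partial>lborel)"
  proof (intro nn_integral_cong)
    fix w :: complex
    show "(\<integral>\<^sup>+u. ?F (u, w) \<partial>lborel) = ennreal (1 / (norm w)\<^sup>2) * indicator (annulus (2 * pi * \<mu>)) w * K w"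
    proof (cases "w \<in> annulus (2 * pi * \<mu>)")
      case False
      then show ?thesis by (simp add: fd)
    next
      case True
      then have w: "w \<noteq> 0" by (auto simp: annulus_def)
      define c where "c = - exp (\<i> * ln ((norm w)\<^sup>2))"
      have c: "norm c = 1" by (simp add: c_def)
      have in_Om: "(c * v, w) \<in> Omega_tilde \<longleftrightarrow> v \<in> ball 1 1" for v
        using w by (simp add: Omega_tilde_iff Mtilde_def disc_coord_def level_def c_def exp_minus field_simps)
      have "(\<integral>\<^sup>+u. ?F (u, w) \<partial>lborel) = (\<integral>\<^sup>+u. ?F (u, w) \<partial>(distr lborel borel (\<lambda>v. c * v)))"
        by (simp add: lborel_rotation[OF c])
      also have "\<dots> = (\<integral>\<^sup>+v. ?F (c * v, w) \<partial>lborel)"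
        by (rule nn_integral_distr) (auto intro!: measurable_compose[OF _ F] borel_measurable_continuous_onI continuous_intros)
      also have "\<dots> = (\<integral>\<^sup>+v. ennreal (1 / (norm w)\<^sup>2) * (indicator (ball 1 1) v * G (c * v, w)) \<partial>lborel)"
        using True in_Om by (intro nn_integral_cong) (simp add: indicator_def fd del: mem_ball)
      also have "\<dots> = ennreal (1 / (norm w)\<^sup>2) * K w"
        unfolding K_def c_def minus_mult_left[symmetric]
        by (intro nn_integral_cmult borel_measurable_times_ennreal measurable_compose[OF _ G])
          (auto intro!: borel_measurable_continuous_onI continuous_intros)
      finally show ?thesis using True by simp
    qed
  qed
  also have "\<dots> = (\<integral>\<^sup>+p. ennreal (1 / 2) * indicator (cbox (0, 0) (2 * pi * \<mu>, 2 * pi)) p * K (log_polar p) \<partial>lborel)"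
    using \<mu> by (intro nn_integral_annulus_log_polar) auto
  also have "\<dots> = (\<integral>\<^sup>+p. (\<integral>\<^sup>+v. ennreal (1 / 2) * indicator (model_domain \<mu>) (v, p) * G (torus_point (v, p)) \<partial>lborel) \<partial>lborel)"
  proof (intro nn_integral_cong)
    fix p :: "real \<times> real"
    have l: "ln ((norm (log_polar p))\<^sup>2) = fst p"
      by (simp add: norm_log_polar ln_realpow)
    have "K (log_polar p) = (\<integral>\<^sup>+v. indicator (ball 1 1) v * G (torus_point (v, p)) \<partial>lborel)"
      unfolding K_def l by (simp add: torus_point_def)
    then have "ennreal (1 / 2) * indicator (cbox (0, 0) (2 * pi * \<mu>, 2 * pi)) p * K (log_polar p) =
      (\<integral>\<^sup>+v. ennreal (1 / 2) * indicator (cbox (0, 0) (2 * pi * \<mu>, 2 * pi)) p * (indicator (ball 1 1) v * G (torus_point (v, p))) \<partial>lborel)"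
      by (simp only:) (intro nn_integral_cmult[symmetric] borel_measurable_times_ennreal measurable_compose[OF _ G],
          auto simp: torus_point_def intro!: borel_measurable_continuous_onI continuous_intros)
    then show "ennreal (1 / 2) * indicator (cbox (0, 0) (2 * pi * \<mu>, 2 * pi)) p * K (log_polar p) =
      (\<integral>\<^sup>+v. ennreal (1 / 2) * indicator (model_domain \<mu>) (v, p) * G (torus_point (v, p)) \<partial>lborel)"
      by (simp only: model_domain_def indicator_times fst_conv snd_conv mult_ac)
  qed
  also have "\<dots> = (\<integral>\<^sup>+x. ennreal (1 / 2) * indicator (model_domain \<mu>) x * G (torus_point x) \<partial>(lborel \<Otimes>\<^sub>M lborel))"
    by (rule lborel_pair.nn_integral_snd)
      (auto simp: lborel_prod intro!: borel_measurable_times_ennreal measurable_compose[OF measurable_torus_point G])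
  finally show ?thesis by (simp add: lborel_prod)
qed

text \<open>This reduces all integrals over the domain to Lebesgue integrals over the product of a disc and a
rectangle.\<close>

lemma Omega_volume_eq_distr:
  assumes \<mu>: "\<mu> > 0"
  shows "Omega_volume \<mu> = distr (model_measure \<mu>) (Omega_volume \<mu>) (\<lambda>x. proj_mu \<mu> (torus_point x))"
proof (rule measure_eqI)
  fix A assume A: "A \<in> sets (Omega_volume \<mu>)"
  then have AO: "A \<subseteq> Omega \<mu>" and AM: "A \<in> sets (M_borel \<mu>)" by (auto simp: sets_Omega_volume_iff)
  define B where "B = {z \<in> Mtilde. proj_mu \<mu> z \<in> A}"
  have B [measurable]: "B \<in> sets borel"
    using measurable_sets[OF measurable_proj_mu AM] open_Mtilde
    by (subst (asm) sets_restrict_space_iff) (auto simp: B_def space_restrict_space Collect_conj_eq vimage_def Int_commute)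
  have BO: "B \<subseteq> Omega_tilde" using AO proj_mu_in_Omega_iff by (auto simp: B_def)
  note fundamental_domain_borel [measurable] volume_density_borel [measurable]
  have fM: "fundamental_domain \<mu> \<subseteq> Mtilde" by (auto simp: fundamental_domain_def Mtilde_def)
  have sM: "sets Mtilde_volume = sets borel" by (simp add: Mtilde_volume_def)
  have proj: "proj_mu \<mu> \<in> measurable (restrict_space Mtilde_volume (fundamental_domain \<mu>)) (M_borel \<mu>)"
  proof -
    have "proj_mu \<mu> \<in> measurable (restrict_space (restrict_space borel Mtilde) (fundamental_domain \<mu>)) (M_borel \<mu>)"
      by (rule measurable_restrict_space1[OF measurable_proj_mu])
    moreover have "sets (restrict_space (restrict_space borel Mtilde) (fundamental_domain \<mu>)) =
        sets (restrict_space Mtilde_volume (fundamental_domain \<mu>))"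
      unfolding sets_restrict_restrict_space using fM sM
      by (simp add: Int_absorb1 sets_restrict_space)
    ultimately show ?thesis by (simp cong: measurable_cong_sets)
  qed
  have "emeasure (Omega_volume \<mu>) A = emeasure (M_volume \<mu>) A"
    unfolding Omega_volume_def using Omega_in_M_borel AO
    by (intro emeasure_restrict_space) (auto simp: M_volume_def M_borel_def[symmetric] space_M_borel Int_absorb2 Omega_subset_M_mu)
  also have "\<dots> = emeasure (restrict_space Mtilde_volume (fundamental_domain \<mu>)) (proj_mu \<mu> -` A \<inter> fundamental_domain \<mu>)"
    unfolding M_volume_def M_borel_def[symmetric] using proj AM
    by (subst emeasure_distr) (auto simp: space_restrict_space Mtilde_volume_def)
  also have "proj_mu \<mu> -` A \<inter> fundamental_domain \<mu> = B \<inter> fundamental_domain \<mu>"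
    using fM by (auto simp: B_def)
  also have "emeasure (restrict_space Mtilde_volume (fundamental_domain \<mu>)) (B \<inter> fundamental_domain \<mu>) =
      emeasure Mtilde_volume (B \<inter> fundamental_domain \<mu>)"
    by (intro emeasure_restrict_space) (auto simp: sM)
  also have "\<dots> = (\<integral>\<^sup>+z. ennreal (1 / (norm (snd z))\<^sup>2) * indicator (fundamental_domain \<mu> \<inter> Omega_tilde) z * indicator B z \<partial>lborel)"
  proof -
    have "Mtilde_volume = density lborel (\<lambda>z. ennreal (1 / (norm (snd z))\<^sup>2))"
      by (simp add: Mtilde_volume_def kahler_coeff_def)
    moreover have B': "B \<inter> fundamental_domain \<mu> \<in> sets lborel" by simp
    have "(\<lambda>z :: complex \<times> complex. ennreal (1 / (norm (snd z))\<^sup>2)) \<in> borel_measurable lborel"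
      by (subst measurable_cong_sets[OF sets_lborel refl]) (rule volume_density_borel)
    note emeasure_density[OF this B']
    ultimately have "emeasure Mtilde_volume (B \<inter> fundamental_domain \<mu>) =
        (\<integral>\<^sup>+z. ennreal (1 / (norm (snd z))\<^sup>2) * indicator (B \<inter> fundamental_domain \<mu>) z \<partial>lborel)"
      by simp
    also have "\<dots> = (\<integral>\<^sup>+z. ennreal (1 / (norm (snd z))\<^sup>2) * indicator (fundamental_domain \<mu> \<inter> Omega_tilde) z * indicator B z \<partial>lborel)"
      using BO by (intro nn_integral_cong) (auto simp: indicator_def)
    finally show ?thesis .
  qed
  also have "\<dots> = (\<integral>\<^sup>+x. ennreal (1 / 2) * indicator (model_domain \<mu>) x * indicator B (torus_point x) \<partial>lborel)"
    by (rule nn_integral_fundamental_torus[OF \<mu>]) simp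
  also have "\<dots> = emeasure (density lborel (\<lambda>_. ennreal (1 / 2))) (torus_point -` B \<inter> model_domain \<mu>)"
    using measurable_sets_borel[OF measurable_torus_point B]
    by (subst emeasure_density) (auto intro!: nn_integral_cong simp: indicator_def)
  also have "\<dots> = emeasure (model_measure \<mu>) (torus_point -` B \<inter> model_domain \<mu>)"
    unfolding model_measure_def by (intro emeasure_restrict_space[symmetric]) auto
  also have "torus_point -` B \<inter> model_domain \<mu> = (\<lambda>x. proj_mu \<mu> (torus_point x)) -` A \<inter> space (model_measure \<mu>)"
    by (auto simp: B_def space_model_measure)
  also have "emeasure (model_measure \<mu>) \<dots> = emeasure (distr (model_measure \<mu>) (Omega_volume \<mu>) (\<lambda>x. proj_mu \<mu> (torus_point x))) A"
    by (rule emeasure_distr[OF measurable_proj_torus_point A, symmetric])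
  finally show "emeasure (Omega_volume \<mu>) A = emeasure (distr (model_measure \<mu>) (Omega_volume \<mu>) (\<lambda>x. proj_mu \<mu> (torus_point x))) A" .
qed simp

section \<open>Continuity of the partial derivatives of a holomorphic function\<close>

definition partial1 :: "(complex \<times> complex \<Rightarrow> complex) \<Rightarrow> complex \<times> complex \<Rightarrow> complex" where
  "partial1 f z = deriv (\<lambda>w. f (w, snd z)) (fst z)"

definition partial2 :: "(complex \<times> complex \<Rightarrow> complex) \<Rightarrow> complex \<times> complex \<Rightarrow> complex" where
  "partial2 f z = deriv (\<lambda>w. f (fst z, w)) (snd z)"

lemma holomorphic2_partials:
  assumes "holomorphic2_on S f" "z \<in> S"
  shows "((\<lambda>w. f (w, snd z)) has_field_derivative partial1 f z) (at (fst z))"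
    and "((\<lambda>w. f (fst z, w)) has_field_derivative partial2 f z) (at (snd z))"
    and "(f has_derivative (\<lambda>d. partial1 f z * fst d + partial2 f z * snd d)) (at z)"
proof -
  obtain a b where ab: "(f has_derivative (\<lambda>w. a * fst w + b * snd w)) (at z)"
    using assms unfolding holomorphic2_on_def by blast
  have "((\<lambda>w. (w, snd z)) has_derivative (\<lambda>w. (w, 0))) (at (fst z))"
    by (auto intro!: derivative_eq_intros)
  from has_derivative_compose[OF this, of f "\<lambda>w. a * fst w + b * snd w"] ab
  have 1: "((\<lambda>w. f (w, snd z)) has_field_derivative a) (at (fst z))"
    by (simp add: has_field_derivative_def)
  have "((\<lambda>w. (fst z, w)) has_derivative (\<lambda>w. (0, w))) (at (snd z))"
    by (auto intro!: derivative_eq_intros)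
  from has_derivative_compose[OF this, of f "\<lambda>w. a * fst w + b * snd w"] ab
  have 2: "((\<lambda>w. f (fst z, w)) has_field_derivative b) (at (snd z))"
    by (simp add: has_field_derivative_def)
  have "partial1 f z = a" "partial2 f z = b"
    using DERIV_imp_deriv[OF 1] DERIV_imp_deriv[OF 2] by (simp_all add: partial1_def partial2_def)
  with 1 2 ab show "((\<lambda>w. f (w, snd z)) has_field_derivative partial1 f z) (at (fst z))"
    "((\<lambda>w. f (fst z, w)) has_field_derivative partial2 f z) (at (snd z))"
    "(f has_derivative (\<lambda>d. partial1 f z * fst d + partial2 f z * snd d)) (at z)"
    by simp_all
qed

lemma holomorphic2_continuous_on: "holomorphic2_on S f \<Longrightarrow> continuous_on S f"
  by (intro continuous_at_imp_continuous_on ballI has_derivative_continuous[OF holomorphic2_partials(3)])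

text \<open>Holomorphy only provides the derivative at each point. The Cauchy formula for the derivative in the first
variable is an integral over a fixed circle, whose integrand depends continuously on both variables.\<close>

lemma continuous_on_partial1:
  assumes S: "open S" and f: "holomorphic2_on S f"
  shows "continuous_on S (partial1 f)"
proof (rule continuous_at_imp_continuous_on, rule ballI)
  fix z assume "z \<in> S"
  obtain p q where pq: "z = (p, q)" by (cases z)
  obtain A B where AB: "open A" "open B" "z \<in> A \<times> B" "A \<times> B \<subseteq> S"
    by (rule open_prod_elim[OF S \<open>z \<in> S\<close>])
  from AB pq obtain r1 where r1: "r1 > 0" "cball p r1 \<subseteq> A" by (auto simp: open_contains_cball)
  from AB pq obtain r2 where r2: "r2 > 0" "cball q r2 \<subseteq> B" by (auto simp: open_contains_cball)
  define U where "U = ball p r1 \<times> ball q r2"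
  define F where "F x t = f (circlepath p r1 t, snd x) / (circlepath p r1 t - fst x)^2 *
     (2 * pi * \<i> * r1 * exp (2 * of_real pi * \<i> * t))" for x :: "complex \<times> complex" and t :: real
  have sub: "(w, w') \<in> S" if "w \<in> cball p r1" "w' \<in> ball q r2" for w w'
  proof -
    have "w \<in> A" "w' \<in> B" using that r1(2) r2(2) by auto
    with AB(4) show ?thesis by auto
  qed
  have circ: "circlepath p r1 t \<in> sphere p r1" for t
    using r1(1) by (simp add: circlepath dist_norm norm_mult norm_exp_eq_Re)
  have eq: "partial1 f x = 1 / (2 * of_real pi * \<i>) * integral (cbox 0 1) (F x)" if "x \<in> U" for x
  proof -
    have x: "fst x \<in> ball p r1" "snd x \<in> ball q r2" using that by (auto simp: U_def)
    have d: "((\<lambda>w. f (w, snd x)) has_field_derivative partial1 f (w, snd x)) (at w)" if "w \<in> cball p r1" for w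
      using holomorphic2_partials(1)[OF f sub[OF that x(2)]] by simp
    have hol: "(\<lambda>w. f (w, snd x)) holomorphic_on ball p r1"
      unfolding holomorphic_on_def field_differentiable_def
    proof
      fix w assume "w \<in> ball p r1"
      then have "((\<lambda>w. f (w, snd x)) has_field_derivative partial1 f (w, snd x)) (at w within ball p r1)"
        using has_field_derivative_at_within[OF d[of w]] by simp
      then show "\<exists>f'. ((\<lambda>w. f (w, snd x)) has_field_derivative f') (at w within ball p r1)" by blast
    qed
    have cont: "continuous_on (cball p r1) (\<lambda>w. f (w, snd x))"
      using d by (intro continuous_at_imp_continuous_on ballI DERIV_isCont) blast
    note C = Cauchy_derivative_integral_circlepath[OF cont hol x(1)]
    have "partial1 f x = 1 / (2 * of_real pi * \<i>) * contour_integral (circlepath p r1) (\<lambda>u. f (u, snd x) / (u - fst x)^2)"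
      unfolding partial1_def by (rule DERIV_imp_deriv[OF C(2)])
    moreover have "(F x has_integral contour_integral (circlepath p r1) (\<lambda>u. f (u, snd x) / (u - fst x)^2)) {0..1}"
    proof (rule has_integral_eq)
      show "((\<lambda>t. f (circlepath p r1 t, snd x) / (circlepath p r1 t - fst x)^2 *
          vector_derivative (circlepath p r1) (at t within {0..1})) has_integral
          contour_integral (circlepath p r1) (\<lambda>u. f (u, snd x) / (u - fst x)^2)) {0..1}"
        using has_contour_integral_integral[OF C(1)] unfolding has_contour_integral_def .
      show "f (circlepath p r1 t, snd x) / (circlepath p r1 t - fst x)^2 *
          vector_derivative (circlepath p r1) (at t within {0..1}) = F x t" if "t \<in> {0..1}" for t
        using that by (simp add: F_def vector_derivative_circlepath01)
    qed
    ultimately show ?thesis by (simp add: integral_unique)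
  qed
  have contF: "continuous_on (U \<times> cbox 0 1) (\<lambda>(x, t). F x t)"
    unfolding F_def case_prod_beta'
  proof (intro continuous_intros)
    show "continuous_on (U \<times> cbox 0 1) (\<lambda>x. f (circlepath p r1 (snd x), snd (fst x)))"
    proof (rule continuous_on_compose2[OF holomorphic2_continuous_on[OF f]])
      show "continuous_on (U \<times> cbox 0 1) (\<lambda>x. (circlepath p r1 (snd x), snd (fst x)))"
        unfolding circlepath by (intro continuous_intros)
      show "(\<lambda>x. (circlepath p r1 (snd x), snd (fst x))) ` (U \<times> cbox 0 1) \<subseteq> S"
        using sub circ by (auto simp: U_def)
    qed
    show "continuous_on (U \<times> cbox 0 1) (\<lambda>x. circlepath p r1 (snd x))"
      unfolding circlepath by (intro continuous_intros)
    show "\<forall>x\<in>U \<times> cbox 0 1. (circlepath p r1 (snd x) - fst (fst x))\<^sup>2 \<noteq> 0"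
    proof
      fix x assume "x \<in> U \<times> cbox (0 :: real) 1"
      then have "fst (fst x) \<in> ball p r1" by (auto simp: U_def)
      with circ[of "snd x"] show "(circlepath p r1 (snd x) - fst (fst x))\<^sup>2 \<noteq> 0" by auto
    qed
  qed
  have "continuous_on U (\<lambda>x. 1 / (2 * of_real pi * \<i>) * integral (cbox 0 1) (F x))"
    by (intro continuous_intros integral_continuous_on_param[OF contF])
  then have "continuous_on U (partial1 f)"
    by (subst continuous_on_cong[OF refl eq]) auto
  moreover have "open U" "z \<in> U" using r1 r2 pq by (auto simp: U_def open_Times)
  ultimately show "isCont (partial1 f) z" by (simp add: continuous_on_eq_continuous_at)
qed

lemma continuous_on_partial2:
  assumes S: "open S" and f: "holomorphic2_on S f"
  shows "continuous_on S (partial2 f)"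
proof -
  have swap: "continuous_on T (prod.swap :: complex \<times> complex \<Rightarrow> _)" for T
    unfolding prod.swap_def by (intro continuous_intros)
  let ?T = "prod.swap -` S" and ?g = "\<lambda>z. f (prod.swap z)"
  have "open ?T" using open_vimage[OF S swap] .
  moreover have "holomorphic2_on ?T ?g"
    unfolding holomorphic2_on_def
  proof
    fix z assume z: "z \<in> ?T"
    have "(prod.swap has_derivative prod.swap) (at z)"
      unfolding prod.swap_def by (auto intro!: derivative_eq_intros)
    from has_derivative_compose[OF this holomorphic2_partials(3)[OF f]] z
    have "(?g has_derivative (\<lambda>w. partial2 f (prod.swap z) * fst w + partial1 f (prod.swap z) * snd w)) (at z)"
      by (simp add: add.commute)
    then show "\<exists>a b. (?g has_derivative (\<lambda>w. a * fst w + b * snd w)) (at z)" by blast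
  qed
  ultimately have "continuous_on ?T (partial1 ?g)" by (rule continuous_on_partial1)
  then have "continuous_on S (\<lambda>z. partial1 ?g (prod.swap z))"
    by (rule continuous_on_compose2[OF _ swap]) auto
  then show ?thesis by (simp add: partial1_def partial2_def[abs_def])
qed

section \<open>Torus averages of holomorphic functions\<close>

lemma torus_point_has_derivative:
  "((\<lambda>p. torus_point (v, p)) has_derivative
     (\<lambda>d. (\<i> * of_real (fst d) * fst (torus_point (v, p)),
           snd (torus_point (v, p)) * (of_real (fst d / 2) + \<i> * of_real (snd d))))) (at p)"
proof -
  have "((\<lambda>p :: real \<times> real. \<i> * complex_of_real (fst p)) has_derivative (\<lambda>d. \<i> * of_real (fst d))) (at p)"
    by (auto intro!: derivative_eq_intros)
  from has_derivative_compose[OF this DERIV_exp[THEN has_field_derivative_imp_has_derivative]]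
  have "((\<lambda>p. - (exp (\<i> * of_real (fst p)) * v)) has_derivative
      (\<lambda>d. - (exp (\<i> * of_real (fst p)) * (\<i> * of_real (fst d)) * v))) (at p)"
    by (auto intro!: derivative_eq_intros)
  from has_derivative_Pair[OF this has_derivative_log_polar] show ?thesis
    by (simp add: torus_point_def mult_ac)
qed

lemma half_plane_of_disc:
  assumes "v \<in> ball (1 :: complex) 1" shows "0 < Re v" "v \<notin> \<real>\<^sub>\<le>\<^sub>0" "v \<noteq> 0"
proof -
  have "\<bar>Re (1 - v)\<bar> < 1" using assms abs_Re_le_cmod[of "1 - v"] by (simp add: dist_norm)
  then show "0 < Re v" by simp
  then show "v \<notin> \<real>\<^sub>\<le>\<^sub>0" "v \<noteq> 0" by (auto simp: complex_nonpos_Reals_iff)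
qed

text \<open>With \<open>Y\<close> as below, the Cauchy-Riemann equations give
\<open>\<partial>\<^sub>t Y + (i/2) \<partial>\<^sub>\<phi> Y = i v \<partial>\<^sub>v Y - i b Y\<close>: the combination of torus derivatives is chosen so that the
derivative in \<open>z\<^sub>2\<close> cancels. Both torus derivatives integrate to zero by periodicity, so
the integral \<open>J\<close> of \<open>Y\<close> over the torus satisfies \<open>v J' = b J\<close>, and \<open>J v\<^bsup>-b\<^esup>\<close> is constant on the disc. The
exponential in \<open>Y\<close> is \<open>e\<^bsup>-ibt\<^esup> z\<^sub>2\<^sup>n\<close> in torus coordinates; the power of \<open>z\<^sub>2\<close> accounts for the frame.\<close>

lemma torus_integral_eq_powr:
  fixes h :: "complex \<times> complex \<Rightarrow> complex" and b T :: real and n :: nat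
  assumes h: "holomorphic2_on Omega_tilde h" and T: "T \<ge> 0"
  defines "Y \<equiv> \<lambda>v (p :: real \<times> real). exp ((of_nat n / 2 - \<i> * of_real b) * of_real (fst p) + \<i> * of_nat n * of_real (snd p)) * h (torus_point (v, p))"
  assumes per1: "\<And>v t. v \<in> ball 1 1 \<Longrightarrow> Y v (T, t) = Y v (0, t)"
  obtains C where "\<And>v. v \<in> ball 1 1 \<Longrightarrow> integral (cbox (0, 0) (T, 2 * pi)) (Y v) = C * v powr of_real b"
proof -
  define E where "E p = exp ((of_nat n / 2 - \<i> * of_real b) * of_real (fst p) + \<i> * of_nat n * of_real (snd p))" for p :: "real \<times> real"
  define DY where "DY v p d = E p * (((of_nat n / 2 - \<i> * of_real b) * complex_of_real (fst d) + \<i> * of_nat n * of_real (snd d)) * h (torus_point (v, p)) +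
      partial1 h (torus_point (v, p)) * (\<i> * of_real (fst d) * fst (torus_point (v, p))) +
      partial2 h (torus_point (v, p)) * (snd (torus_point (v, p)) * (of_real (fst d / 2) + \<i> * of_real (snd d))))"
    for v and p d :: "real \<times> real"
  define Yv where "Yv v p = E p * (partial1 h (torus_point (v, p)) * - exp (\<i> * of_real (fst p)))" for v p
  let ?D = "ball (1 :: complex) 1" and ?R = "cbox (0, 0) (T, 2 * pi)"
  have YE: "Y v p = E p * h (torus_point (v, p))" for v p by (simp add: Y_def E_def)
  have in_Om: "torus_point (v, p) \<in> Omega_tilde" if "v \<in> ?D" for v p
    using that by (simp add: torus_point_in_Omega_tilde_iff)
  have DY: "(Y v has_derivative DY v p) (at p)" if v: "v \<in> ?D" for v p
  proof -
    have "((\<lambda>p :: real \<times> real. (of_nat n / 2 - \<i> * of_real b) * complex_of_real (fst p) + \<i> * of_nat n * of_real (snd p)) has_derivative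
        (\<lambda>d. (of_nat n / 2 - \<i> * of_real b) * complex_of_real (fst d) + \<i> * of_nat n * of_real (snd d))) (at p)"
      by (auto intro!: derivative_eq_intros)
    from has_derivative_compose[OF this DERIV_exp[THEN has_field_derivative_imp_has_derivative]]
    have 1: "(E has_derivative (\<lambda>d. E p * ((of_nat n / 2 - \<i> * of_real b) * complex_of_real (fst d) + \<i> * of_nat n * of_real (snd d)))) (at p)"
      by (simp add: E_def[abs_def])
    note 2 = has_derivative_compose[OF torus_point_has_derivative holomorphic2_partials(3)[OF h in_Om[OF v]]]
    have "((\<lambda>p. E p * h (torus_point (v, p))) has_derivative DY v p) (at p)"
      by (rule has_derivative_eq_rhs[OF has_derivative_mult[OF 1 2]])
        (simp add: DY_def fun_eq_iff algebra_simps)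
    then show ?thesis unfolding YE[abs_def] .
  qed
  have Yv: "((\<lambda>v. Y v p) has_field_derivative Yv v p) (at v)" if v: "v \<in> ?D" for v p
  proof -
    have 1: "((\<lambda>v. - (exp (\<i> * of_real (fst p)) * v)) has_field_derivative - exp (\<i> * of_real (fst p))) (at v)"
      by (auto intro!: derivative_eq_intros)
    have "((\<lambda>v. h (torus_point (v, p))) has_field_derivative
       partial1 h (torus_point (v, p)) * - exp (\<i> * of_real (fst p))) (at v)"
      using DERIV_chain2[OF _ 1] holomorphic2_partials(1)[OF h in_Om[OF v], of p]
      by (simp add: torus_point_def)
    from DERIV_cmult[OF this, of "E p"] show ?thesis unfolding YE Yv_def .
  qed
  have ct: "continuous_on X (\<lambda>x. torus_point (fst x, snd x))" for X
    using continuous_on_subset[OF continuous_torus_point] by simp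
  have cE: "continuous_on X E" for X
    unfolding E_def by (intro continuous_intros)
  have cE': "continuous_on X (\<lambda>x. E (snd x))" for X :: "(complex \<times> real \<times> real) set"
    by (rule continuous_on_compose2[OF cE[of UNIV]]) (auto intro: continuous_intros)
  have c0: "continuous_on (?D \<times> UNIV) (\<lambda>x. h (torus_point (fst x, snd x)))"
    by (rule continuous_on_compose2[OF holomorphic2_continuous_on[OF h] ct]) (use in_Om in auto)
  have c1: "continuous_on (?D \<times> UNIV) (\<lambda>x. partial1 h (torus_point (fst x, snd x)))"
    by (rule continuous_on_compose2[OF continuous_on_partial1[OF open_Omega_tilde h] ct]) (use in_Om in auto)
  have c2: "continuous_on (?D \<times> UNIV) (\<lambda>x. partial2 h (torus_point (fst x, snd x)))"
    by (rule continuous_on_compose2[OF continuous_on_partial2[OF open_Omega_tilde h] ct]) (use in_Om in auto)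
  have cYv: "continuous_on (?D \<times> UNIV) (\<lambda>(v, p). Yv v p)"
    unfolding Yv_def case_prod_beta' by (intro continuous_intros cE' c1)
  have cDY: "continuous_on (?D \<times> UNIV) (\<lambda>(v, p). DY v p d)" for d
    unfolding DY_def case_prod_beta' by (intro continuous_intros cE' c0 c1 c2 ct)
  have slice: "continuous_on X (g v)" if "v \<in> ?D" "continuous_on (?D \<times> UNIV) (\<lambda>(v, p). g v p)"
    for X v and g :: "complex \<Rightarrow> real \<times> real \<Rightarrow> complex"
  proof -
    have 1: "continuous_on X (Pair v)" by (intro continuous_intros)
    have 2: "Pair v ` X \<subseteq> ?D \<times> UNIV" using that(1) by auto
    show ?thesis using continuous_on_compose2[OF that(2) 1 2] by simp
  qed
  have cY: "continuous_on X (Y v)" if "v \<in> ?D" for X v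
    using has_derivative_continuous[OF DY[OF that]] by (simp add: continuous_at_imp_continuous_on)
  define J where "J v = integral ?R (Y v)" for v
  have ode: "v * integral ?R (Yv v) = of_real b * J v" if v: "v \<in> ?D" for v
  proof -
    let ?Yt = "\<lambda>p. DY v p (1, 0)" and ?Yf = "\<lambda>p. DY v p (0, 1)"
    have it: "integral ?R ?Yt = 0"
    proof -
      have "integral ?R ?Yt = integral (cbox 0 T) (\<lambda>t. integral (cbox 0 (2 * pi)) (\<lambda>s. DY v (t, s) (1, 0)))"
        by (rule integral_prod_continuous[OF slice[OF v cDY]])
      also have "\<dots> = integral (cbox 0 (2 * pi)) (\<lambda>s. integral (cbox 0 T) (\<lambda>t. DY v (t, s) (1, 0)))"
        using slice[OF v cDY] by (intro integral_swap_continuous) (simp add: case_prod_beta')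
      also have "\<dots> = integral (cbox 0 (2 * pi)) (\<lambda>s. 0)"
      proof (intro integral_cong integral_unique)
        fix s
        have "((\<lambda>t. DY v (t, s) (1, 0)) has_integral (Y v (T, s) - Y v (0, s))) {0..T}"
        proof (rule fundamental_theorem_of_calculus[OF T])
          fix t
          have "((\<lambda>t. (t, s)) has_derivative (\<lambda>t. (t, 0))) (at t within {0..T})"
            by (auto intro!: derivative_eq_intros)
          from has_derivative_compose[OF this DY[OF v]]
          show "((\<lambda>t. Y v (t, s)) has_vector_derivative DY v (t, s) (1, 0)) (at t within {0..T})"
            unfolding has_vector_derivative_def
            by (rule has_derivative_eq_rhs) (simp add: DY_def fun_eq_iff scaleR_conv_of_real algebra_simps)
        qed
        then show "((\<lambda>t. DY v (t, s) (1, 0)) has_integral 0) (cbox 0 T)"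
          using per1[OF v] by simp
      qed
      finally show ?thesis by simp
    qed
    have if0: "integral ?R ?Yf = 0"
    proof -
      have "integral ?R ?Yf = integral (cbox 0 T) (\<lambda>t. integral (cbox 0 (2 * pi)) (\<lambda>s. DY v (t, s) (0, 1)))"
        by (rule integral_prod_continuous[OF slice[OF v cDY]])
      also have "\<dots> = integral (cbox 0 T) (\<lambda>t. 0)"
      proof (intro integral_cong integral_unique)
        fix t
        have per2: "Y v (t, 2 * pi) = Y v (t, 0)"
        proof -
          have "exp (\<i> * of_nat n * (2 * of_real pi)) = 1"
            using exp_integer_2pi[of "of_nat n"] by (simp add: mult_ac)
          moreover have "exp (\<i> * (2 * of_real pi)) = 1"
            using exp_two_pi_i by (simp add: mult_ac)
          ultimately show ?thesis
            by (simp add: Y_def torus_point_def log_polar_def exp_add)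
        qed
        have "((\<lambda>s. DY v (t, s) (0, 1)) has_integral (Y v (t, 2 * pi) - Y v (t, 0))) {0..2 * pi}"
        proof (rule fundamental_theorem_of_calculus)
          fix s
          have "((\<lambda>s. (t, s)) has_derivative (\<lambda>s. (0, s))) (at s within {0..2 * pi})"
            by (auto intro!: derivative_eq_intros)
          from has_derivative_compose[OF this DY[OF v]]
          show "((\<lambda>s. Y v (t, s)) has_vector_derivative DY v (t, s) (0, 1)) (at s within {0..2 * pi})"
            unfolding has_vector_derivative_def
            by (rule has_derivative_eq_rhs) (simp add: DY_def fun_eq_iff scaleR_conv_of_real algebra_simps)
        qed simp
        then show "((\<lambda>s. DY v (t, s) (0, 1)) has_integral 0) (cbox 0 (2 * pi))"
          using per2 by simp
      qed
      finally show ?thesis by simp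
    qed
    \<comment> \<open>the terms with \<open>partial2 h\<close> cancel\<close>
    have eq: "\<i> * (v * Yv v p) = ?Yt p + (\<i> / 2) * ?Yf p + \<i> * of_real b * Y v p" for p
      by (simp add: DY_def Yv_def YE torus_point_def field_simps)
    have "?Yt integrable_on ?R" "?Yf integrable_on ?R" "Y v integrable_on ?R" "Yv v integrable_on ?R"
      by (intro integrable_continuous slice[OF v cDY] cY[OF v] slice[OF v cYv])+
    then have *: "(?Yt has_integral 0) ?R" "(?Yf has_integral 0) ?R" "(Y v has_integral J v) ?R"
      "(Yv v has_integral integral ?R (Yv v)) ?R"
      using it if0 by (auto simp: has_integral_iff J_def)
    have "((\<lambda>p. \<i> * (v * Yv v p)) has_integral (0 + (\<i> / 2) * 0 + \<i> * of_real b * J v)) ?R"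
      unfolding eq by (intro has_integral_add has_integral_mult_right *)
    moreover have "((\<lambda>p. \<i> * (v * Yv v p)) has_integral \<i> * (v * integral ?R (Yv v))) ?R"
      by (intro has_integral_mult_right *)
    ultimately have "\<i> * (v * integral ?R (Yv v)) = 0 + (\<i> / 2) * 0 + \<i> * of_real b * J v"
      by (rule has_integral_unique[rotated])
    then show ?thesis by simp
  qed
  have dJ: "(J has_field_derivative integral ?R (Yv v)) (at v)" if v: "v \<in> ?D" for v
  proof -
    have "(J has_field_derivative integral ?R (Yv v)) (at v within ?D)"
      unfolding J_def
    proof (rule leibniz_rule_field_derivative)
      show "((\<lambda>v. Y v p) has_field_derivative Yv v p) (at v within ?D)" if "v \<in> ?D" for v p
        using Yv[OF that] by (rule has_field_derivative_at_within)
      show "Y v integrable_on ?R" if "v \<in> ?D" for v by (intro integrable_continuous cY that)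
      show "continuous_on (?D \<times> ?R) (\<lambda>(v, p). Yv v p)"
        by (rule continuous_on_subset[OF cYv]) auto
    qed (use v in auto)
    then show ?thesis using v by (simp add: at_within_open[OF v open_ball])
  qed
  have "\<exists>C. \<forall>v\<in>?D. J v * v powr (- of_real b) = C"
  proof (rule has_field_derivative_zero_constant)
    fix v assume v: "v \<in> ?D"
    have "((\<lambda>v. J v * v powr (- of_real b)) has_field_derivative
       (integral ?R (Yv v) * v powr (- of_real b) + (- of_real b * v powr (- of_real b - 1)) * J v)) (at v)"
      by (rule DERIV_mult[OF dJ[OF v] has_field_derivative_powr[OF half_plane_of_disc(2)[OF v]]])
    moreover have "integral ?R (Yv v) * v powr (- of_real b) + (- of_real b * v powr (- of_real b - 1)) * J v = 0"
    proof -
      have "v powr (- of_real b) = v * v powr (- of_real b - 1)"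
        using half_plane_of_disc(3)[OF v] by (simp add: powr_def left_diff_distrib exp_diff)
      then have "integral ?R (Yv v) * v powr (- of_real b) + (- of_real b * v powr (- of_real b - 1)) * J v =
          (v * integral ?R (Yv v) - of_real b * J v) * v powr (- of_real b - 1)" by (simp add: algebra_simps)
      then show ?thesis using ode[OF v] by simp
    qed
    ultimately show "((\<lambda>v. J v * v powr (- of_real b)) has_field_derivative 0) (at v within ?D)"
      by (simp add: has_field_derivative_at_within)
  qed simp
  then obtain C where C: "\<And>v. v \<in> ?D \<Longrightarrow> J v * v powr (- of_real b) = C" by blast
  show thesis
  proof (rule that)
    fix v assume v: "v \<in> ?D"
    then have "v powr (- of_real b) * v powr of_real b = 1"
      using half_plane_of_disc(3)[OF v] by (simp add: powr_def exp_minus)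
    then have "J v = J v * v powr (- of_real b) * v powr of_real b" by (simp add: mult.assoc)
    then show "integral ?R (Y v) = C * v powr of_real b" unfolding C[OF v] by (simp only: J_def)
  qed
qed

section \<open>Functions and integrals on the quotient domain\<close>

text \<open>The function on the quotient induced by an invariant function; the choice of a representative is
immaterial by \<open>descend_proj_mu\<close>.\<close>

definition descend :: "real \<Rightarrow> (complex \<times> complex \<Rightarrow> 'a) \<Rightarrow> pt \<Rightarrow> 'a" where
  "descend \<mu> U x = U (SOME z. z \<in> Mtilde \<and> proj_mu \<mu> z = x)"

lemma descend_proj_mu:
  assumes inv: "\<And>z. z \<in> Mtilde \<Longrightarrow> U (deck \<mu> z) = U z" and z: "z \<in> Mtilde"
  shows "descend \<mu> U (proj_mu \<mu> z) = U z"
proof -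
  define w where "w = (SOME w. w \<in> Mtilde \<and> proj_mu \<mu> w = proj_mu \<mu> z)"
  have "w \<in> Mtilde \<and> proj_mu \<mu> w = proj_mu \<mu> z"
    unfolding w_def by (rule someI_ex) (use z in blast)
  then have "(w, z) \<in> deck_rel \<mu>" using z proj_mu_eq_iff[of w z \<mu>] by simp
  from deck_rel_invariant[OF this, of U] inv show ?thesis by (simp add: descend_def w_def)
qed

lemma Omega_cases:
  assumes "x \<in> Omega \<mu>" obtains z where "z \<in> Omega_tilde" "z \<in> Mtilde" "x = proj_mu \<mu> z"
  using assms by (auto simp: Omega_def Omega_tilde_iff)

text \<open>The quotient carries the topology coinduced by the projection, so a function whose pullback is continuous
has open preimages of open sets.\<close>

lemma borel_measurable_Omega_volume:
  fixes u :: "pt \<Rightarrow> 'a::topological_space"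
  assumes "continuous_on Omega_tilde (\<lambda>z. u (proj_mu \<mu> z))"
  shows "u \<in> borel_measurable (Omega_volume \<mu>)"
proof (rule borel_measurableI)
  fix S :: "'a set" assume "open S"
  have "open {z \<in> Omega_tilde. u (proj_mu \<mu> z) \<in> S}"
    using continuous_open_preimage[OF assms open_Omega_tilde \<open>open S\<close>] by (simp add: vimage_def Collect_conj_eq)
  moreover have "{z \<in> Mtilde. proj_mu \<mu> z \<in> u -` S \<inter> Omega \<mu>} = {z \<in> Omega_tilde. u (proj_mu \<mu> z) \<in> S}"
    using proj_mu_in_Omega_iff[of _ \<mu>] by (auto simp: Omega_tilde_iff)
  ultimately have "openin (M_top \<mu>) (u -` S \<inter> Omega \<mu>)"
    using Omega_subset_M_mu[of \<mu>] by (auto simp: openin_M_top)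
  then show "u -` S \<inter> space (Omega_volume \<mu>) \<in> sets (Omega_volume \<mu>)"
    by (simp add: space_Omega_volume sets_Omega_volume_iff sets_M_borel_open)
qed

lemma
  fixes u :: "pt \<Rightarrow> 'a::{banach, second_countable_topology}"
  assumes \<mu>: "\<mu> > 0" and u: "u \<in> borel_measurable (Omega_volume \<mu>)"
  shows integral_Omega_volume:
      "(LINT x|Omega_volume \<mu>. u x) = (LINT y|model_measure \<mu>. u (proj_mu \<mu> (torus_point y)))"
    and integrable_Omega_volume:
      "integrable (Omega_volume \<mu>) u \<longleftrightarrow> integrable (model_measure \<mu>) (\<lambda>y. u (proj_mu \<mu> (torus_point y)))"
proof -
  have "(LINT x|Omega_volume \<mu>. u x) =
     (LINT x|distr (model_measure \<mu>) (Omega_volume \<mu>) (\<lambda>x. proj_mu \<mu> (torus_point x)). u x)"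
    using Omega_volume_eq_distr[OF \<mu>] by simp
  also have "\<dots> = (LINT y|model_measure \<mu>. u (proj_mu \<mu> (torus_point y)))"
    by (rule integral_distr[OF measurable_proj_torus_point u])
  finally show "(LINT x|Omega_volume \<mu>. u x) = (LINT y|model_measure \<mu>. u (proj_mu \<mu> (torus_point y)))" .
  have "integrable (Omega_volume \<mu>) u \<longleftrightarrow>
     integrable (distr (model_measure \<mu>) (Omega_volume \<mu>) (\<lambda>x. proj_mu \<mu> (torus_point x))) u"
    using Omega_volume_eq_distr[OF \<mu>] by simp
  also have "\<dots> \<longleftrightarrow> integrable (model_measure \<mu>) (\<lambda>y. u (proj_mu \<mu> (torus_point y)))"
    by (rule integrable_distr_eq[OF measurable_proj_torus_point u])
  finally show "integrable (Omega_volume \<mu>) u \<longleftrightarrow> integrable (model_measure \<mu>) (\<lambda>y. u (proj_mu \<mu> (torus_point y)))" .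
qed

lemma
  fixes \<psi> :: "complex \<times> (real \<times> real) \<Rightarrow> 'a::{banach, second_countable_topology}"
  assumes \<psi>: "\<psi> \<in> borel_measurable (restrict_space borel (model_domain \<mu>))"
  shows integrable_model_measure:
      "integrable (model_measure \<mu>) \<psi> \<longleftrightarrow> integrable lborel (\<lambda>y. indicator (model_domain \<mu>) y *\<^sub>R \<psi> y)"
    and integral_model_measure:
      "(LINT y|model_measure \<mu>. \<psi> y) = (1 / 2) *\<^sub>R (LINT y|lborel. indicator (model_domain \<mu>) y *\<^sub>R \<psi> y)"
proof -
  have m: "(\<lambda>y. indicator (model_domain \<mu>) y *\<^sub>R \<psi> y) \<in> borel_measurable lborel"
    using \<psi> by (subst (asm) borel_measurable_restrict_space_iff) auto
  have "integrable (model_measure \<mu>) \<psi> \<longleftrightarrow>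
      integrable (density lborel (\<lambda>_. ennreal (1 / 2))) (\<lambda>y. indicator (model_domain \<mu>) y *\<^sub>R \<psi> y)"
    unfolding model_measure_def by (rule integrable_restrict_space) simp
  also have "\<dots> \<longleftrightarrow> integrable lborel (\<lambda>y. (1 / 2) *\<^sub>R (indicator (model_domain \<mu>) y *\<^sub>R \<psi> y))"
    by (rule integrable_density[OF m]) auto
  also have "\<dots> \<longleftrightarrow> integrable lborel (\<lambda>y. indicator (model_domain \<mu>) y *\<^sub>R \<psi> y)"
  proof
    assume "integrable lborel (\<lambda>y. (1 / 2) *\<^sub>R (indicator (model_domain \<mu>) y *\<^sub>R \<psi> y))"
    then have "integrable lborel (\<lambda>y. 2 *\<^sub>R (1 / 2) *\<^sub>R (indicator (model_domain \<mu>) y *\<^sub>R \<psi> y))"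
      by (rule integrable_scaleR_right)
    then show "integrable lborel (\<lambda>y. indicator (model_domain \<mu>) y *\<^sub>R \<psi> y)" by simp
  qed (rule integrable_scaleR_right)
  finally show "integrable (model_measure \<mu>) \<psi> \<longleftrightarrow> integrable lborel (\<lambda>y. indicator (model_domain \<mu>) y *\<^sub>R \<psi> y)" .
  have "(LINT y|model_measure \<mu>. \<psi> y) =
      (LINT y|density lborel (\<lambda>_. ennreal (1 / 2)). indicator (model_domain \<mu>) y *\<^sub>R \<psi> y)"
    unfolding model_measure_def by (rule integral_restrict_space) simp
  also have "\<dots> = (LINT y|lborel. (1 / 2) *\<^sub>R (indicator (model_domain \<mu>) y *\<^sub>R \<psi> y))"
    by (rule integral_density[OF m]) auto
  finally show "(LINT y|model_measure \<mu>. \<psi> y) = (1 / 2) *\<^sub>R (LINT y|lborel. indicator (model_domain \<mu>) y *\<^sub>R \<psi> y)"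
    by (simp only: integral_scaleR_right)
qed

section \<open>Powers on the disc\<close>

text \<open>On the annulus of inner radius \<open>2\<^bsup>-l\<^esup>\<close> and twice that outer radius the integrand is at most \<open>2\<^bsup>-2bl\<^esup>\<close>, and
the area is of order \<open>4\<^bsup>-l\<^esup>\<close>; the resulting geometric series has ratio \<open>4\<^bsup>-(1+b)\<^esup> < 1\<close>.\<close>

lemma nn_integral_radial_power_finite:
  assumes b: "-1 < b" "b \<le> (0::real)"
  shows "(\<integral>\<^sup>+v. ennreal (indicator (ball (0 :: complex) 2) v * norm v powr (2 * b)) \<partial>lborel) < \<infinity>"
proof -
  define a where "a l = (1 / 2 :: real) ^ l" for l :: nat
  define F where "F l v = ennreal (a l powr (2 * b)) * indicator (ball (0 :: complex) (2 * a l)) v" for l v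
  have le: "ennreal (indicator (ball (0 :: complex) 2) v * norm v powr (2 * b)) \<le> (\<Sum>l. F l v)" for v
  proof (cases "v \<in> ball 0 2 \<and> v \<noteq> 0")
    case True
    \<comment> \<open>the dyadic annulus that contains \<open>v\<close>\<close>
    define l where "l = (LEAST l. a l \<le> norm v)"
    have ex: "\<exists>l. a l \<le> norm v"
      using real_arch_pow_inv[of "norm v" "1 / 2"] True by (auto simp: a_def intro: less_imp_le)
    have l: "a l \<le> norm v" unfolding l_def by (rule LeastI_ex[OF ex])
    have u: "norm v < 2 * a l"
    proof (cases "l = 0")
      case True': True
      have "norm v < 2" using True by simp
      then show ?thesis by (simp add: True' a_def)
    next
      case False
      then obtain j where j: "l = Suc j" by (cases l) auto
      have "\<not> a j \<le> norm v"
        by (rule not_less_Least[of j "\<lambda>l. a l \<le> norm v"]) (simp add: j flip: l_def)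
      then show ?thesis unfolding j by (simp add: a_def)
    qed
    have "norm v powr (2 * b) \<le> a l powr (2 * b)"
      using l b by (intro powr_mono2') (auto simp: a_def)
    then have "ennreal (indicator (ball (0 :: complex) 2) v * norm v powr (2 * b)) \<le> F l v"
      using True u by (simp add: F_def indicator_def ennreal_leI)
    also have "\<dots> \<le> (\<Sum>l. F l v)"
      using sum_le_suminf[of "\<lambda>l. F l v" "{l}"] by simp
    finally show ?thesis .
  qed auto
  have term_eq: "(\<integral>\<^sup>+v. F l v \<partial>lborel) = ennreal (4 * pi * ((1 / 4) powr (1 + b)) ^ l)" for l
  proof -
    have "(\<integral>\<^sup>+v. F l v \<partial>lborel) = ennreal (a l powr (2 * b)) * emeasure lborel (ball (0 :: complex) (2 * a l))"
      unfolding F_def by (rule nn_integral_cmult_indicator) simp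
    also have "emeasure lborel (ball (0 :: complex) (2 * a l)) = ennreal (pi * (2 * a l)\<^sup>2)"
      by (subst emeasure_ball) (auto simp: a_def unit_ball_vol_2)
    also have "ennreal (a l powr (2 * b)) * ennreal (pi * (2 * a l)\<^sup>2) = ennreal (4 * pi * (a l powr (2 * b) * (a l)\<^sup>2))"
      by (subst ennreal_mult[symmetric]) (auto simp: power2_eq_square mult_ac)
    also have "a l powr (2 * b) * (a l)\<^sup>2 = ((1 / 4) powr (1 + b)) ^ l"
    proof -
      have al: "a l = (1 / 2) powr l" by (simp add: a_def powr_realpow)
      have "a l powr (2 * b) * (a l)\<^sup>2 = a l powr (2 * b) * a l powr 2"
        by (simp add: a_def)
      also have "\<dots> = a l powr (2 * (1 + b))" by (simp add: powr_add[symmetric] algebra_simps)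
      also have "\<dots> = ((1 / 2) powr 2) powr ((1 + b) * l)"
        by (simp add: al powr_powr mult_ac del: powr_numeral)
      also have "\<dots> = ((1 / 4) powr (1 + b)) ^ l"
        by (simp add: power2_eq_square powr_powr[symmetric] powr_realpow)
      finally show ?thesis .
    qed
    finally show ?thesis .
  qed
  have "(1 / 4 :: real) powr (1 + b) < 1" using b by (simp add: powr_def mult_pos_neg)
  then have "summable (\<lambda>l. 4 * pi * ((1 / 4) powr (1 + b)) ^ l :: real)"
    by (intro summable_mult summable_geometric) auto
  then have "(\<Sum>l. ennreal (4 * pi * ((1 / 4) powr (1 + b)) ^ l)) < \<infinity>"
    by (subst suminf_ennreal_eq[OF _ summable_sums]) auto
  moreover have "(\<integral>\<^sup>+v. (\<Sum>l. F l v) \<partial>lborel) = (\<Sum>l. \<integral>\<^sup>+v. F l v \<partial>lborel)"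
    unfolding F_def
    by (intro nn_integral_suminf borel_measurable_times_ennreal borel_measurable_const borel_measurable_indicator) simp
  ultimately have "(\<integral>\<^sup>+v. (\<Sum>l. F l v) \<partial>lborel) < \<infinity>" by (simp add: term_eq)
  then show ?thesis
    by (rule le_less_trans[OF nn_integral_mono[OF le]])
qed

lemma norm_powr_of_real: "norm (v powr (of_real b :: complex)) = norm v powr b"
  by (simp add: norm_powr_real_powr')

lemma borel_measurable_disc_powr:
  "(\<lambda>v. indicator (ball 1 1) v *\<^sub>R (v powr of_real b :: complex)) \<in> borel_measurable lborel"
proof -
  have "continuous_on (ball 1 1) (\<lambda>v. v powr (of_real b :: complex))"
    by (intro continuous_at_imp_continuous_on ballI
        DERIV_isCont[OF has_field_derivative_powr[OF half_plane_of_disc(2)]])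
  then show ?thesis
    by (simp add: borel_measurable_continuous_on_indicator)
qed

lemma integrable_disc_powr_square:
  assumes b: "-1 < b" "b \<le> (0::real)"
  shows "set_integrable lborel (ball 1 1) (\<lambda>v. (norm (v powr (of_real b :: complex)))\<^sup>2)"
  unfolding set_integrable_def
proof (rule integrableI_bounded)
  have "(\<lambda>v. (norm (indicator (ball 1 1) v *\<^sub>R (v powr of_real b :: complex)))\<^sup>2) \<in> borel_measurable lborel"
    using borel_measurable_disc_powr by measurable
  also have "(\<lambda>v. (norm (indicator (ball 1 1) v *\<^sub>R (v powr of_real b :: complex)))\<^sup>2) =
      (\<lambda>v. indicator (ball 1 1) v *\<^sub>R (norm (v powr (of_real b :: complex)))\<^sup>2)"
    by (auto simp: indicator_def)
  finally show "(\<lambda>v. indicator (ball 1 1) v *\<^sub>R (norm (v powr (of_real b :: complex)))\<^sup>2) \<in> borel_measurable lborel" .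
  have "(\<integral>\<^sup>+v. ennreal (norm (indicator (ball 1 1) v *\<^sub>R (norm (v powr (of_real b :: complex)))\<^sup>2)) \<partial>lborel) \<le>
     (\<integral>\<^sup>+v. ennreal (indicator (ball (0 :: complex) 2) v * norm v powr (2 * b)) \<partial>lborel)"
  proof (intro nn_integral_mono ennreal_leI)
    fix v :: complex
    have "v \<in> ball 0 2" if "v \<in> ball 1 1"
      using that norm_triangle_sub[of v 1] by (simp add: dist_norm norm_minus_commute)
    moreover have "(norm v powr b)\<^sup>2 = norm v powr (2 * b)"
      by (simp add: power2_eq_square powr_add[symmetric])
    ultimately show "norm (indicator (ball 1 1) v *\<^sub>R (norm (v powr (of_real b :: complex)))\<^sup>2) \<le>
       indicator (ball 0 2) v * norm v powr (2 * b)"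
      by (auto simp: norm_powr_of_real indicator_def)
  qed
  also have "\<dots> < \<infinity>" by (rule nn_integral_radial_power_finite[OF b])
  finally show "(\<integral>\<^sup>+v. ennreal (norm (indicator (ball 1 1) v *\<^sub>R (norm (v powr (of_real b :: complex)))\<^sup>2)) \<partial>lborel) < \<infinity>" .
qed

lemma integrable_disc_powr:
  assumes b: "-1 < b" "b \<le> (0::real)"
  shows "set_integrable lborel (ball 1 1) (\<lambda>v. v powr (of_real b :: complex))"
  unfolding set_integrable_def
proof (rule Bochner_Integration.integrable_bound[OF _ borel_measurable_disc_powr])
  have "set_integrable lborel (ball 1 1) (\<lambda>v :: complex. 1 :: real)"
    using emeasure_lborel_ball_finite[of "1 :: complex" 1] by (simp add: set_integrable_def integrable_indicator_iff)
  from set_integral_add(1)[OF this integrable_disc_powr_square[OF b]]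
  show "integrable lborel (\<lambda>v. indicator (ball 1 1) v *\<^sub>R (1 + (norm (v powr (of_real b :: complex)))\<^sup>2))"
    by (simp add: set_integrable_def)
  have "x \<le> 1 + x\<^sup>2" for x :: real
    using sum_power2_ge_zero[of "x - 1/2" 0] by (simp add: power2_eq_square algebra_simps)
  then show "AE v in lborel. norm (indicator (ball 1 1) v *\<^sub>R (v powr (of_real b :: complex))) \<le>
      norm (indicator (ball 1 1) v *\<^sub>R (1 + (norm (v powr (of_real b :: complex)))\<^sup>2))"
    by (auto simp: indicator_def)
qed

text \<open>The argument of \<open>v\<^sup>b\<close> is \<open>b\<close> times that of \<open>v\<close>, hence still less than a right angle.\<close>

lemma Re_powr_pos:
  assumes b: "-1 < b" "b \<le> (0::real)" and v: "Re v > 0"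
  shows "Re (v powr (of_real b :: complex)) > 0"
proof -
  have v0: "v \<noteq> 0" using v by auto
  have "\<bar>Im (Ln v)\<bar> < pi / 2" using Re_Ln_pos_lt[OF v0] v by blast
  moreover have "\<bar>b\<bar> * \<bar>Im (Ln v)\<bar> \<le> 1 * \<bar>Im (Ln v)\<bar>"
    using b by (intro mult_right_mono) auto
  ultimately have "\<bar>b * Im (Ln v)\<bar> < pi / 2" by (simp add: abs_mult)
  then have "cos (b * Im (Ln v)) > 0" by (intro cos_gt_zero_pi) (auto simp: abs_less_iff)
  then show ?thesis using v0 by (simp add: powr_def Re_exp)
qed

section \<open>The holomorphic functions of a fixed torus weight\<close>

lemma level_disc_coord_deck:
  assumes "z \<in> Mtilde" shows "level (deck \<mu> z) = level z + 2 * pi * \<mu>"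
    and "disc_coord (deck \<mu> z) = disc_coord z"
proof -
  obtain q where q: "z = torus_point (disc_coord z, q)" "fst q = level z"
    using torus_point_surj[OF assms] by metis
  have "deck \<mu> z = torus_point (disc_coord z, (fst q + 2 * pi * \<mu>, snd q))"
    by (subst q(1)) (simp add: deck_torus_point)
  then show "level (deck \<mu> z) = level z + 2 * pi * \<mu>" "disc_coord (deck \<mu> z) = disc_coord z"
    using q(2) by simp_all
qed

text \<open>The torus character \<open>e\<^bsup>i\<kappa>t\<^esup>\<close>, well defined on the quotient when \<open>\<kappa> \<mu>\<close> is an integer.\<close>

definition phase :: "real \<Rightarrow> complex \<times> complex \<Rightarrow> complex" where
  "phase \<kappa> z = exp (\<i> * of_real (\<kappa> * level z))"

lemma norm_phase [simp]: "norm (phase \<kappa> z) = 1"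
  by (simp add: phase_def)

lemma phase_deck:
  fixes k :: int
  assumes "\<mu> > 0" "z \<in> Mtilde"
  shows "phase (k / \<mu>) (deck \<mu> z) = phase (k / \<mu>) z"
proof -
  have "\<i> * of_real (k / \<mu> * level (deck \<mu> z)) = \<i> * of_real (k / \<mu> * level z) + \<i> * of_int k * (of_real pi * 2)"
    using assms by (simp add: level_disc_coord_deck field_simps)
  moreover have "exp (\<i> * of_int k * (of_real pi * 2)) = 1"
    using exp_integer_2pi[of "of_int k"] by (simp add: mult_ac)
  ultimately show ?thesis by (simp add: phase_def exp_add)
qed

text \<open>The generator of a weight space: up to a constant and the frame it is a branch of a power of \<open>z\<^sub>1\<close>,
which is single valued on the covering domain because there \<open>z\<^sub>1\<close> follows the angle \<open>\<theta>\<close>.\<close>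

definition edge_power :: "real \<Rightarrow> real \<Rightarrow> complex \<times> complex \<Rightarrow> complex" where
  "edge_power \<kappa> b z = disc_coord z powr of_real b * phase \<kappa> z"

lemma edge_power_deck:
  fixes k :: int
  assumes "\<mu> > 0" "z \<in> Mtilde"
  shows "edge_power (k / \<mu>) b (deck \<mu> z) = edge_power (k / \<mu>) b z"
  using assms phase_deck[OF assms] by (simp add: edge_power_def level_disc_coord_deck)

lemma norm_edge_power: "norm (edge_power \<kappa> b z) = norm (fst z) powr b"
proof -
  have "norm (disc_coord z) = norm (fst z)" by (simp add: disc_coord_def norm_mult)
  then show ?thesis by (simp add: edge_power_def norm_mult norm_powr_of_real)
qed

text \<open>The exponent with which \<open>\<theta>\<^sup>j\<close> enters \<open>\<theta>\<^sup>I\<close>.\<close>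

definition frame_degree :: "nat \<Rightarrow> nat set \<Rightarrow> nat" where
  "frame_degree j I = of_bool (j \<in> I)"

lemma prod_frame_coeff:
  assumes "I \<subseteq> {1, 2}"
  shows "(\<Prod>j\<in>I. frame_coeff j z) = exp (- (\<i> * of_real (level z))) ^ frame_degree 1 I * inverse (snd z) ^ frame_degree 2 I"
proof -
  have "I = {} \<or> I = {1} \<or> I = {2} \<or> I = {1, 2}" using assms by blast
  then show ?thesis
    by (elim disjE) (simp_all add: frame_degree_def frame_coeff_def level_def)
qed

lemma form_index_subset: "I \<in> form_index p \<Longrightarrow> I \<subseteq> {1, 2}"
  by (simp add: form_index_def)

lemma finite_form_index: "finite (form_index p)"
  by (rule finite_subset[of _ "Pow {1, 2}"]) (auto simp: form_index_def)

lemma level_has_derivative: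
  assumes "z \<in> Mtilde"
  shows "(level has_derivative (\<lambda>d. 2 * (snd z \<bullet> snd d) * exp (- level z))) (at z)"
proof -
  have "snd z \<noteq> 0" using assms by (simp add: Mtilde_def)
  have 1: "((\<lambda>z :: complex \<times> complex. snd z \<bullet> snd z) has_derivative (\<lambda>d. 2 * (snd z \<bullet> snd d))) (at z)"
    by (auto intro!: derivative_eq_intros simp: inner_commute)
  have lev: "level = (\<lambda>z. ln (snd z \<bullet> snd z))" by (simp add: level_def fun_eq_iff power2_norm_eq_inner)
  have "((\<lambda>z. ln (snd z \<bullet> snd z)) has_derivative (\<lambda>d. inverse (snd z \<bullet> snd z) * (2 * (snd z \<bullet> snd d)))) (at z)"
    using has_derivative_compose[OF 1 DERIV_ln[THEN has_field_derivative_imp_has_derivative]] \<open>snd z \<noteq> 0\<close> by simp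
  moreover have "exp (- level z) = inverse (snd z \<bullet> snd z)"
    using \<open>snd z \<noteq> 0\<close> by (simp add: lev exp_minus)
  ultimately show ?thesis by (simp add: lev mult_ac)
qed

text \<open>Multiplied by the frame, the function is \<open>c e\<^bsup>b L\<^esup> z\<^sub>2\<^bsup>-n\<^esup>\<close> with \<open>L = Ln v + i\<theta>\<close>, a continuous branch of the
logarithm of \<open>- z\<^sub>1\<close>. The derivative of \<open>\<theta>\<close>, which is not complex linear, cancels in \<open>L\<close> and leaves
\<open>dz\<^sub>1 / z\<^sub>1\<close>.\<close>

lemma holomorphic2_edge_power:
  fixes \<kappa> b :: real
  assumes I: "I \<subseteq> {1, 2}" and b: "b = \<kappa> - frame_degree 1 I"
  shows "holomorphic2_on Omega_tilde (\<lambda>z. c * edge_power \<kappa> b z * (\<Prod>j\<in>I. frame_coeff j z))"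
  unfolding holomorphic2_on_def
proof
  fix z assume z: "z \<in> Omega_tilde"
  then have M: "z \<in> Mtilde" and v: "disc_coord z \<in> ball 1 1" by (auto simp: Omega_tilde_iff)
  define D where "D d = 2 * (snd z \<bullet> snd d) * exp (- level z)" for d :: "complex \<times> complex"
  \<comment> \<open>a branch of \<open>log (- z\<^sub>1)\<close>\<close>
  define L where "L z = Ln (disc_coord z) + \<i> * of_real (level z)" for z
  define n where "n = frame_degree 2 I"
  have s0: "snd z \<noteq> 0" using M by (simp add: Mtilde_def)
  have f0: "fst z \<noteq> 0" using half_plane_of_disc(3)[OF v] by (auto simp: disc_coord_def)
  have D: "(level has_derivative D) (at z)"
    using level_has_derivative[OF M] by (simp add: D_def[abs_def])
  have D': "((\<lambda>z. \<i> * complex_of_real (level z)) has_derivative (\<lambda>d. \<i> * of_real (D d))) (at z)"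
    using D by (auto intro!: derivative_eq_intros)
  from has_derivative_compose[OF has_derivative_minus[OF this] DERIV_exp[THEN has_field_derivative_imp_has_derivative]]
  have e: "((\<lambda>z. exp (- (\<i> * complex_of_real (level z)))) has_derivative
     (\<lambda>d. exp (- (\<i> * of_real (level z))) * - (\<i> * of_real (D d)))) (at z)" .
  have "(disc_coord has_derivative (\<lambda>d. - (fst z * (exp (- (\<i> * of_real (level z))) * - (\<i> * of_real (D d))) +
      fst d * exp (- (\<i> * of_real (level z)))))) (at z)"
    unfolding disc_coord_def[abs_def] by (intro has_derivative_minus has_derivative_mult has_derivative_fst has_derivative_ident e)
  from has_derivative_compose[OF this has_field_derivative_Ln[OF half_plane_of_disc(2)[OF v], THEN has_field_derivative_imp_has_derivative]]
  have "((\<lambda>z. Ln (disc_coord z)) has_derivative (\<lambda>d. inverse (disc_coord z) *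
      - (fst z * (exp (- (\<i> * of_real (level z))) * - (\<i> * of_real (D d))) + fst d * exp (- (\<i> * of_real (level z)))))) (at z)" .
  moreover have "inverse (disc_coord z) * - (fst z * (exp (- (\<i> * of_real (level z))) * - (\<i> * of_real (D d))) +
      fst d * exp (- (\<i> * of_real (level z)))) = fst d / fst z - \<i> * of_real (D d)" for d
    using f0 by (simp add: disc_coord_def field_simps)
  ultimately have "((\<lambda>z. Ln (disc_coord z)) has_derivative (\<lambda>d. fst d / fst z - \<i> * of_real (D d))) (at z)" by simp
  from has_derivative_add[OF this D']
  have "(L has_derivative (\<lambda>d. fst d / fst z)) (at z)" by (simp add: L_def[abs_def])
  from has_derivative_compose[OF has_derivative_mult_right[OF this, of "of_real b"] DERIV_exp[THEN has_field_derivative_imp_has_derivative]]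
  have E: "((\<lambda>z. exp (of_real b * L z)) has_derivative (\<lambda>d. exp (of_real b * L z) * (of_real b * (fst d / fst z)))) (at z)" .
  have "((\<lambda>w. inverse w ^ n) has_field_derivative deriv (\<lambda>w. inverse w ^ n) (snd z)) (at (snd z))"
    using s0 by (intro field_differentiable_derivI field_differentiable_power field_differentiable_inverse) auto
  from has_derivative_compose[OF has_derivative_snd[OF has_derivative_ident] this[THEN has_field_derivative_imp_has_derivative]]
  have S: "((\<lambda>z. inverse (snd z) ^ n) has_derivative (\<lambda>d. deriv (\<lambda>w. inverse w ^ n) (snd z) * snd d)) (at z)" .
  have der: "((\<lambda>z. c * exp (of_real b * L z) * inverse (snd z) ^ n) has_derivative
     (\<lambda>d. c * exp (of_real b * L z) * (deriv (\<lambda>w. inverse w ^ n) (snd z) * snd d) +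
       c * (exp (of_real b * L z) * (of_real b * (fst d / fst z))) * inverse (snd z) ^ n)) (at z)"
    by (rule has_derivative_mult[OF has_derivative_mult_right[OF E] S])
  have eq: "c * edge_power \<kappa> b w * (\<Prod>j\<in>I. frame_coeff j w) = c * exp (of_real b * L w) * inverse (snd w) ^ n"
    if "w \<in> Omega_tilde" for w
  proof -
    have "disc_coord w \<noteq> 0" using that half_plane_of_disc(3) by (auto simp: Omega_tilde_iff)
    then have "edge_power \<kappa> b w * exp (- (\<i> * of_real (level w))) ^ frame_degree 1 I = exp (of_real b * L w)"
      by (simp add: edge_power_def phase_def powr_def L_def b exp_of_nat_mult[symmetric] exp_add[symmetric] algebra_simps)
    then show ?thesis by (simp add: prod_frame_coeff[OF I] n_def mult.assoc)
  qed
  have "((\<lambda>z. c * edge_power \<kappa> b z * (\<Prod>j\<in>I. frame_coeff j z)) has_derivative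
     (\<lambda>d. c * exp (of_real b * L z) * (deriv (\<lambda>w. inverse w ^ n) (snd z) * snd d) +
       c * (exp (of_real b * L z) * (of_real b * (fst d / fst z))) * inverse (snd z) ^ n)) (at z)"
    by (rule has_derivative_transform_within_open[OF der open_Omega_tilde z]) (simp add: eq)
  then have "((\<lambda>z. c * edge_power \<kappa> b z * (\<Prod>j\<in>I. frame_coeff j z)) has_derivative
     (\<lambda>d. (c * (exp (of_real b * L z) * (of_real b / fst z)) * inverse (snd z) ^ n) * fst d +
       (c * exp (of_real b * L z) * deriv (\<lambda>w. inverse w ^ n) (snd z)) * snd d)) (at z)"
    by (rule has_derivative_eq_rhs) (simp add: fun_eq_iff algebra_simps)
  then show "\<exists>a' b'. ((\<lambda>z. c * edge_power \<kappa> b z * (\<Prod>j\<in>I. frame_coeff j z)) has_derivative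
     (\<lambda>w. a' * fst w + b' * snd w)) (at z)" by blast
qed

text \<open>Lemma \<open>torus_integral_eq_powr\<close> read in the frame: expressing a frame coefficient by a holomorphic function
multiplies it by \<open>e\<^bsup>it\<^esup>\<close> if \<open>\<theta>\<^sup>1\<close> occurs, which shifts the exponent \<open>k / \<mu>\<close> by one, and by \<open>z\<^sub>2\<close> if \<open>\<theta>\<^sup>2\<close> occurs.\<close>

lemma torus_coefficient:
  fixes k :: int and u :: "pt \<Rightarrow> complex"
  assumes \<mu>: "\<mu> > 0" and I: "I \<subseteq> {1, 2}" and b: "b = k / \<mu> - frame_degree 1 I"
    and hol: "holomorphic2_on Omega_tilde (\<lambda>z. u (proj_mu \<mu> z) * (\<Prod>j\<in>I. frame_coeff j z))"
  obtains C where "\<And>v. v \<in> ball 1 1 \<Longrightarrow>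
    integral (cbox (0, 0) (2 * pi * \<mu>, 2 * pi))
      (\<lambda>q. cnj (phase (k / \<mu>) (torus_point (v, q))) * u (proj_mu \<mu> (torus_point (v, q)))) = C * v powr of_real b"
proof -
  define n where "n = frame_degree 2 I"
  define h where "h z = u (proj_mu \<mu> z) * (\<Prod>j\<in>I. frame_coeff j z)" for z
  define Y where "Y v q = exp ((of_nat n / 2 - \<i> * of_real b) * of_real (fst q) + \<i> * of_nat n * of_real (snd q)) *
    h (torus_point (v, q))" for v and q :: "real \<times> real"
  have Y: "Y v q = cnj (phase (k / \<mu>) (torus_point (v, q))) * u (proj_mu \<mu> (torus_point (v, q)))" for v q
  proof -
    have "exp ((of_nat n / 2 - \<i> * of_real b) * of_real (fst q) + \<i> * of_nat n * of_real (snd q)) =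
        exp (- (\<i> * of_real (k / \<mu> * fst q))) * exp (\<i> * of_real (fst q)) ^ frame_degree 1 I * log_polar q ^ n"
      unfolding log_polar_def b by (simp add: exp_of_nat_mult[symmetric] exp_add[symmetric] algebra_simps)
    moreover have "snd (torus_point (v, q)) = log_polar q" by (simp add: torus_point_def)
    ultimately show ?thesis
      by (simp add: Y_def h_def prod_frame_coeff[OF I] phase_def exp_cnj n_def power_inverse exp_minus
          flip: power_mult_distrib) (simp add: field_simps)
  qed
  have per: "Y v (2 * pi * \<mu>, t) = Y v (0, t)" if "v \<in> ball 1 1" for v t
  proof -
    have d: "torus_point (v, (2 * pi * \<mu>, t)) = deck \<mu> (torus_point (v, (0, t)))"
      by (simp add: deck_torus_point)
    show ?thesis unfolding Y d by (simp add: phase_deck[OF \<mu>] proj_mu_deck)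
  qed
  have T: "0 \<le> 2 * pi * \<mu>" using \<mu> by simp
  obtain C where "\<And>v. v \<in> ball 1 1 \<Longrightarrow> integral (cbox (0, 0) (2 * pi * \<mu>, 2 * pi)) (Y v) = C * v powr of_real b"
    using torus_integral_eq_powr[of h "2 * pi * \<mu>" n b] hol T per unfolding Y_def[abs_def] h_def[abs_def] by blast
  then show thesis by (intro that[of C]) (simp add: Y[abs_def])
qed

section \<open>Definiteness of the inner product on the Bergman spaces\<close>

lemma proj_mu_torus_shift:
  "proj_mu \<mu> (torus_point (v, (t + 2 * pi * \<mu> * of_int l, s))) = proj_mu \<mu> (torus_point (v, (t, s)))"
proof -
  have nat: "proj_mu \<mu> (torus_point (v, (t + 2 * pi * \<mu> * of_nat n, s))) = proj_mu \<mu> (torus_point (v, (t, s)))" for n t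
  proof (induction n)
    case (Suc n)
    have "torus_point (v, (t + 2 * pi * \<mu> * of_nat (Suc n), s)) =
        deck \<mu> (torus_point (v, (t + 2 * pi * \<mu> * of_nat n, s)))"
      by (simp add: deck_torus_point algebra_simps)
    then show ?case using Suc proj_mu_deck[of "torus_point (v, (t + 2 * pi * \<mu> * of_nat n, s))" \<mu>] by simp
  qed simp
  show ?thesis
  proof (cases "l \<ge> 0")
    case True
    then show ?thesis using nat[of t "nat l"] by simp
  next
    case False
    then show ?thesis using nat[of "t + 2 * pi * \<mu> * of_int l" "nat (- l)"] by simp
  qed
qed

text \<open>Every point of the quotient has a representative in the closed rectangle of torus coordinates: reduce the
first angle modulo its period.\<close>

lemma Omega_model_cases:
  assumes "\<mu> > 0" "x \<in> Omega \<mu>"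
  obtains v q where "v \<in> ball 1 1" "q \<in> cbox (0, 0) (2 * pi * \<mu>, 2 * pi)" "x = proj_mu \<mu> (torus_point (v, q))"
proof -
  obtain z where z: "z \<in> Omega_tilde" "z \<in> Mtilde" "x = proj_mu \<mu> z"
    using Omega_cases[OF assms(2)] .
  obtain q where q: "z = torus_point (disc_coord z, q)" "fst q = level z" "0 \<le> snd q" "snd q < 2 * pi"
    using torus_point_surj[OF z(2)] .
  define T where "T = 2 * pi * \<mu>"
  have T: "T > 0" using assms by (simp add: T_def)
  define l where "l = \<lfloor>fst q / T\<rfloor>"
  define t where "t = fst q - T * of_int l"
  have "of_int l \<le> fst q / T" "fst q / T < of_int l + 1" by (simp_all add: l_def)
  then have "0 \<le> t" "t \<le> T" using T by (simp_all add: t_def field_simps)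
  moreover have "x = proj_mu \<mu> (torus_point (disc_coord z, (t, snd q)))"
  proof -
    have "(t + 2 * pi * \<mu> * of_int l, snd q) = q" by (simp add: t_def T_def prod_eq_iff)
    then show ?thesis
      using proj_mu_torus_shift[of \<mu> "disc_coord z" t l "snd q"] q(1) z(3) by simp
  qed
  ultimately show ?thesis
    using z(1) q(3,4) by (intro that[of "disc_coord z" "(t, snd q)"]) (auto simp: Omega_tilde_iff T_def)
qed

lemma continuous_on_proj_of_holomorphic:
  assumes I: "I \<subseteq> {1, 2}"
    and hol: "holomorphic2_on Omega_tilde (\<lambda>z. u (proj_mu \<mu> z) * (\<Prod>j\<in>I. frame_coeff j z))"
  shows "continuous_on Omega_tilde (\<lambda>z. u (proj_mu \<mu> z))"
proof -
  have sub: "Omega_tilde \<subseteq> Mtilde" by (auto simp: Omega_tilde_iff)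
  have lev: "continuous_on Omega_tilde level" by (rule continuous_on_subset[OF continuous_on_level sub])
  let ?P = "\<lambda>z. \<Prod>j\<in>I. frame_coeff j z"
  have P: "?P z \<noteq> 0" if "z \<in> Omega_tilde" for z
    using that sub by (auto simp: prod_frame_coeff[OF I] Mtilde_def)
  have "continuous_on Omega_tilde ?P"
    unfolding prod_frame_coeff[OF I] using sub
    by (intro continuous_intros lev) (auto simp: Mtilde_def)
  then have "continuous_on Omega_tilde (\<lambda>z. u (proj_mu \<mu> z) * ?P z / ?P z)"
    using P by (intro continuous_on_divide holomorphic2_continuous_on[OF hol]) auto
  then show ?thesis
    using P by (simp cong: continuous_on_cong)
qed

lemma continuous_on_edge_power: "continuous_on Omega_tilde (edge_power \<kappa> b)"
proof -
  have sub: "Omega_tilde \<subseteq> Mtilde" by (auto simp: Omega_tilde_iff)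
  have 1: "continuous_on (ball 1 1) (\<lambda>v. v powr (of_real b :: complex))"
    by (intro continuous_at_imp_continuous_on ballI
        DERIV_isCont[OF has_field_derivative_powr[OF half_plane_of_disc(2)]])
  have "continuous_on Omega_tilde (\<lambda>z. disc_coord z powr of_real b)"
    by (rule continuous_on_compose2[OF 1 continuous_on_subset[OF continuous_on_disc_coord sub]])
      (auto simp: Omega_tilde_iff)
  moreover have "continuous_on Omega_tilde (phase \<kappa>)"
    unfolding phase_def[abs_def] by (intro continuous_intros continuous_on_subset[OF continuous_on_level sub])
  ultimately show ?thesis
    unfolding edge_power_def[abs_def] by (rule continuous_on_mult)
qed

lemma continuous_on_phase: "continuous_on Mtilde (phase \<kappa>)"
  unfolding phase_def[abs_def] by (intro continuous_intros continuous_on_level)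

lemma L2_mult_integrable:
  fixes u w :: "'a \<Rightarrow> complex"
  assumes "u \<in> borel_measurable M" "w \<in> borel_measurable M"
    and "integrable M (\<lambda>x. (norm (u x))\<^sup>2)" "integrable M (\<lambda>x. (norm (w x))\<^sup>2)"
  shows "integrable M (\<lambda>x. u x * cnj (w x))"
proof (rule Bochner_Integration.integrable_bound)
  show "integrable M (\<lambda>x. (norm (u x))\<^sup>2 + (norm (w x))\<^sup>2)" using assms by (intro Bochner_Integration.integrable_add)
  have "cnj \<in> borel_measurable borel"
    by (intro borel_measurable_continuous_onI continuous_intros)
  from measurable_compose[OF assms(2) this]
  show "(\<lambda>x. u x * cnj (w x)) \<in> borel_measurable M" using assms(1) by measurable
  have "x * y \<le> x\<^sup>2 + y\<^sup>2" if "0 \<le> x" "0 \<le> y" for x y :: real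
    using sum_squares_bound[of x y] mult_nonneg_nonneg[OF that] by linarith
  then show "AE x in M. norm (u x * cnj (w x)) \<le> norm ((norm (u x))\<^sup>2 + (norm (w x))\<^sup>2)"
    by (simp add: norm_mult)
qed

lemma L2_diff_integrable:
  fixes u w :: "'a \<Rightarrow> complex"
  assumes "u \<in> borel_measurable M" "w \<in> borel_measurable M"
    and "integrable M (\<lambda>x. (norm (u x))\<^sup>2)" "integrable M (\<lambda>x. (norm (w x))\<^sup>2)"
  shows "integrable M (\<lambda>x. (norm (u x - w x))\<^sup>2)"
proof (rule Bochner_Integration.integrable_bound)
  show "integrable M (\<lambda>x. 2 * (norm (u x))\<^sup>2 + 2 * (norm (w x))\<^sup>2)" using assms by simp
  show "(\<lambda>x. (norm (u x - w x))\<^sup>2) \<in> borel_measurable M" using assms(1,2) by measurable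
  have "(norm (x - y))\<^sup>2 \<le> 2 * (norm x)\<^sup>2 + 2 * (norm y)\<^sup>2" for x y :: complex
  proof -
    have "(norm (x - y))\<^sup>2 \<le> (norm x + norm y)\<^sup>2"
      by (intro power_mono norm_triangle_ineq4) simp
    also have "\<dots> \<le> 2 * (norm x)\<^sup>2 + 2 * (norm y)\<^sup>2"
      using sum_squares_bound[of "norm x" "norm y"] by (simp add: power2_sum)
    finally show ?thesis .
  qed
  then show "AE x in M. norm ((norm (u x - w x))\<^sup>2) \<le> norm (2 * (norm (u x))\<^sup>2 + 2 * (norm (w x))\<^sup>2)"
    by simp
qed

lemma L2_forms_diff:
  assumes "u \<in> L2_forms \<mu> p" "w \<in> L2_forms \<mu> p"
  shows "(\<lambda>I x. u I x - w I x) \<in> L2_forms \<mu> p"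
  using assms unfolding L2_forms_def by (auto intro!: L2_diff_integrable borel_measurable_diff)

lemma bergman_space_diff:
  assumes "u \<in> bergman_space \<mu> p" "w \<in> bergman_space \<mu> p"
  shows "(\<lambda>I x. u I x - w I x) \<in> bergman_space \<mu> p"
proof -
  have "holomorphic_form \<mu> p (\<lambda>I x. u I x - w I x)"
    unfolding holomorphic_form_def holomorphic2_on_def
  proof (intro ballI)
    fix I z assume I: "I \<in> form_index p" and z: "z \<in> Omega_tilde"
    let ?P = "\<lambda>z. \<Prod>j\<in>I. frame_coeff j z"
    have "holomorphic2_on Omega_tilde (\<lambda>z. u I (proj_mu \<mu> z) * ?P z)"
      "holomorphic2_on Omega_tilde (\<lambda>z. w I (proj_mu \<mu> z) * ?P z)"
      using assms I by (auto simp: bergman_space_def holomorphic_form_def)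
    then obtain a b a' b'
      where 1: "((\<lambda>z. u I (proj_mu \<mu> z) * ?P z) has_derivative (\<lambda>w. a * fst w + b * snd w)) (at z)"
        and 2: "((\<lambda>z. w I (proj_mu \<mu> z) * ?P z) has_derivative (\<lambda>w. a' * fst w + b' * snd w)) (at z)"
      using holomorphic2_partials(3)[OF _ z] by blast
    have "((\<lambda>z. (u I (proj_mu \<mu> z) - w I (proj_mu \<mu> z)) * ?P z) has_derivative
        (\<lambda>w. (a - a') * fst w + (b - b') * snd w)) (at z)"
      using has_derivative_diff[OF 1 2] by (simp add: algebra_simps)
    then show "\<exists>a b. ((\<lambda>z. (u I (proj_mu \<mu> z) - w I (proj_mu \<mu> z)) * ?P z) has_derivative
        (\<lambda>w. a * fst w + b * snd w)) (at z)" by blast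
  qed
  with assms show ?thesis by (auto simp: bergman_space_def intro: L2_forms_diff)
qed

lemma L2_inner_integrable:
  assumes "u \<in> L2_forms \<mu> p" "w \<in> L2_forms \<mu> p"
  shows "integrable (Omega_volume \<mu>) (\<lambda>x. \<Sum>I\<in>form_index p. u I x * cnj (w I x))"
  using assms by (intro Bochner_Integration.integrable_sum L2_mult_integrable) (auto simp: L2_forms_def)

lemma L2_inner_diff:
  assumes "u \<in> L2_forms \<mu> p" "v \<in> L2_forms \<mu> p" "w \<in> L2_forms \<mu> p"
  shows "L2_inner \<mu> p (\<lambda>I x. u I x - v I x) w = L2_inner \<mu> p u w - L2_inner \<mu> p v w"
proof -
  have "(\<Sum>I\<in>form_index p. (u I x - v I x) * cnj (w I x)) =
      (\<Sum>I\<in>form_index p. u I x * cnj (w I x)) - (\<Sum>I\<in>form_index p. v I x * cnj (w I x))" for x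
    by (simp add: left_diff_distrib sum_subtractf)
  then show ?thesis
    unfolding L2_inner_def using assms by (simp add: L2_inner_integrable)
qed

text \<open>The inner product determines a form only almost everywhere. The coefficients of a holomorphic form are
continuous in torus coordinates, and a nonempty open subset of the rectangle has positive measure, so
almost everywhere zero means zero.\<close>

lemma bergman_space_definite:
  assumes \<mu>: "\<mu> > 0" and d: "d \<in> bergman_space \<mu> p" and zero: "L2_inner \<mu> p d d = 0"
  shows "d I x = 0"
proof (cases "I \<in> form_index p \<and> x \<in> Omega \<mu>")
  case False
  then show ?thesis using d by (auto simp: bergman_space_def)
next
  case True
  then have I: "I \<in> form_index p" and x: "x \<in> Omega \<mu>" by auto
  have L2: "d \<in> L2_forms \<mu> p" and hol: "holomorphic_form \<mu> p d" using d by (auto simp: bergman_space_def)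
  define N where "N x = (\<Sum>J\<in>form_index p. (norm (d J x))\<^sup>2)" for x
  have Nint: "integrable (Omega_volume \<mu>) N"
    unfolding N_def using L2 by (intro Bochner_Integration.integrable_sum) (auto simp: L2_forms_def)
  have "(\<Sum>J\<in>form_index p. d J x * cnj (d J x)) = of_real (N x)" for x
    unfolding N_def of_real_sum complex_norm_square by (rule refl)
  then have "L2_inner \<mu> p d d = (LINT x|Omega_volume \<mu>. of_real (N x))"
    by (simp only: L2_inner_def)
  also have "\<dots> = of_real (LINT x|Omega_volume \<mu>. N x)" by (rule integral_complex_of_real)
  finally have "(LINT x|Omega_volume \<mu>. N x) = 0" using zero by simp
  then have "AE x in Omega_volume \<mu>. N x = 0"
    using integral_nonneg_eq_0_iff_AE[OF Nint AE_I2] by (simp add: N_def[abs_def] sum_nonneg)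
  then have "AE x in Omega_volume \<mu>. d I x = 0"
  proof eventually_elim
    case (elim x)
    then have "\<forall>J\<in>form_index p. (norm (d J x))\<^sup>2 = 0"
      unfolding N_def by (subst (asm) sum_nonneg_eq_0_iff) (auto simp: finite_form_index)
    with I show ?case by simp
  qed
  then have "AE x in distr (model_measure \<mu>) (Omega_volume \<mu>) (\<lambda>x. proj_mu \<mu> (torus_point x)). d I x = 0"
    by (simp only: Omega_volume_eq_distr[OF \<mu>, symmetric])
  from AE_distrD[OF measurable_proj_torus_point this]
  have "AE y in density lborel (\<lambda>_. ennreal (1 / 2)). y \<in> model_domain \<mu> \<longrightarrow> d I (proj_mu \<mu> (torus_point y)) = 0"
    unfolding model_measure_def by (subst (asm) AE_restrict_space_iff) auto
  then have AE: "AE y in lborel. y \<in> model_domain \<mu> \<longrightarrow> d I (proj_mu \<mu> (torus_point y)) = 0"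
    by (subst (asm) AE_density) auto
  have cont: "continuous_on Omega_tilde (\<lambda>z. d I (proj_mu \<mu> z))"
    using hol I by (intro continuous_on_proj_of_holomorphic[of I] form_index_subset) (auto simp: holomorphic_form_def)
  have cont': "continuous_on (ball 1 1 \<times> UNIV) (\<lambda>y. d I (proj_mu \<mu> (torus_point y)))"
    by (rule continuous_on_compose2[OF cont continuous_on_subset[OF continuous_torus_point]])
      (auto simp: torus_point_in_Omega_tilde_iff)
  \<comment> \<open>where the coefficient is nonzero, an open set in torus coordinates\<close>
  define W where "W = (ball 1 1 \<times> UNIV) \<inter> (\<lambda>y. d I (proj_mu \<mu> (torus_point y))) -` (- {0})"
  have W: "open W"
    unfolding W_def by (rule continuous_open_preimage[OF cont']) (auto simp: open_Times)
  show ?thesis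
  proof (rule ccontr)
    assume nz: "d I x \<noteq> 0"
    obtain v q where vq: "v \<in> ball 1 1" "q \<in> cbox (0, 0) (2 * pi * \<mu>, 2 * pi)" "x = proj_mu \<mu> (torus_point (v, q))"
      using Omega_model_cases[OF \<mu> x] .
    then have "(v, q) \<in> W" using nz by (auto simp: W_def)
    from open_prod_elim[OF W this] obtain A B where AB: "open A" "open B" "(v, q) \<in> A \<times> B" "A \<times> B \<subseteq> W" .
    let ?box = "box (0, 0) (2 * pi * \<mu>, 2 * pi)"
    have "?box \<noteq> {}" using \<mu> by (auto simp: box_ne_empty Basis_prod_def)
    then have "q \<in> closure ?box" using vq(2) by (simp add: closure_box)
    with AB have ne: "B \<inter> ?box \<noteq> {}" using open_Int_closure_eq_empty[of B ?box] by auto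
    have op: "A \<times> (B \<inter> ?box) \<noteq> {}" "open (A \<times> (B \<inter> ?box))"
      using AB(1,3) ne open_Times[OF AB(1) open_Int[OF AB(2) open_box]] by auto
    have "AE y in lborel. y \<notin> A \<times> (B \<inter> ?box)"
      using AE
    proof eventually_elim
      case (elim y)
      show ?case
      proof
        assume y: "y \<in> A \<times> (B \<inter> ?box)"
        then have "y \<in> W" using AB(4) by auto
        moreover have "y \<in> model_domain \<mu>"
          using y \<open>y \<in> W\<close> box_subset_cbox by (force simp: model_domain_def W_def)
        ultimately show False using elim by (auto simp: W_def)
      qed
    qed
    then have "A \<times> (B \<inter> ?box) \<in> null_sets lborel"
      using op by (subst AE_iff_null_sets) auto
    then have "negligible (A \<times> (B \<inter> ?box))"
      by (simp add: negligible_iff_null_sets null_sets_completionI)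
    then show False using open_not_negligible[OF op(2,1)] by simp
  qed
qed

section \<open>The Bergman projection of a phase\<close>

lemma set_integrable_cnj_of_disc:
  assumes "set_integrable lborel (ball (1 :: complex) 1) (f :: complex \<Rightarrow> complex)"
  shows "set_integrable lborel (ball 1 1) (\<lambda>v. cnj (f v))"
proof -
  have "integrable lborel (\<lambda>v. cnj (indicator (ball 1 1) v *\<^sub>R f v))"
    using assms unfolding set_integrable_def by (simp only: complex_integrable_cnj)
  then show ?thesis by (simp add: set_integrable_def)
qed

text \<open>In other words, the phase of weight \<open>k\<close> is not orthogonal to the generator of its weight space.\<close>

lemma Re_disc_integral_pos:
  assumes b: "-1 < b" "b \<le> (0::real)"
  shows "Re (LINT v:ball 1 1|lborel. v powr (of_real b :: complex)) > 0"
proof -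
  let ?r = "\<lambda>v. indicator (ball 1 1) v *\<^sub>R Re (v powr (of_real b :: complex))"
  have i: "integrable lborel (\<lambda>v. indicator (ball 1 1) v *\<^sub>R (v powr (of_real b :: complex)))"
    using integrable_disc_powr[OF b] by (simp add: set_integrable_def)
  have "Re (LINT v:ball 1 1|lborel. v powr (of_real b :: complex)) = (LINT v|lborel. ?r v)"
    unfolding set_lebesgue_integral_def by (subst integral_Re[OF i, symmetric]) simp
  moreover have ri: "integrable lborel ?r"
    using integrable_Re[OF i] by simp
  moreover have nn: "0 \<le> ?r v" for v
    using Re_powr_pos[OF b half_plane_of_disc(1), of v] by (auto simp: indicator_def intro: less_imp_le)
  moreover have "(LINT v|lborel. ?r v) \<noteq> 0"
  proof
    assume "(LINT v|lborel. ?r v) = 0"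
    then have "AE v in lborel. ?r v = 0"
      using integral_nonneg_eq_0_iff_AE[OF ri] nn by simp
    then have "AE v in lborel. v \<notin> ball (1 :: complex) 1"
    proof eventually_elim
      case (elim v)
      then show ?case using Re_powr_pos[OF b half_plane_of_disc(1), of v] by (auto simp: indicator_def)
    qed
    then have "ball (1 :: complex) 1 \<in> null_sets lborel" by (subst AE_iff_null_sets) auto
    then have "negligible (ball (1 :: complex) 1)" by (simp add: negligible_iff_null_sets null_sets_completionI)
    then show False using open_not_negligible[of "ball (1 :: complex) 1"] by simp
  qed
  ultimately show ?thesis using integral_nonneg_AE[of ?r lborel] by (simp add: less_le)
qed

lemma finite_Omega_volume:
  assumes "\<mu> > 0" shows "integrable (Omega_volume \<mu>) (\<lambda>_. 1 :: real)"
proof -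
  have "bounded (model_domain \<mu>)" unfolding model_domain_def by (intro bounded_Times bounded_ball bounded_cbox)
  then have "emeasure lborel (model_domain \<mu>) < \<infinity>" by (rule emeasure_bounded_finite)
  then have "integrable lborel (indicator (model_domain \<mu>) :: _ \<Rightarrow> real)"
    using model_domain_borel[of \<mu>] by (intro integrable_real_indicator) auto
  then have "integrable (model_measure \<mu>) (\<lambda>_. 1 :: real)"
    by (subst integrable_model_measure[OF borel_measurable_const]) simp
  then show ?thesis by (subst integrable_Omega_volume[OF assms borel_measurable_const])
qed

lemma integrable_lborel_tensor:
  fixes f :: "'a::euclidean_space \<Rightarrow> real" and g :: "'b::euclidean_space \<Rightarrow> real"
  assumes f: "integrable lborel f" and g: "integrable lborel g"
  shows "integrable lborel (\<lambda>y. f (fst y) * g (snd y))"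
proof -
  have [measurable]: "f \<in> borel_measurable lborel" "g \<in> borel_measurable lborel" using f g by auto
  have "integrable (lborel \<Otimes>\<^sub>M lborel) (\<lambda>y. f (fst y) * g (snd y))"
  proof (rule lborel_pair.Fubini_integrable)
    show "(\<lambda>y. f (fst y) * g (snd y)) \<in> borel_measurable (lborel \<Otimes>\<^sub>M lborel)" by measurable
    show "integrable lborel (\<lambda>x. LINT y|lborel. norm (f (fst (x, y)) * g (snd (x, y))))"
      using f by (simp add: abs_mult)
    show "AE x in lborel. integrable lborel (\<lambda>y. f (fst (x, y)) * g (snd (x, y)))" using g by simp
  qed
  then show ?thesis by (simp add: lborel_prod)
qed

lemma integral_mult_cnj: "(LINT x|M. a * cnj (F x)) = a * cnj (LINT x|M. F x)" for a :: complex
  by simp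

text \<open>The residual \<open>f - g\<close> is \<open>(1 - c v\<^sup>b) e\<^bsup>ikt/\<mu>\<^esup>\<close> in the component \<open>I\<close> and zero in all others. By Fubini its inner product
with a holomorphic form is the integral over the disc of \<open>1 - c v\<^sup>b\<close> times the conjugate of the torus
coefficient, which is a multiple of \<open>v\<^sup>b\<close>; the value of \<open>c\<close> is the one for which this integral vanishes.\<close>

lemma bergman_proj_phase:
  fixes k :: int
  assumes \<mu>: "\<mu> > 0" and I: "I \<in> form_index p" and b: "b = k / \<mu> - frame_degree 1 I" "-1 < b" "b \<le> 0"
  obtains c where "c \<noteq> 0"
    "\<And>z. z \<in> Omega_tilde \<Longrightarrow>
      bergman_proj \<mu> p (\<lambda>J x. if J = I then descend \<mu> (phase (k / \<mu>)) x else 0) I (proj_mu \<mu> z) =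
        c * edge_power (k / \<mu>) b z"
proof -
  define \<kappa> where "\<kappa> = k / \<mu>"
  define f :: form where "f = (\<lambda>J x. if J = I then descend \<mu> (phase \<kappa>) x else 0)"
  let ?D = "ball (1 :: complex) 1" and ?R = "cbox (0, 0) (2 * pi * \<mu>, 2 * pi)"
  define A where "A = (LINT v:?D|lborel. v powr (of_real b :: complex))"
  define B where "B = (LINT v:?D|lborel. (norm (v powr (of_real b :: complex)))\<^sup>2)"
  \<comment> \<open>makes the residual orthogonal to the generator of the weight space\<close>
  define c where "c = cnj A / of_real B"
  define g :: form where "g = (\<lambda>J x. if J = I \<and> x \<in> Omega \<mu> then c * descend \<mu> (edge_power \<kappa> b) x else 0)"
  have I12: "I \<subseteq> {1, 2}" by (rule form_index_subset[OF I])
  have Apos: "Re A > 0" unfolding A_def by (rule Re_disc_integral_pos[OF b(2,3)])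
  have Bpos: "B \<noteq> 0"
  proof
    assume "B = 0"
    then have "AE v in lborel. indicator ?D v *\<^sub>R (norm (v powr (of_real b :: complex)))\<^sup>2 = 0"
      using integrable_disc_powr_square[OF b(2,3)] unfolding B_def set_lebesgue_integral_def set_integrable_def
      by (subst (asm) integral_nonneg_eq_0_iff_AE) auto
    then have "AE v in lborel. indicator ?D v *\<^sub>R (v powr (of_real b :: complex)) = 0"
      by eventually_elim (auto simp: indicator_def split: if_splits)
    then have "A = (LINT v|(lborel :: complex measure). 0 :: complex)"
      unfolding A_def set_lebesgue_integral_def
      by (intro integral_cong_AE borel_measurable_disc_powr) auto
    then show False using Apos by simp
  qed
  have c0: "c \<noteq> 0" using Apos Bpos by (auto simp: c_def)
  have sub: "z \<in> Mtilde" if "z \<in> Omega_tilde" for z using that by (simp add: Omega_tilde_iff)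
  have f_proj: "f I (proj_mu \<mu> z) = phase \<kappa> z" if "z \<in> Mtilde" for z
    unfolding f_def \<kappa>_def using that by (simp add: descend_proj_mu phase_deck[OF \<mu>])
  have g_proj: "g I (proj_mu \<mu> z) = c * edge_power \<kappa> b z" if "z \<in> Omega_tilde" for z
    unfolding g_def \<kappa>_def using that sub[OF that]
    by (simp add: descend_proj_mu edge_power_deck[OF \<mu>] proj_mu_in_Omega_iff)
  have f_meas: "f I \<in> borel_measurable (Omega_volume \<mu>)"
  proof (rule borel_measurable_Omega_volume)
    have "continuous_on Omega_tilde (phase \<kappa>)"
      by (rule continuous_on_subset[OF continuous_on_phase]) (use sub in auto)
    then show "continuous_on Omega_tilde (\<lambda>z. f I (proj_mu \<mu> z))"
      by (subst continuous_on_cong[OF refl f_proj[OF sub]]) auto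
  qed
  have g_meas: "g I \<in> borel_measurable (Omega_volume \<mu>)"
  proof (rule borel_measurable_Omega_volume)
    have "continuous_on Omega_tilde (\<lambda>z. c * edge_power \<kappa> b z)"
      by (intro continuous_intros continuous_on_edge_power)
    then show "continuous_on Omega_tilde (\<lambda>z. g I (proj_mu \<mu> z))"
      by (subst continuous_on_cong[OF refl g_proj]) auto
  qed
  have f_L2: "f \<in> L2_forms \<mu> p"
  proof -
    have "integrable (Omega_volume \<mu>) (\<lambda>x. (norm (f I x))\<^sup>2)"
    proof (subst Bochner_Integration.integrable_cong[OF refl])
      fix x assume "x \<in> space (Omega_volume \<mu>)"
      then obtain z where "z \<in> Mtilde" "x = proj_mu \<mu> z"
        by (auto simp: space_Omega_volume elim: Omega_cases)
      then show "(norm (f I x))\<^sup>2 = 1" by (simp add: f_proj)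
    qed (rule finite_Omega_volume[OF \<mu>])
    then have "f J \<in> borel_measurable (Omega_volume \<mu>) \<and> integrable (Omega_volume \<mu>) (\<lambda>x. (norm (f J x))\<^sup>2)" for J
    proof (cases "J = I")
      case False
      then have "f J = (\<lambda>_. 0)" by (simp add: f_def)
      then show ?thesis by simp
    qed (use f_meas in simp)
    then show ?thesis unfolding L2_forms_def by blast
  qed
  have g_torus: "g I (proj_mu \<mu> (torus_point y)) = c * (fst y powr of_real b * phase \<kappa> (torus_point y))"
    if "fst y \<in> ?D" for y
    using that by (simp add: g_proj torus_point_in_Omega_tilde_iff edge_power_def)
  have g_L2: "g \<in> L2_forms \<mu> p"
  proof -
    let ?N = "\<lambda>y. (norm (g I (proj_mu \<mu> (torus_point y))))\<^sup>2"
    have sq: "integrable lborel (\<lambda>v. indicator ?D v *\<^sub>R (norm (v powr (of_real b :: complex)))\<^sup>2)"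
      using integrable_disc_powr_square[OF b(2,3)] by (simp add: set_integrable_def)
    have "emeasure lborel ?R < \<infinity>" by (rule emeasure_lborel_cbox_finite)
    then have R: "integrable lborel (indicator ?R :: real \<times> real \<Rightarrow> real)"
      by (intro integrable_real_indicator) auto
    have "integrable lborel (\<lambda>y. (norm c)\<^sup>2 * ((indicator ?D (fst y) *\<^sub>R (norm (fst y powr (of_real b :: complex)))\<^sup>2) * (indicator ?R (snd y) :: real)))"
      by (rule integrable_mult_right[OF integrable_lborel_tensor[OF sq R]])
    also have "(\<lambda>y. (norm c)\<^sup>2 * ((indicator ?D (fst y) *\<^sub>R (norm (fst y powr (of_real b :: complex)))\<^sup>2) * (indicator ?R (snd y) :: real))) =
        (\<lambda>y. indicator (model_domain \<mu>) y *\<^sub>R ?N y)"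
    proof
      fix y
      show "(norm c)\<^sup>2 * ((indicator ?D (fst y) *\<^sub>R (norm (fst y powr (of_real b :: complex)))\<^sup>2) * (indicator ?R (snd y) :: real)) =
        indicator (model_domain \<mu>) y *\<^sub>R ?N y"
        by (cases "fst y \<in> ?D") (simp_all add: g_torus norm_mult power_mult_distrib model_domain_def indicator_def mem_Times_iff del: mem_ball)
    qed
    finally have "integrable lborel (\<lambda>y. indicator (model_domain \<mu>) y *\<^sub>R ?N y)" .
    moreover have mN: "(\<lambda>x. (norm (g I x))\<^sup>2) \<in> borel_measurable (Omega_volume \<mu>)" using g_meas by measurable
    moreover from measurable_compose[OF measurable_proj_torus_point mN]
    have "?N \<in> borel_measurable (restrict_space borel (model_domain \<mu>))"
      by (simp cong: measurable_cong_sets add: sets_model_measure)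
    ultimately have "integrable (Omega_volume \<mu>) (\<lambda>x. (norm (g I x))\<^sup>2)"
      by (simp add: integrable_Omega_volume[OF \<mu>] integrable_model_measure)
    then have "g J \<in> borel_measurable (Omega_volume \<mu>) \<and> integrable (Omega_volume \<mu>) (\<lambda>x. (norm (g J x))\<^sup>2)" for J
    proof (cases "J = I")
      case False
      then have "g J = (\<lambda>_. 0)" by (simp add: g_def)
      then show ?thesis by simp
    qed (use g_meas in simp)
    then show ?thesis unfolding L2_forms_def by blast
  qed
  have g_berg: "g \<in> bergman_space \<mu> p"
  proof -
    have "holomorphic2_on Omega_tilde (\<lambda>z. g J (proj_mu \<mu> z) * (\<Prod>j\<in>J. frame_coeff j z))" for J
    proof (cases "J = I")
      case False
      then have "(\<lambda>z. g J (proj_mu \<mu> z) * (\<Prod>j\<in>J. frame_coeff j z)) = (\<lambda>_. 0)" by (simp add: g_def)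
      moreover have "((\<lambda>_. 0 :: complex) has_derivative (\<lambda>w. 0 * fst w + 0 * snd w)) (at z)" for z :: "complex \<times> complex"
        by simp
      ultimately show ?thesis unfolding holomorphic2_on_def by metis
    next
      case True
      have "\<exists>a b. ((\<lambda>z. g I (proj_mu \<mu> z) * (\<Prod>j\<in>I. frame_coeff j z)) has_derivative (\<lambda>w. a * fst w + b * snd w)) (at z)"
        if z: "z \<in> Omega_tilde" for z
      proof -
        have "holomorphic2_on Omega_tilde (\<lambda>z. c * edge_power \<kappa> b z * (\<Prod>j\<in>I. frame_coeff j z))"
          by (rule holomorphic2_edge_power[OF I12]) (simp add: b(1) \<kappa>_def)
        from has_derivative_transform_within_open[OF holomorphic2_partials(3)[OF this z] open_Omega_tilde z,
            of "\<lambda>z. g I (proj_mu \<mu> z) * (\<Prod>j\<in>I. frame_coeff j z)"]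
        show ?thesis by (auto simp: g_proj)
      qed
      then show ?thesis unfolding holomorphic2_on_def True by blast
    qed
    then show ?thesis
      using g_L2 I by (auto simp: bergman_space_def holomorphic_form_def g_def)
  qed
  have orth: "L2_inner \<mu> p (\<lambda>J x. f J x - g J x) h = 0" if h: "h \<in> bergman_space \<mu> p" for h
  proof -
    define u where "u = h I"
    have hL2: "h \<in> L2_forms \<mu> p" using h by (simp add: bergman_space_def)
    have hol: "holomorphic2_on Omega_tilde (\<lambda>z. u (proj_mu \<mu> z) * (\<Prod>j\<in>I. frame_coeff j z))"
      using h I by (auto simp: bergman_space_def holomorphic_form_def u_def)
    define \<phi> where "\<phi> x = (f I x - g I x) * cnj (u x)" for x
    have d_L2: "(\<lambda>J x. f J x - g J x) \<in> L2_forms \<mu> p" by (rule L2_forms_diff[OF f_L2 g_L2])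
    have \<phi>_int: "integrable (Omega_volume \<mu>) \<phi>"
      unfolding \<phi>_def u_def using d_L2 hL2 I by (intro L2_mult_integrable) (auto simp: L2_forms_def)
    have \<phi>_meas: "\<phi> \<in> borel_measurable (Omega_volume \<mu>)" using \<phi>_int by (rule borel_measurable_integrable)
    let ?\<psi> = "\<lambda>y. \<phi> (proj_mu \<mu> (torus_point y))"
    have \<psi>_meas: "?\<psi> \<in> borel_measurable (restrict_space borel (model_domain \<mu>))"
      using measurable_compose[OF measurable_proj_torus_point \<phi>_meas]
      by (simp cong: measurable_cong_sets add: sets_model_measure)
    have \<psi>_int: "integrable lborel (\<lambda>y. indicator (model_domain \<mu>) y *\<^sub>R ?\<psi> y)"
      using \<phi>_int by (simp add: integrable_Omega_volume[OF \<mu> \<phi>_meas] integrable_model_measure[OF \<psi>_meas])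
    obtain C where C: "\<And>v. v \<in> ?D \<Longrightarrow>
        integral ?R (\<lambda>q. cnj (phase \<kappa> (torus_point (v, q))) * u (proj_mu \<mu> (torus_point (v, q)))) = C * v powr of_real b"
      using torus_coefficient[OF \<mu> I12 b(1) hol] unfolding \<kappa>_def by blast
    have inner: "(LINT q|lborel. indicator (model_domain \<mu>) (v, q) *\<^sub>R ?\<psi> (v, q)) =
        indicator ?D v *\<^sub>R ((1 - c * v powr of_real b) * cnj (C * v powr of_real b))" for v
    proof (cases "v \<in> ?D")
      case False
      then show ?thesis by (simp add: model_domain_def)
    next
      case True
      let ?w = "\<lambda>q. cnj (phase \<kappa> (torus_point (v, q))) * u (proj_mu \<mu> (torus_point (v, q)))"
      have "continuous_on ?R (\<lambda>q. torus_point (v, q))"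
        by (rule continuous_on_compose2[OF continuous_torus_point]) (auto intro: continuous_intros)
      then have "continuous_on ?R ?w"
        using True
        by (intro continuous_on_mult continuous_on_cnj
            continuous_on_compose2[OF continuous_on_phase]
            continuous_on_compose2[OF continuous_on_proj_of_holomorphic[OF I12 hol]])
          (auto simp: torus_point_in_Omega_tilde_iff)
      from borel_integrable_compact[OF compact_cbox this]
      have w: "set_integrable lborel ?R ?w" by (simp add: set_integrable_def)
      have "(LINT q|lborel. indicator (model_domain \<mu>) (v, q) *\<^sub>R ?\<psi> (v, q)) =
          (LINT q|lborel. (1 - c * v powr of_real b) * cnj (indicator ?R q *\<^sub>R ?w q))"
      proof (intro Bochner_Integration.integral_cong refl)
        fix q
        have "?\<psi> (v, q) = (1 - c * v powr of_real b) * cnj (?w q)"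
          using True by (simp add: \<phi>_def f_proj g_torus algebra_simps)
        then show "indicator (model_domain \<mu>) (v, q) *\<^sub>R ?\<psi> (v, q) =
            (1 - c * v powr of_real b) * cnj (indicator ?R q *\<^sub>R ?w q)"
          using True by (simp add: model_domain_def indicator_def)
      qed
      also have "\<dots> = (1 - c * v powr of_real b) * cnj (LINT q:?R|lborel. ?w q)"
        unfolding set_lebesgue_integral_def by (rule integral_mult_cnj)
      also have "(LINT q:?R|lborel. ?w q) = integral ?R ?w"
        by (rule set_borel_integral_eq_integral(2)[OF w])
      also have "\<dots> = C * v powr of_real b" by (rule C[OF True])
      finally show ?thesis using True by simp
    qed
    have "L2_inner \<mu> p (\<lambda>J x. f J x - g J x) h = (LINT x|Omega_volume \<mu>. \<phi> x)"
    proof -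
      have "(\<Sum>J\<in>form_index p. (f J x - g J x) * cnj (h J x)) = \<phi> x" for x
      proof -
        have "(\<Sum>J\<in>form_index p. (f J x - g J x) * cnj (h J x)) = (\<Sum>J\<in>form_index p. if J = I then \<phi> x else 0)"
          by (intro sum.cong refl) (auto simp: f_def g_def \<phi>_def u_def)
        also have "\<dots> = \<phi> x" using I by (simp add: finite_form_index)
        finally show ?thesis .
      qed
      then show ?thesis by (simp add: L2_inner_def)
    qed
    also have "\<dots> = (1 / 2) *\<^sub>R (LINT y|lborel. indicator (model_domain \<mu>) y *\<^sub>R ?\<psi> y)"
      by (simp only: integral_Omega_volume[OF \<mu> \<phi>_meas] integral_model_measure[OF \<psi>_meas])
    also have "(LINT y|lborel. indicator (model_domain \<mu>) y *\<^sub>R ?\<psi> y) =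
        (LINT v|lborel. LINT q|lborel. indicator (model_domain \<mu>) (v, q) *\<^sub>R ?\<psi> (v, q))"
      using lborel_pair.integral_fst'[of "\<lambda>y. indicator (model_domain \<mu>) y *\<^sub>R ?\<psi> y"] \<psi>_int
      by (simp add: lborel_prod)
    also have "\<dots> = (LINT v:?D|lborel. cnj C * (cnj (v powr of_real b) - c * of_real ((norm (v powr (of_real b :: complex)))\<^sup>2)))"
      unfolding inner set_lebesgue_integral_def
      unfolding complex_norm_square
      by (intro Bochner_Integration.integral_cong refl) (simp add: algebra_simps)
    also have "\<dots> = cnj C * ((LINT v:?D|lborel. cnj (v powr of_real b)) - c * (LINT v:?D|lborel. of_real ((norm (v powr (of_real b :: complex)))\<^sup>2)))"
    proof -
      have 1: "set_integrable lborel ?D (\<lambda>v. cnj (v powr of_real b))"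
        by (rule set_integrable_cnj_of_disc[OF integrable_disc_powr[OF b(2,3)]])
      have "integrable lborel (\<lambda>v. of_real (indicator ?D v *\<^sub>R (norm (v powr (of_real b :: complex)))\<^sup>2) :: complex)"
        using integrable_disc_powr_square[OF b(2,3)] unfolding set_integrable_def by (rule integrable_of_real)
      then have 2: "set_integrable lborel ?D (\<lambda>v. of_real ((norm (v powr (of_real b :: complex)))\<^sup>2) :: complex)"
        by (simp add: set_integrable_def scaleR_conv_of_real)
      show ?thesis
        by (subst set_integral_mult_right, subst set_integral_diff(2)[OF 1 set_integrable_mult_right[OF 2]],
            subst set_integral_mult_right) (rule refl)
    qed
    also have "(LINT v:?D|lborel. cnj (v powr of_real b)) = cnj A"
    proof -
      have "(LINT v:?D|lborel. cnj (v powr of_real b)) = (LINT v|lborel. cnj (indicator ?D v *\<^sub>R (v powr of_real b)))"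
        by (simp add: set_lebesgue_integral_def)
      also have "\<dots> = cnj A" unfolding A_def set_lebesgue_integral_def by (rule Bochner_Integration.integral_cnj)
      finally show ?thesis .
    qed
    also have "(LINT v:?D|lborel. of_real ((norm (v powr (of_real b :: complex)))\<^sup>2)) = complex_of_real B"
    proof -
      have "(LINT v:?D|lborel. of_real ((norm (v powr (of_real b :: complex)))\<^sup>2)) =
          (LINT v|lborel. complex_of_real (indicator ?D v *\<^sub>R (norm (v powr (of_real b :: complex)))\<^sup>2))"
        by (simp add: set_lebesgue_integral_def scaleR_conv_of_real)
      then show ?thesis by (simp only: integral_complex_of_real B_def set_lebesgue_integral_def)
    qed
    also have "cnj A - c * of_real B = 0" using Bpos by (simp add: c_def)
    finally show ?thesis by simp
  qed
  have "bergman_proj \<mu> p f = g"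
    unfolding bergman_proj_def
  proof (rule the_equality)
    show "g \<in> bergman_space \<mu> p \<and> (\<forall>h\<in>bergman_space \<mu> p. L2_inner \<mu> p (\<lambda>I x. f I x - g I x) h = 0)"
      using g_berg orth by blast
    fix g' assume g': "g' \<in> bergman_space \<mu> p \<and> (\<forall>h\<in>bergman_space \<mu> p. L2_inner \<mu> p (\<lambda>I x. f I x - g' I x) h = 0)"
    define d where "d = (\<lambda>J x. g' J x - g J x)"
    have d: "d \<in> bergman_space \<mu> p" unfolding d_def using g' g_berg by (intro bergman_space_diff) auto
    have L2: "d \<in> L2_forms \<mu> p" "g' \<in> L2_forms \<mu> p" using d g' by (auto simp: bergman_space_def)
    have "L2_inner \<mu> p d d = L2_inner \<mu> p g' d - L2_inner \<mu> p g d"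
      using L2_inner_diff[OF L2(2) g_L2 L2(1)] by (simp add: d_def)
    also have "\<dots> = 0"
      using orth[OF d] g' d L2_inner_diff[OF f_L2 g_L2 L2(1)] L2_inner_diff[OF f_L2 L2(2,1)] by auto
    finally have "d J x = 0" for J x by (rule bergman_space_definite[OF \<mu> d])
    then show "g' = g" by (simp add: d_def fun_eq_iff)
  qed
  then show thesis
    using that[OF c0] g_proj unfolding f_def \<kappa>_def by simp
qed

section \<open>Smoothness of the phase\<close>

text \<open>The algebra generated by the real coordinates and the exponentials of multiples of \<open>\<theta>\<close>. It contains the
derivatives of its members because \<open>1 / |z\<^sub>2|\<^sup>2\<close>, which appears in the derivative of \<open>\<theta>\<close>, is \<open>e\<^bsup>-\<theta>\<^esup>\<close>.\<close>

inductive level_smooth :: "(complex \<times> complex \<Rightarrow> complex) \<Rightarrow> bool" where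
  const: "level_smooth (\<lambda>_. c)"
| linear: "level_smooth (\<lambda>z. of_real (c \<bullet> z))"
| exp: "level_smooth (\<lambda>z. exp (a * of_real (level z)))"
| add: "level_smooth f \<Longrightarrow> level_smooth g \<Longrightarrow> level_smooth (\<lambda>z. f z + g z)"
| mult: "level_smooth f \<Longrightarrow> level_smooth g \<Longrightarrow> level_smooth (\<lambda>z. f z * g z)"

lemma level_smooth_derivative:
  assumes "level_smooth f"
  shows "\<exists>f'. (\<forall>z\<in>Mtilde. (f has_derivative f' z) (at z)) \<and> (\<forall>d. level_smooth (\<lambda>z. f' z d))"
  using assms
proof induction
  case (const c)
  show ?case by (rule exI[of _ "\<lambda>_ _. 0"]) (auto intro: level_smooth.const)
next
  case (linear c)
  have "((\<lambda>z. complex_of_real (c \<bullet> z)) has_derivative (\<lambda>d. of_real (c \<bullet> d))) (at z)" for z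
    by (auto intro!: derivative_eq_intros)
  then show ?case by (intro exI[of _ "\<lambda>_ d. of_real (c \<bullet> d)"]) (auto intro: level_smooth.const)
next
  case (exp a)
  let ?f' = "\<lambda>z d. exp (a * of_real (level z)) * (a * 2 * (of_real ((0, snd d) \<bullet> z) * exp (- 1 * of_real (level z))))"
  have "((\<lambda>z. exp (a * of_real (level z))) has_derivative ?f' z) (at z)" if "z \<in> Mtilde" for z
  proof -
    have "((\<lambda>z. a * of_real (level z)) has_derivative (\<lambda>d. a * of_real (2 * (snd z \<bullet> snd d) * exp (- level z)))) (at z)"
      using level_has_derivative[OF that] by (auto intro!: derivative_eq_intros)
    from has_derivative_compose[OF this DERIV_exp[THEN has_field_derivative_imp_has_derivative]]
    show ?thesis
      by (rule has_derivative_eq_rhs) (simp add: fun_eq_iff inner_prod_def inner_commute exp_of_real[symmetric])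
  qed
  moreover have "level_smooth (\<lambda>z. ?f' z d)" for d
    by (intro level_smooth.mult level_smooth.exp level_smooth.const level_smooth.linear)
  ultimately show ?case by (intro exI[of _ ?f']) auto
next
  case (add f g)
  then obtain f' g' where "\<forall>z\<in>Mtilde. (f has_derivative f' z) (at z)" "\<And>d. level_smooth (\<lambda>z. f' z d)"
    "\<forall>z\<in>Mtilde. (g has_derivative g' z) (at z)" "\<And>d. level_smooth (\<lambda>z. g' z d)" by blast
  then show ?case
    by (intro exI[of _ "\<lambda>z d. f' z d + g' z d"]) (auto intro: level_smooth.add has_derivative_add)
next
  case (mult f g)
  then obtain f' g' where "\<forall>z\<in>Mtilde. (f has_derivative f' z) (at z)" "\<And>d. level_smooth (\<lambda>z. f' z d)"
    "\<forall>z\<in>Mtilde. (g has_derivative g' z) (at z)" "\<And>d. level_smooth (\<lambda>z. g' z d)" by blast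
  with mult show ?case
    by (intro exI[of _ "\<lambda>z d. f z * g' z d + f' z d * g z"])
      (auto intro!: level_smooth.add level_smooth.mult has_derivative_mult)
qed

lemma smooth_on_level_smooth:
  assumes "level_smooth g" and eq: "\<And>z. z \<in> Mtilde \<Longrightarrow> f z = g z"
  shows "smooth_on Mtilde f"
  unfolding smooth_on_def
proof
  fix k
  show "Ck_on k Mtilde f" using assms
  proof (induction k arbitrary: f g)
    case 0
    obtain g' where "\<forall>z\<in>Mtilde. (g has_derivative g' z) (at z)"
      using level_smooth_derivative[OF 0(1)] by blast
    then have "continuous_on Mtilde g"
      by (intro continuous_at_imp_continuous_on) (auto intro: has_derivative_continuous)
    then show ?case using 0(2) by (simp cong: continuous_on_cong)
  next
    case (Suc k)
    obtain g' where g': "\<And>z. z \<in> Mtilde \<Longrightarrow> (g has_derivative g' z) (at z)" "\<And>d. level_smooth (\<lambda>z. g' z d)"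
      using level_smooth_derivative[OF Suc.prems(1)] by blast
    have f': "(f has_derivative g' z) (at z)" if "z \<in> Mtilde" for z
      by (rule has_derivative_transform_within_open[OF g'(1)[OF that] open_Mtilde that]) (simp add: Suc.prems(2))
    have "Ck_on k Mtilde (\<lambda>z. frechet_derivative f (at z) d)" for d
    proof (rule Suc.IH[OF g'(2)])
      show "frechet_derivative f (at z) d = g' z d" if "z \<in> Mtilde" for z
        using frechet_derivative_at[OF f'[OF that]] by simp
    qed
    then show ?case
      unfolding Ck_on.simps by (intro conjI ballI differentiableI[OF f'])
  qed
qed

lemma smooth_closure_phase:
  fixes k :: int
  assumes "\<mu> > 0"
  shows "descend \<mu> (phase (k / \<mu>)) \<in> smooth_closure \<mu>"
proof -
  have "smooth_on Mtilde (descend \<mu> (phase (k / \<mu>)) \<circ> proj_mu \<mu>)"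
  proof (rule smooth_on_level_smooth)
    show "level_smooth (\<lambda>z. exp (\<i> * of_real (k / \<mu>) * of_real (level z)))" by (rule level_smooth.exp)
    show "(descend \<mu> (phase (k / \<mu>)) \<circ> proj_mu \<mu>) z = exp (\<i> * of_real (k / \<mu>) * of_real (level z))"
      if "z \<in> Mtilde" for z
      using that by (simp add: descend_proj_mu phase_deck[OF assms]) (simp add: phase_def mult.assoc)
  qed
  then show ?thesis unfolding smooth_closure_def by blast
qed

lemma smooth_closure_zero: "(\<lambda>_. 0) \<in> smooth_closure \<mu>"
proof -
  have "smooth_on Mtilde ((\<lambda>_. 0 :: complex) \<circ> proj_mu \<mu>)"
    by (rule smooth_on_level_smooth[OF level_smooth.const[of 0]]) simp
  then show ?thesis unfolding smooth_closure_def by blast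
qed

section \<open>The Gagliardo seminorm near the edge\<close>

lemma emeasure_ball_complex: "r \<ge> 0 \<Longrightarrow> emeasure lborel (ball (c :: complex) r) = ennreal (pi * r\<^sup>2)"
  by (subst emeasure_ball) (auto simp: unit_ball_vol_2)

lemma emeasure_bidisc:
  assumes "r \<ge> 0" "t \<ge> 0"
  shows "emeasure lborel (ball (c :: complex) r \<times> ball (d :: complex) t) = ennreal (pi\<^sup>2 * r\<^sup>2 * t\<^sup>2)"
proof -
  have "emeasure lborel (ball c r \<times> ball d t) = emeasure (lborel \<Otimes>\<^sub>M lborel) (ball c r \<times> ball d t)"
    by (simp add: lborel_prod)
  also have "\<dots> = emeasure lborel (ball c r) * emeasure lborel (ball d t)"
    by (rule lborel.emeasure_pair_measure_Times) auto
  also have "\<dots> = ennreal (pi * r\<^sup>2 * (pi * t\<^sup>2))"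
    using assms by (simp add: emeasure_ball_complex ennreal_mult)
  also have "pi * r\<^sup>2 * (pi * t\<^sup>2) = pi\<^sup>2 * r\<^sup>2 * t\<^sup>2" by (simp add: power2_eq_square)
  finally show ?thesis .
qed

text \<open>Close to a boundary point with \<open>z\<^sub>1 = 0\<close> the domain contains balls in \<open>z\<^sub>1\<close> of radius comparable to their
distance to \<open>0\<close>, along the inward normal \<open>- e\<^bsup>i\<theta>\<^esup>\<close>, uniformly for nearby values of \<open>z\<^sub>2\<close>.\<close>

lemma corkscrew_in_Omega_tilde:
  assumes z2: "snd z \<noteq> 0" and lev: "\<bar>level z - \<theta>\<bar> < 1 / 4"
    and \<rho>: "0 < \<rho>" "\<rho> \<le> 1" and z1: "fst z \<in> ball (- (exp (\<i> * of_real \<theta>) * of_real \<rho>)) (\<rho> / 4)"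
  shows "z \<in> Omega_tilde"
proof -
  define x where "x = \<theta> - level z"
  define w where "w = - (fst z * exp (- (\<i> * of_real \<theta>))) / of_real \<rho>"
  have v: "disc_coord z = of_real \<rho> * (exp (\<i> * of_real x) * w)"
    using \<rho> by (simp add: disc_coord_def w_def x_def exp_diff exp_minus field_simps)
  have w1: "norm (w - 1) < 1 / 4"
  proof -
    have "w - 1 = - (exp (- (\<i> * of_real \<theta>)) * (fst z - - (exp (\<i> * of_real \<theta>) * of_real \<rho>))) / of_real \<rho>"
      using \<rho> by (simp add: w_def exp_minus field_simps)
    then have "norm (w - 1) = dist (fst z) (- (exp (\<i> * of_real \<theta>) * of_real \<rho>)) / \<rho>"
      using \<rho> by (simp add: norm_divide norm_mult dist_norm)
    moreover have "dist (fst z) (- (exp (\<i> * of_real \<theta>) * of_real \<rho>)) / \<rho> < \<rho> / 4 / \<rho>"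
      using z1 \<rho>(1) by (intro divide_strict_right_mono) (simp_all add: dist_commute)
    ultimately show ?thesis using \<rho>(1) by simp
  qed
  have "norm w \<le> 5 / 4" using w1 norm_triangle_ineq2[of w 1] by simp
  have arc: "norm (exp (\<i> * of_real x) - 1) \<le> 1 / 4"
  proof -
    have "norm (exp (\<i> * of_real x) - 1) = 2 * \<bar>sin (x / 2)\<bar>" by (rule dist_exp_i_1)
    also have "\<dots> \<le> 2 * \<bar>x / 2\<bar>" by (intro mult_left_mono abs_sin_x_le_abs_x) simp
    also have "\<dots> = \<bar>level z - \<theta>\<bar>" by (simp add: x_def abs_minus_commute)
    also have "\<dots> \<le> 1 / 4" using lev by simp
    finally show ?thesis .
  qed
  have "norm (exp (\<i> * of_real x) * w - 1) = norm ((exp (\<i> * of_real x) - 1) * w + (w - 1))"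
    by (simp add: algebra_simps)
  also have "\<dots> \<le> norm (exp (\<i> * of_real x) - 1) * norm w + norm (w - 1)"
    by (rule order_trans[OF norm_triangle_ineq]) (simp add: norm_mult)
  also have "\<dots> \<le> 1 / 4 * (5 / 4) + 1 / 4"
    using arc \<open>norm w \<le> 5 / 4\<close> w1 by (intro add_mono mult_mono) simp_all
  finally have t: "norm (exp (\<i> * of_real x) * w - 1) \<le> 9 / 16" by simp
  have "norm (disc_coord z - 1) = norm (of_real \<rho> * (exp (\<i> * of_real x) * w - 1) + of_real (\<rho> - 1))"
    unfolding v by (simp add: algebra_simps)
  also have "\<dots> \<le> \<rho> * norm (exp (\<i> * of_real x) * w - 1) + \<bar>\<rho> - 1\<bar>"
    using \<rho> by (intro order_trans[OF norm_triangle_ineq]) (simp only: norm_mult norm_of_real abs_of_pos order_refl)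
  also have "\<dots> \<le> \<rho> * (9 / 16) + (1 - \<rho>)"
    using \<rho> t by (intro add_mono mult_left_mono) auto
  also have "\<dots> < 1" using \<rho> by simp
  finally show ?thesis
    using z2 by (simp add: Omega_tilde_iff Mtilde_def dist_norm norm_minus_commute)
qed

text \<open>At each scale \<open>\<rho>\<close> compare points \<open>x\<close> with \<open>|x\<^sub>1| \<approx> \<rho>\<close> and \<open>y\<close> with \<open>|y\<^sub>1| \<approx> K \<rho>\<close> and \<open>|x\<^sub>2 - y\<^sub>2| < \<rho>\<close>. For
large \<open>K\<close> the values of \<open>F\<close> differ by a multiple of \<open>\<rho>\<^sup>b\<close>, while the points are at distance at most
a multiple of \<open>\<rho>\<close>. These pairs have measure of order \<open>\<rho>\<^sup>2 \<cdot> \<rho>\<^sup>4\<close>, so they contribute at least a multiple of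
\<open>\<rho>\<^bsup>2b + 6 - (4 + 2s)\<^esup>\<close>, which is bounded below because the exponent is at most zero. Infinitely many
disjoint dyadic scales make the integral infinite. Two-sided bounds on \<open>|F|\<close> in place of a formula
admit a cut-off factor.\<close>

lemma gagliardo_edge_power_infinite:
  fixes F :: "complex \<times> complex \<Rightarrow> complex" and b s m r :: real
  assumes b: "b < 0" and s: "0 < s" "1 + b \<le> s" and m: "m > 0" and r: "r > 0" and \<zeta>: "\<zeta> \<noteq> 0"
    and bounds: "AE z in lborel. z \<in> ball (0, \<zeta>) r \<inter> Omega_tilde \<longrightarrow>
      m * norm (fst z) powr b \<le> norm (F z) \<and> norm (F z) \<le> 2 * m * norm (fst z) powr b"
  shows "\<not> finite_gagliardo s F"
proof
  assume fin: "finite_gagliardo s F"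
  define \<theta> where "\<theta> = ln ((norm \<zeta>)\<^sup>2)"
  define e where "e = - exp (\<i> * of_real \<theta>)"
  have ne: "norm e = 1" by (simp add: e_def)
  obtain \<delta> where \<delta>: "0 < \<delta>" "\<delta> \<le> r / 2"
    and \<delta>lev: "\<And>w. dist w \<zeta> < \<delta> \<Longrightarrow> w \<noteq> 0 \<and> \<bar>ln ((norm w)\<^sup>2) - \<theta>\<bar> < 1 / 4"
  proof -
    have "isCont (\<lambda>w. ln ((norm w)\<^sup>2)) \<zeta>" using \<zeta> by (intro continuous_intros) auto
    then obtain d where d: "d > 0" "\<And>w. dist w \<zeta> < d \<Longrightarrow> dist (ln ((norm w)\<^sup>2)) \<theta> < 1 / 4"
      unfolding continuous_at_eps_delta \<theta>_def by (metis zero_less_divide_1_iff zero_less_numeral)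
    show thesis
    proof (rule that[of "min d (min (norm \<zeta>) (r / 2))"])
      fix w assume w: "dist w \<zeta> < min d (min (norm \<zeta>) (r / 2))"
      have "w \<noteq> 0" using w by (auto simp: dist_norm)
      then show "w \<noteq> 0 \<and> \<bar>ln ((norm w)\<^sup>2) - \<theta>\<bar> < 1 / 4" using w d(2)[of w] by (simp add: dist_real_def)
    qed (use d r \<zeta> in auto)
  qed
  \<comment> \<open>Both points of a pair lie within a quarter of their scale, so \<open>|x\<^sub>1| \<le> 5\<rho>/4\<close> and \<open>|y\<^sub>1| \<ge> 3K\<rho>/4\<close>; this \<open>K\<close> makes the bound for \<open>|F y|\<close> half of the one for \<open>|F x|\<close>.\<close>
  define K where "K = 5 / 3 * 4 powr (- 1 / b)"
  have "(4 :: real) powr (- 1 / b) \<ge> 4 powr 0" using b by (intro powr_mono) auto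
  then have K1: "K \<ge> 1" by (simp add: K_def)
  have Kb: "(3 / 5 * K) powr b = 1 / 4"
  proof -
    have "(3 / 5 * K) powr b = 4 powr (- 1 / b * b)" by (simp add: K_def powr_powr)
    also have "- 1 / b * b = - 1" using b by simp
    finally show ?thesis by (simp add: powr_minus_divide)
  qed
  \<comment> \<open>small enough for both balls of a pair to stay in the domain and in the given ball\<close>
  define \<rho>0 where "\<rho>0 = min (1 / K) (min (\<delta> / 2) (r / (4 * K)))"
  have \<rho>0: "0 < \<rho>0" "K * \<rho>0 \<le> 1" "\<rho>0 \<le> \<delta> / 2" "K * \<rho>0 \<le> r / 4"
    using K1 \<delta> r by (auto simp: \<rho>0_def field_simps min_def)
  define \<rho> where "\<rho> l = \<rho>0 / 2 ^ l" for l :: nat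
  have \<rho>: "0 < \<rho> l" "\<rho> l \<le> \<rho>0" for l
    using \<rho>0 by (auto simp: \<rho>_def field_simps)
  have \<rho>K: "K * \<rho> l \<le> 1" "K * \<rho> l \<le> r / 4" "\<rho> l \<le> 1" for l
  proof -
    have "K * \<rho> l \<le> K * \<rho>0" using \<rho>[of l] K1 by (intro mult_left_mono) auto
    then show "K * \<rho> l \<le> 1" "K * \<rho> l \<le> r / 4" using \<rho>0 by linarith+
    moreover have "\<rho> l \<le> K * \<rho> l" using \<rho>[of l] K1 by simp
    ultimately show "\<rho> l \<le> 1" by linarith
  qed
  define X where "X l = ball (e * of_real (\<rho> l)) (\<rho> l / 4) \<times> ball \<zeta> (\<delta> / 2)" for l
  define Y where "Y l x = ball (e * of_real (K * \<rho> l)) (K * \<rho> l / 4) \<times> ball (snd x) (\<rho> l)"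
    for l and x :: "complex \<times> complex"
  have near: "z \<in> ball (0, \<zeta>) r \<inter> Omega_tilde \<and> 3 / 4 * t \<le> norm (fst z) \<and> norm (fst z) \<le> 5 / 4 * t"
    if t: "0 < t" "t \<le> 1" "t \<le> r / 4" and z1: "fst z \<in> ball (e * of_real t) (t / 4)" and z2: "dist (snd z) \<zeta> < \<delta>"
    for t and z :: "complex \<times> complex"
  proof -
    have d: "dist (fst z) (e * of_real t) < t / 4" using z1 by (simp add: dist_commute)
    have n: "norm (e * of_real t) = t" using t ne by (simp add: norm_mult)
    have n1: "3 / 4 * t \<le> norm (fst z)" "norm (fst z) \<le> 5 / 4 * t"
      using d n norm_triangle_ineq2[of "e * of_real t" "fst z"] norm_triangle_ineq2[of "fst z" "e * of_real t"]
      by (simp_all add: dist_norm norm_minus_commute)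
    have "z \<in> Omega_tilde"
      using \<delta>lev[OF z2] t z1 by (intro corkscrew_in_Omega_tilde[of z \<theta> t]) (auto simp: level_def e_def)
    moreover have "dist (0, \<zeta>) z < r"
    proof -
      have "dist (0, \<zeta>) z \<le> dist 0 (fst z) + dist \<zeta> (snd z)"
        by (cases z) (simp add: dist_prod_def sqrt_sum_squares_le_sum)
      also have "\<dots> < 5 / 4 * t + \<delta>" using n1 z2 by (simp add: dist_commute)
      also have "\<dots> \<le> r" using t \<delta> by simp
      finally show ?thesis .
    qed
    ultimately show ?thesis using n1 by simp
  qed
  define \<Phi> where "\<Phi> x y = (norm (F x - F y))\<^sup>2 / norm (x - y) powr (4 + 2 * s)" for x y :: "complex \<times> complex"
  define L where "L = 3 + 2 * K"
  have L: "L > 0" using K1 by (simp add: L_def)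
  define a where "a l = (m / 2 * (5 / 4 * \<rho> l) powr b)\<^sup>2 / (L * \<rho> l) powr (4 + 2 * s)" for l
  have a_nonneg: "a l \<ge> 0" for l by (simp add: a_def)
  let ?P = "\<lambda>z. z \<in> ball (0, \<zeta>) r \<inter> Omega_tilde \<longrightarrow>
      m * norm (fst z) powr b \<le> norm (F z) \<and> norm (F z) \<le> 2 * m * norm (fst z) powr b"
  have pointwise: "a l \<le> \<Phi> x y" if x: "x \<in> X l" "?P x" and y: "y \<in> Y l x" "?P y" for l x y
  proof -
    have x2: "dist (snd x) \<zeta> < \<delta> / 2" using x(1) by (auto simp: X_def dist_commute)
    have y2: "dist (snd x) (snd y) < \<rho> l" using y(1) by (auto simp: Y_def)
    have nx: "x \<in> ball (0, \<zeta>) r \<inter> Omega_tilde \<and> 3 / 4 * \<rho> l \<le> norm (fst x) \<and> norm (fst x) \<le> 5 / 4 * \<rho> l"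
    proof (rule near)
      have "1 * \<rho> l \<le> K * \<rho> l" using K1 \<rho>(1)[of l] by (intro mult_right_mono) auto
      then show "\<rho> l \<le> r / 4" using \<rho>K(2)[of l] by simp
    qed (use \<rho>[of l] \<rho>K[of l] x(1) x2 \<delta> in \<open>auto simp: X_def\<close>)
    have ny: "y \<in> ball (0, \<zeta>) r \<inter> Omega_tilde \<and> 3 / 4 * (K * \<rho> l) \<le> norm (fst y) \<and> norm (fst y) \<le> 5 / 4 * (K * \<rho> l)"
    proof (rule near)
      show "dist (snd y) \<zeta> < \<delta>"
        using dist_triangle[of "snd y" \<zeta> "snd x"] x2 y2 \<rho>[of l] \<rho>0(3) by (simp add: dist_commute)
    qed (use \<rho>[of l] \<rho>K[of l] K1 y(1) in \<open>auto simp: Y_def\<close>)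
    have xpos: "0 < norm (fst x)" "0 < norm (fst y)"
      using nx ny \<rho>[of l] K1 by (smt (verit) mult_pos_pos zero_less_divide_iff)+
    have "(5 / 4 * \<rho> l) powr b \<le> norm (fst x) powr b"
      using b nx xpos by (intro powr_mono2') auto
    then have "m * (5 / 4 * \<rho> l) powr b \<le> m * norm (fst x) powr b"
      using m by (intro mult_left_mono) simp_all
    also have "\<dots> \<le> norm (F x)" using x(2) nx by blast
    finally have Fx: "m * (5 / 4 * \<rho> l) powr b \<le> norm (F x)" .
    have "norm (fst y) powr b \<le> (3 / 4 * (K * \<rho> l)) powr b"
      using b ny \<rho>[of l] K1 by (intro powr_mono2') auto
    also have "3 / 4 * (K * \<rho> l) = 3 / 5 * K * (5 / 4 * \<rho> l)" by simp
    also have "(3 / 5 * K * (5 / 4 * \<rho> l)) powr b = (3 / 5 * K) powr b * (5 / 4 * \<rho> l) powr b"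
      by (rule powr_mult)
    also have "\<dots> = 1 / 4 * (5 / 4 * \<rho> l) powr b" by (simp only: Kb)
    finally have "2 * m * norm (fst y) powr b \<le> 2 * m * (1 / 4 * (5 / 4 * \<rho> l) powr b)"
      using m by (intro mult_left_mono) auto
    then have Fy: "norm (F y) \<le> m / 2 * (5 / 4 * \<rho> l) powr b"
      using y(2) ny by simp
    have "m / 2 * (5 / 4 * \<rho> l) powr b \<le> norm (F x) - norm (F y)" using Fx Fy by simp
    also have "\<dots> \<le> norm (F x - F y)" by (rule norm_triangle_ineq2)
    finally have num: "(m / 2 * (5 / 4 * \<rho> l) powr b)\<^sup>2 \<le> (norm (F x - F y))\<^sup>2"
      using m by (intro power_mono) auto
    have "norm (x - y) \<le> norm (fst x - fst y) + norm (snd x - snd y)"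
      by (simp add: norm_prod_def sqrt_sum_squares_le_sum)
    also have "\<dots> \<le> (norm (fst x) + norm (fst y)) + norm (snd x - snd y)"
      by (intro add_mono norm_triangle_ineq4) simp
    also have "\<dots> \<le> 5 / 4 * \<rho> l + 5 / 4 * (K * \<rho> l) + \<rho> l"
      using nx ny y2 by (intro add_mono) (auto simp: dist_norm)
    also have "\<dots> \<le> L * \<rho> l"
    proof -
      have "0 \<le> K * \<rho> l" using K1 \<rho>(1)[of l] by simp
      moreover have "L * \<rho> l = 3 * \<rho> l + 2 * (K * \<rho> l)" by (simp add: L_def algebra_simps)
      ultimately show ?thesis using \<rho>(1)[of l] by linarith
    qed
    finally have den: "norm (x - y) powr (4 + 2 * s) \<le> (L * \<rho> l) powr (4 + 2 * s)"
      using s by (intro powr_mono2) auto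
    have "x \<noteq> y"
    proof
      assume "x = y"
      then have "m / 2 * (5 / 4 * \<rho> l) powr b \<le> 0" using Fx Fy by simp
      then show False using m \<rho>[of l] by (simp add: mult_le_0_iff)
    qed
    then have "0 < norm (x - y) powr (4 + 2 * s)" by simp
    then show ?thesis unfolding a_def \<Phi>_def using num den by (intro frac_le) auto
  qed
  define A where "A l = ennreal (a l) * ennreal (pi\<^sup>2 * (K * \<rho> l / 4)\<^sup>2 * (\<rho> l)\<^sup>2)" for l
  have inner: "A l \<le> (\<integral>\<^sup>+y. ennreal (\<Phi> x y) \<partial>lborel)" if "x \<in> X l" "?P x" for l x
  proof -
    have "A l = (\<integral>\<^sup>+y. ennreal (a l) * indicator (Y l x) y \<partial>lborel)"
    proof (subst nn_integral_cmult_indicator)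
      show "Y l x \<in> sets lborel" unfolding Y_def by (simp add: borel_Times)
      show "A l = ennreal (a l) * emeasure lborel (Y l x)"
        unfolding A_def Y_def using \<rho>[of l] K1 by (subst emeasure_bidisc) auto
    qed
    also have "\<dots> \<le> (\<integral>\<^sup>+y. ennreal (\<Phi> x y) \<partial>lborel)"
    proof (rule nn_integral_mono_AE)
      show "AE y in lborel. ennreal (a l) * indicator (Y l x) y \<le> ennreal (\<Phi> x y)"
        using bounds
      proof eventually_elim
        case (elim y)
        then show ?case using pointwise[OF that, of y] by (auto simp: indicator_def intro: ennreal_leI)
      qed
    qed
    finally show ?thesis .
  qed
  have disj: "x \<notin> X l'" if "x \<in> X l" "l \<noteq> l'" for x l l'
  proof -
    have bd: "3 / 4 * \<rho> j < norm (fst x) \<and> norm (fst x) < 5 / 4 * \<rho> j" if "x \<in> X j" for j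
    proof -
      have d: "dist (fst x) (e * of_real (\<rho> j)) < \<rho> j / 4" using that by (auto simp: X_def dist_commute)
      have n: "norm (e * of_real (\<rho> j)) = \<rho> j" using \<rho>[of j] ne by (simp add: norm_mult)
      show ?thesis
        using d n norm_triangle_ineq2[of "e * of_real (\<rho> j)" "fst x"] norm_triangle_ineq2[of "fst x" "e * of_real (\<rho> j)"]
        by (simp add: dist_norm norm_minus_commute)
    qed
    have half: "\<rho> j \<le> \<rho> i / 2" if "i < j" for i j
    proof -
      have "(2 :: real) * 2 ^ i \<le> 2 ^ j" using that power_increasing[of "Suc i" j "2 :: real"] by simp
      then have "\<rho>0 / 2 ^ j \<le> \<rho>0 / (2 * 2 ^ i)" using \<rho>0(1) by (intro divide_left_mono) auto
      then show ?thesis by (simp add: \<rho>_def)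
    qed
    show ?thesis
    proof
      assume "x \<in> X l'"
      consider "l < l'" | "l' < l" using \<open>l \<noteq> l'\<close> by linarith
      then show False
        using bd[OF \<open>x \<in> X l\<close>] bd[OF \<open>x \<in> X l'\<close>] half[of l l'] half[of l' l] \<rho>[of l] \<rho>[of l'] by cases linarith+
    qed
  qed
  define I where "I = (\<integral>\<^sup>+x. \<integral>\<^sup>+y. ennreal (\<Phi> x y) \<partial>lborel \<partial>lborel)"
  have lower: "(\<Sum>l<n. A l * emeasure lborel (X l)) \<le> I" for n
  proof -
    have X: "X l \<in> sets lborel" for l unfolding X_def by (simp add: borel_Times)
    have "(\<Sum>l<n. A l * emeasure lborel (X l)) = (\<Sum>l<n. \<integral>\<^sup>+x. A l * indicator (X l) x \<partial>lborel)"
      using X by (simp add: nn_integral_cmult_indicator)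
    also have "\<dots> = (\<integral>\<^sup>+x. (\<Sum>l<n. A l * indicator (X l) x) \<partial>lborel)"
      using X by (intro nn_integral_sum[symmetric] borel_measurable_times_ennreal borel_measurable_const borel_measurable_indicator)
    also have "\<dots> \<le> I"
      unfolding I_def
    proof (rule nn_integral_mono_AE)
      show "AE x in lborel. (\<Sum>l<n. A l * indicator (X l) x) \<le> (\<integral>\<^sup>+y. ennreal (\<Phi> x y) \<partial>lborel)"
        using bounds
      proof eventually_elim
        case (elim x)
        show ?case
        proof (cases "\<exists>l<n. x \<in> X l")
          case False
          then have "(\<Sum>l<n. A l * indicator (X l) x) = 0" by (intro sum.neutral) auto
          then show ?thesis by simp
        next
          case True
          then obtain l where l: "l < n" "x \<in> X l" by blast
          have "(\<Sum>j<n. A j * indicator (X j) x) = (\<Sum>j<n. if j = l then A l else 0)"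
            using disj[OF l(2)] l(2) by (intro sum.cong refl) (auto simp: indicator_def)
          also have "\<dots> = A l" using l(1) by simp
          also have "\<dots> \<le> (\<integral>\<^sup>+y. ennreal (\<Phi> x y) \<partial>lborel)" by (rule inner[OF l(2) elim])
          finally show ?thesis .
        qed
      qed
    qed
    finally show ?thesis .
  qed
  define \<kappa> where "\<kappa> = (m / 2 * (5 / 4) powr b)\<^sup>2 / L powr (4 + 2 * s) * (pi\<^sup>2 * (K / 4)\<^sup>2) * (pi\<^sup>2 * (1 / 4)\<^sup>2 * (\<delta> / 2)\<^sup>2)"
  have \<kappa>: "\<kappa> > 0" using m L K1 \<delta> by (simp add: \<kappa>_def)
  have term_ge: "ennreal \<kappa> \<le> A l * emeasure lborel (X l)" for l
  proof -
    have p: "\<rho> l > 0" by (rule \<rho>)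
    have "emeasure lborel (X l) = ennreal (pi\<^sup>2 * (\<rho> l / 4)\<^sup>2 * (\<delta> / 2)\<^sup>2)"
      unfolding X_def using p \<delta> by (intro emeasure_bidisc) auto
    then have eq: "A l * emeasure lborel (X l) =
        ennreal (a l * (pi\<^sup>2 * (K * \<rho> l / 4)\<^sup>2 * (\<rho> l)\<^sup>2) * (pi\<^sup>2 * (\<rho> l / 4)\<^sup>2 * (\<delta> / 2)\<^sup>2))"
      using a_nonneg[of l] by (simp add: A_def ennreal_mult)
    have pw: "(\<rho> l powr b)\<^sup>2 * (\<rho> l ^ 6 / \<rho> l powr (4 + 2 * s)) = \<rho> l powr (2 * b + 2 - 2 * s)"
    proof -
      have "(\<rho> l powr b)\<^sup>2 = \<rho> l powr (2 * b)" by (simp add: power2_eq_square powr_add[symmetric])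
      moreover have "\<rho> l ^ 6 = \<rho> l powr 6" using p by (simp add: powr_numeral)
      ultimately have "(\<rho> l powr b)\<^sup>2 * (\<rho> l ^ 6 / \<rho> l powr (4 + 2 * s)) = \<rho> l powr (2 * b) * \<rho> l powr (6 - (4 + 2 * s))"
        by (simp only: powr_diff)
      also have "\<dots> = \<rho> l powr (2 * b + 2 - 2 * s)" by (simp add: powr_add[symmetric] algebra_simps)
      finally show ?thesis .
    qed
    have "a l * (pi\<^sup>2 * (K * \<rho> l / 4)\<^sup>2 * (\<rho> l)\<^sup>2) * (pi\<^sup>2 * (\<rho> l / 4)\<^sup>2 * (\<delta> / 2)\<^sup>2) =
        \<kappa> * ((\<rho> l powr b)\<^sup>2 * (\<rho> l ^ 6 / \<rho> l powr (4 + 2 * s)))"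
    proof -
      have 1: "(5 / 4 * \<rho> l) powr b = (5 / 4) powr b * \<rho> l powr b" by (rule powr_mult)
      have 2: "(L * \<rho> l) powr (4 + 2 * s) = L powr (4 + 2 * s) * \<rho> l powr (4 + 2 * s)" by (rule powr_mult)
      have 3: "x\<^sup>2 / (u * v) * (q * (K * t / 4)\<^sup>2 * t\<^sup>2) * (q * (t / 4)\<^sup>2 * y) =
          x\<^sup>2 / u * (q * (K / 4)\<^sup>2) * (q * (1 / 4)\<^sup>2 * y) * (t ^ 6 / v)" for x u v q t y :: real
        by (simp add: power2_eq_square power_numeral_reduce mult_ac)
      show ?thesis unfolding a_def \<kappa>_def 1 2 3 by (simp add: power_mult_distrib power_divide mult_ac)
    qed
    also have "\<dots> = \<kappa> * \<rho> l powr (2 * b + 2 - 2 * s)" unfolding pw by simp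
    also have "\<dots> \<ge> \<kappa> * 1"
    proof (intro mult_left_mono)
      have "\<rho> l powr 0 \<le> \<rho> l powr (2 * b + 2 - 2 * s)"
        using s p \<rho>K(3)[of l] by (intro powr_mono') auto
      then show "1 \<le> \<rho> l powr (2 * b + 2 - 2 * s)" using p by simp
    qed (use \<kappa> in simp)
    finally show ?thesis unfolding eq by (intro ennreal_leI) simp
  qed
  have "I < \<infinity>"
  proof -
    let ?G = "\<lambda>p. \<Phi> (fst p) (snd p)"
    have int: "integrable (lborel \<Otimes>\<^sub>M lborel) ?G"
      using fin by (simp add: finite_gagliardo_def \<Phi>_def case_prod_beta')
    then have "(\<integral>\<^sup>+p. ennreal (norm (?G p)) \<partial>(lborel \<Otimes>\<^sub>M lborel)) < \<infinity>"
      by (simp add: integrable_iff_bounded)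
    moreover have "norm (\<Phi> x y) = \<Phi> x y" for x y by (simp add: \<Phi>_def)
    moreover have "(\<integral>\<^sup>+x. \<integral>\<^sup>+y. ennreal (?G (x, y)) \<partial>lborel \<partial>lborel) = (\<integral>\<^sup>+p. ennreal (?G p) \<partial>(lborel \<Otimes>\<^sub>M lborel))"
      using borel_measurable_integrable[OF int] by (intro lborel.nn_integral_fst) simp
    ultimately show ?thesis by (simp add: I_def)
  qed
  then obtain B where B: "I = ennreal B" "B \<ge> 0" by (cases I rule: ennreal_cases) auto
  obtain n :: nat where n: "B < real n * \<kappa>"
    using reals_Archimedean3[OF \<kappa>] by blast
  have "ennreal (real n * \<kappa>) = (\<Sum>l<n. ennreal \<kappa>)" using \<kappa> by (simp add: ennreal_mult ennreal_of_nat_eq_real_of_nat)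
  also have "\<dots> \<le> (\<Sum>l<n. A l * emeasure lborel (X l))" by (intro sum_mono term_ge)
  also have "\<dots> \<le> ennreal B" using lower[of n] B by simp
  finally have "real n * \<kappa> \<le> B" using B(2) by (simp add: ennreal_le_iff)
  with n show False by simp
qed

section \<open>Irregularity of the projections\<close>

text \<open>Some member of the partition of unity is positive at the boundary point over \<open>(0, 1)\<close>. In its chart that
point is again of the form \<open>(0, \<zeta>)\<close>, since the deck group fixes \<open>z\<^sub>1 = 0\<close>, and near it the cut-off function varies
by at most a factor of two.\<close>

lemma edge_power_not_sobolev:
  fixes f :: "pt \<Rightarrow> complex" and b \<kappa> s :: real
  assumes b: "b < 0" and s: "0 < s" "s < 1" "1 + b \<le> s" and c: "c \<noteq> 0"
    and f: "\<And>z. z \<in> Omega_tilde \<Longrightarrow> f (proj_mu \<mu> z) = c * edge_power \<kappa> b z"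
  shows "f \<notin> sobolev_Omega \<mu> s"
proof
  assume "f \<in> sobolev_Omega \<mu> s"
  then have "\<exists>(n::nat) V (\<eta> :: nat \<Rightarrow> pt \<Rightarrow> real).
     (\<forall>j<n. open (V j) \<and> V j \<subseteq> Mtilde \<and> inj_on (proj_mu \<mu>) (V j)) \<and>
     (\<forall>j<n. smooth_on Mtilde (\<eta> j \<circ> proj_mu \<mu>) \<and> (\<forall>x\<in>M_mu \<mu>. 0 \<le> \<eta> j x) \<and>
        (M_top \<mu>) closure_of {x \<in> M_mu \<mu>. \<eta> j x \<noteq> 0} \<subseteq> proj_mu \<mu> ` V j) \<and>
     (\<forall>x\<in>Omega_closure \<mu>. (\<Sum>j<n. \<eta> j x) = 1) \<and>
     (\<forall>j<n. \<exists>F\<in>sobolev_space s. AE z in lborel. z \<in> V j \<inter> Omega_tilde \<longrightarrow>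
        F z = of_real (\<eta> j (proj_mu \<mu> z)) * f (proj_mu \<mu> z))"
    unfolding sobolev_Omega_def mem_Collect_eq .
  then obtain n :: nat and V and \<eta> :: "nat \<Rightarrow> pt \<Rightarrow> real" where
    V': "\<forall>j<n. open (V j) \<and> V j \<subseteq> Mtilde \<and> inj_on (proj_mu \<mu>) (V j)"
    and \<eta>': "\<forall>j<n. smooth_on Mtilde (\<eta> j \<circ> proj_mu \<mu>) \<and> (\<forall>x\<in>M_mu \<mu>. 0 \<le> \<eta> j x) \<and>
        (M_top \<mu>) closure_of {x \<in> M_mu \<mu>. \<eta> j x \<noteq> 0} \<subseteq> proj_mu \<mu> ` V j"
    and sum1: "\<forall>x\<in>Omega_closure \<mu>. (\<Sum>j<n. \<eta> j x) = 1"
    and F': "\<forall>j<n. \<exists>F\<in>sobolev_space s. AE z in lborel. z \<in> V j \<inter> Omega_tilde \<longrightarrow>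
        F z = of_real (\<eta> j (proj_mu \<mu> z)) * f (proj_mu \<mu> z)"
    by (elim exE conjE) (rule that)
  note V = V'[rule_format] and \<eta> = \<eta>'[THEN spec, THEN mp] and F = F'[rule_format]
  define x0 where "x0 = proj_mu \<mu> (0, 1)"
  have M01: "(0, 1) \<in> Mtilde" by (simp add: Mtilde_def)
  then have x0M: "x0 \<in> M_mu \<mu>" unfolding x0_def by (rule proj_mu_in_M_mu)
  have "x0 \<in> Omega_closure \<mu>"
    unfolding Omega_closure_def in_closure_of topspace_M_top
  proof (intro conjI allI impI)
    fix U assume U: "x0 \<in> U \<and> openin (M_top \<mu>) U"
    let ?W = "{z \<in> Mtilde. proj_mu \<mu> z \<in> U}"
    have "open ?W" "(0, 1) \<in> ?W" using U M01 by (auto simp: openin_M_top x0_def)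
    then have "\<exists>e>0. ball (0, 1) e \<subseteq> ?W" unfolding open_contains_ball by (rule bspec)
    then obtain e where e: "e > 0" "ball (0, 1) e \<subseteq> ?W" by blast
    define t where "t = min (e / 2) (1 / 2)"
    have t: "0 < t" "t < e" "t < 1" using e by (auto simp: t_def)
    have "(- of_real t, 1) \<in> ball (0 :: complex, 1 :: complex) e" using t by (simp add: dist_Pair_Pair)
    then have "(- of_real t, 1) \<in> ?W" using e by blast
    moreover have "(- of_real t, 1) \<in> Omega_tilde"
    proof -
      have "disc_coord (- of_real t, 1) = of_real t" by (simp add: disc_coord_def level_def)
      moreover have "dist 1 (complex_of_real t) = 1 - t"
        using t by (metis abs_of_pos diff_gt_0_iff_gt dist_norm norm_of_real of_real_1 of_real_diff)
      ultimately show ?thesis using t by (simp add: Omega_tilde_iff Mtilde_def)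
    qed
    ultimately show "\<exists>y. y \<in> Omega \<mu> \<and> y \<in> U" by (auto simp: Omega_def)
  qed (rule x0M)
  then have "(\<Sum>j<n. \<eta> j x0) \<noteq> 0" using sum1 by simp
  then obtain j where j: "j < n" "\<eta> j x0 \<noteq> 0" by (metis lessThan_iff sum.neutral)
  have "x0 \<in> (M_top \<mu>) closure_of {x \<in> M_mu \<mu>. \<eta> j x \<noteq> 0}"
    using closure_of_subset[of "{x \<in> M_mu \<mu>. \<eta> j x \<noteq> 0}" "M_top \<mu>"] j x0M by (auto simp: topspace_M_top)
  then obtain q where q: "q \<in> V j" "x0 = proj_mu \<mu> q" using \<eta>[OF j(1)] by blast
  have qM: "q \<in> Mtilde" using V[OF j(1)] q by blast
  have "((0, 1), q) \<in> deck_rel \<mu>" using q(2) M01 qM by (simp add: x0_def proj_mu_eq_iff)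
  then have "(fst (0 :: complex, 1 :: complex) = 0) = (fst q = 0)"
    by (rule deck_rel_invariant[where U = "\<lambda>z. fst z = 0"]) (simp add: deck_def)
  then obtain \<zeta> where \<zeta>: "q = (0, \<zeta>)" "\<zeta> \<noteq> 0" using qM by (cases q) (auto simp: Mtilde_def)
  define h where "h z = \<eta> j (proj_mu \<mu> z)" for z
  define h0 where "h0 = \<eta> j x0"
  have h0: "h0 > 0" using j \<eta>[OF j(1)] x0M by (auto simp: h0_def less_le)
  have "continuous_on Mtilde (\<eta> j \<circ> proj_mu \<mu>)"
    using \<eta>[OF j(1)] unfolding smooth_on_def by (metis Ck_on.simps(1))
  then have "isCont h q"
    using qM open_Mtilde by (simp add: continuous_on_eq_continuous_at h_def[abs_def] o_def)
  then obtain r1 where r1: "r1 > 0" "\<And>z. dist z q < r1 \<Longrightarrow> dist (h z) (h q) < h0 / 3"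
    unfolding continuous_at_eps_delta using h0 by (metis zero_less_divide_iff zero_less_numeral)
  obtain r2 where r2: "r2 > 0" "ball q r2 \<subseteq> V j"
    using V[OF j(1)] q(1) by (metis open_contains_ball)
  define r where "r = min r1 r2"
  have r: "r > 0" using r1 r2 by (simp add: r_def)
  obtain F where F: "F \<in> sobolev_space s"
    and AE: "AE z in lborel. z \<in> V j \<inter> Omega_tilde \<longrightarrow> F z = of_real (\<eta> j (proj_mu \<mu> z)) * f (proj_mu \<mu> z)"
    using F[OF j(1)] by blast
  \<comment> \<open>the cut-off lies between \<open>2/3\<close> and \<open>4/3\<close> of its value \<open>h0\<close> at \<open>q\<close>\<close>
  define m where "m = 2 / 3 * h0 * norm c"
  have m: "m > 0" using h0 c by (simp add: m_def)
  have bounds: "AE z in lborel. z \<in> ball (0, \<zeta>) r \<inter> Omega_tilde \<longrightarrow>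
      m * norm (fst z) powr b \<le> norm (F z) \<and> norm (F z) \<le> 2 * m * norm (fst z) powr b"
    using AE
  proof eventually_elim
    case (elim z)
    show ?case
    proof
      assume z: "z \<in> ball (0, \<zeta>) r \<inter> Omega_tilde"
      then have zq: "dist z q < r1" "z \<in> ball q r2" by (auto simp: \<zeta> r_def dist_commute)
      then have "F z = of_real (h z) * (c * edge_power \<kappa> b z)"
        using elim r2 z f by (auto simp: h_def)
      moreover have "h q = h0" by (simp add: h_def h0_def q(2))
      then have "\<bar>h z - h0\<bar> < h0 / 3" using r1(2)[OF zq(1)] by (simp add: dist_real_def)
      then have hz: "2 / 3 * h0 \<le> h z" "h z \<le> 4 / 3 * h0" by linarith+
      ultimately have nF: "norm (F z) = h z * (norm c * norm (fst z) powr b)"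
        using h0 by (simp add: norm_mult norm_edge_power)
      have "2 / 3 * h0 * (norm c * norm (fst z) powr b) \<le> h z * (norm c * norm (fst z) powr b)"
        "h z * (norm c * norm (fst z) powr b) \<le> 4 / 3 * h0 * (norm c * norm (fst z) powr b)"
        using hz by (intro mult_right_mono; simp)+
      then show "m * norm (fst z) powr b \<le> norm (F z) \<and> norm (F z) \<le> 2 * m * norm (fst z) powr b"
        by (simp add: nF m_def mult_ac)
    qed
  qed
  have "\<not> finite_gagliardo s F"
    by (rule gagliardo_edge_power_infinite[OF b s(1,3) m r \<zeta>(2) bounds])
  moreover have "finite_gagliardo s F"
  proof -
    have "\<lfloor>s\<rfloor> = 0" using s by (simp add: floor_eq_iff)
    then show ?thesis using F s by (simp add: sobolev_space_def frac_def)
  qed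
  ultimately show False by simp
qed

lemma phase_projection_not_sobolev:
  fixes k :: int
  assumes \<mu>: "\<mu> > 0" and I: "I \<in> form_index p" and b: "b = k / \<mu> - frame_degree 1 I" "-1 < b" "b < 0"
    and s: "1 + b \<le> s" "s < 1"
  shows "\<exists>f \<in> smooth_forms_closure \<mu> p. bergman_proj \<mu> p f \<notin> sobolev_forms \<mu> s p"
proof
  let ?f = "\<lambda>J x. if J = I then descend \<mu> (phase (k / \<mu>)) x else 0"
  have "?f J \<in> smooth_closure \<mu>" for J
    using smooth_closure_phase[OF \<mu>, of k] smooth_closure_zero[of \<mu>] by (cases "J = I") auto
  then show "?f \<in> smooth_forms_closure \<mu> p" by (simp add: smooth_forms_closure_def)
  obtain c where c: "c \<noteq> 0" "\<And>z. z \<in> Omega_tilde \<Longrightarrow>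
      bergman_proj \<mu> p ?f I (proj_mu \<mu> z) = c * edge_power (k / \<mu>) b z"
    using bergman_proj_phase[OF \<mu> I b(1,2)] b(3) by (metis less_imp_le)
  have "bergman_proj \<mu> p ?f I \<notin> sobolev_Omega \<mu> s"
    using s b by (intro edge_power_not_sobolev[OF b(3) _ s(2,1) c]) auto
  then show "bergman_proj \<mu> p ?f \<notin> sobolev_forms \<mu> s p"
    using I by (auto simp: sobolev_forms_def)
qed

theorem theorem7p3:
  fixes \<mu> :: real
  assumes "\<mu> > 1"
  shows "(\<forall>s::real. (1 - real_of_int \<lfloor>\<mu>\<rfloor>) / \<mu> + 1 \<le> s \<and> s < 1 / 2 \<longrightarrow>
            (\<exists>f \<in> smooth_forms_closure \<mu> 0. bergman_proj \<mu> 0 f \<notin> sobolev_forms \<mu> s 0))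
       \<and> (\<forall>(s::real) (p::nat). 1 / \<mu> \<le> s \<and> s < 1 / 2 \<and> p \<in> {1, 2} \<longrightarrow>
            (\<exists>f \<in> smooth_forms_closure \<mu> p. bergman_proj \<mu> p f \<notin> sobolev_forms \<mu> s p))"
proof (intro conjI allI impI)
  fix s :: real
  assume s: "(1 - real_of_int \<lfloor>\<mu>\<rfloor>) / \<mu> + 1 \<le> s \<and> s < 1 / 2"
  \<comment> \<open>\<open>b > -1\<close>: the generator is square integrable\<close>
  have "- \<mu> < 1 - of_int \<lfloor>\<mu>\<rfloor>" using of_int_floor_le[of \<mu>] by linarith
  then have "-1 < (1 - of_int \<lfloor>\<mu>\<rfloor>) / \<mu>" using assms by (simp add: field_simps)
  then show "\<exists>f \<in> smooth_forms_closure \<mu> 0. bergman_proj \<mu> 0 f \<notin> sobolev_forms \<mu> s 0"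
    using s assms
    by (intro phase_projection_not_sobolev[where I = "{}" and k = "1 - \<lfloor>\<mu>\<rfloor>" and b = "(1 - real_of_int \<lfloor>\<mu>\<rfloor>) / \<mu>"])
      (auto simp: form_index_def frame_degree_def)
next
  fix s :: real and p :: nat
  assume s: "1 / \<mu> \<le> s \<and> s < 1 / 2 \<and> p \<in> {1, 2}"
  define I :: "nat set" where "I = (if p = 1 then {1} else {1, 2})"
  have "I \<in> form_index p" "1 \<in> I" using s by (auto simp: I_def form_index_def)
  then show "\<exists>f \<in> smooth_forms_closure \<mu> p. bergman_proj \<mu> p f \<notin> sobolev_forms \<mu> s p"
    using s assms
    by (intro phase_projection_not_sobolev[where I = I and k = 1 and b = "1 / \<mu> - 1"]) (auto simp: frame_degree_def)
qed

end
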